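(* For integers $n\ge1$ and $k\ge0$, let $$\gamma_{n,k}(\mathbf{x}):=\sum_{D\in\mathcal H_{n,k}}s_D(\mathbf{x}),$$ where $s_D(\mathbf{x})$ is the skew Schur function of shape $D$. Then for all $n\ge1$, $$Q_n(\mathbf{x},t)=\sum_{k=0}^{\lfloor\frac{n-1}{2}\rfloor}\gamma_{n,k}(\mathbf{x})\,t^k(1+t)^{n-1-2k}.$$ Consequently the polynomial $Q_n(\mathbf{x},t)$ is Schur-$\gamma$-positive.
   Context: Let $\mathbf{x}=(x_1,x_2,\dots)$, let $\Lambda$ be the $\mathbb{R}$-algebra of symmetric functions in $\mathbf{x}$, let $h_n(\mathbf{x})$ be the complete homogeneous symmetric function of degree $n$, and let $H(z):=\sum_{n\ge0}h_n(\mathbf{x})z^n$. The polynomials $Q_n(\mathbf{x},t)\in\Lambda[t]$ are defined by $$\sum_{n\ge0}Q_n(\mathbf{x},t)z^n:=\frac{(1-t)H(z)}{H(tz)-tH(z)}.$$ A skew hook is a connected skew diagram (English notation, considered up to translation) containing no $2\times2$ square. $\mathcal H_{n,k}$ is the set of skew hooks of size $n$ (i.e. with $n$ cells) for which $k$ columns have size $2$ and the remaining $n-2k$ columns, including the last (rightmost) column, have size $1$. A symmetric function is Schur-positive if its expansion in the basis of Schur functions has nonnegative coefficients. A polynomial $A(t)\in\Lambda[t]$ is Schur-$\gamma$-positive if for some $d$ there exist Schur-positive $\gamma_0,\dots,\gamma_{\lfloor d/2\rfloor}\in\Lambda$ such that $A(t)=\sum_{k=0}^{\lfloor d/2\rfloor}\gamma_kt^k(1+t)^{d-2k}$.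 *)

theory Defs
  imports
    "HOL-Library.Poly_Mapping"
    "HOL-Library.FuncSet"
    "HOL-Computational_Algebra.Computational_Algebra"
begin

section \<open>Formal power series in countably many variables\<close>

text \<open>
  A monomial in the variables \<open>x\<^sub>1, x\<^sub>2, \<dots>\<close> is its exponent vector, a finitely supported function on
  the naturals; the index \<open>i\<close> stands for the variable \<open>x\<^sub>i\<^sub>+\<^sub>1\<close>.
  The algebra \<open>\<Lambda>\<close> is carved out below as a subset of the ring of all formal power series.
\<close>

type_synonym xmonom = "nat \<Rightarrow>\<^sub>0 nat"

typedef xseries = "UNIV :: (xmonom \<Rightarrow> real) set"
  morphisms xcoeff Abs_xseries
  by simp

lemma xcoeff_Abs [simp]: "xcoeff (Abs_xseries f) m = f m"
  by (simp add: Abs_xseries_inverse)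

lemma xseries_eqI: "(\<And>m. xcoeff f m = xcoeff g m) \<Longrightarrow> f = g"
  by (metis ext xcoeff_inject)

definition splits :: "xmonom \<Rightarrow> (xmonom \<times> xmonom) set" where
  "splits m = {(a, b). a + b = m}"

lemma finite_splits [simp]: "finite (splits m)"
proof -
  let ?F = "{f. \<forall>i. (i \<in> Poly_Mapping.keys m \<longrightarrow> f i \<in> {..Max (range (Poly_Mapping.lookup m))})
                  \<and> (i \<notin> Poly_Mapping.keys m \<longrightarrow> f i = (0::nat))}"
  have fr: "finite (range (Poly_Mapping.lookup m))"
  proof (rule finite_subset)
    show "range (Poly_Mapping.lookup m) \<subseteq> insert 0 (Poly_Mapping.lookup m ` Poly_Mapping.keys m)"
      by (auto simp: in_keys_iff)
  qed simp
  have "finite ?F"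
    by (rule finite_set_of_finite_funs) auto
  moreover have "(\<lambda>(a, b). Poly_Mapping.lookup a) ` splits m \<subseteq> ?F"
  proof (clarsimp simp: splits_def, intro conjI impI)
    fix a b :: xmonom and i
    show "Poly_Mapping.lookup a i \<le> Max (range (Poly_Mapping.lookup (a + b)))"
      if "m = a + b"
    proof -
      have "Poly_Mapping.lookup a i \<le> Poly_Mapping.lookup (a + b) i"
        by (simp add: lookup_add)
      also have "\<dots> \<le> Max (range (Poly_Mapping.lookup (a + b)))"
        using fr that by (intro Max_ge) auto
      finally show ?thesis .
    qed
    show "Poly_Mapping.lookup a i = 0" if "i \<notin> Poly_Mapping.keys (a + b)"
      using that by (simp add: in_keys_iff lookup_add)
  qed
  moreover have "inj_on (\<lambda>(a, b). Poly_Mapping.lookup a) (splits m)"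
    by (auto simp: inj_on_def splits_def lookup_inject)
  ultimately show ?thesis
    using finite_imageD finite_subset by blast
qed

instantiation xseries :: "{zero, one, plus, minus, uminus, times, scaleR}"
begin
definition "0 = Abs_xseries (\<lambda>m. 0)"
definition "1 = Abs_xseries (\<lambda>m. if m = 0 then 1 else 0)"
definition "f + g = Abs_xseries (\<lambda>m. xcoeff f m + xcoeff g m)"
definition "f - g = Abs_xseries (\<lambda>m. xcoeff f m - xcoeff g m)"
definition "- f = Abs_xseries (\<lambda>m. - xcoeff f m)"
definition "f * g = Abs_xseries (\<lambda>m. \<Sum>(a, b)\<in>splits m. xcoeff f a * xcoeff g b)"
definition "scaleR r f = Abs_xseries (\<lambda>m. r * xcoeff f m)"
instance ..
end

lemma xcoeff_simps [simp]:
  "xcoeff 0 m = 0"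
  "xcoeff 1 m = (if m = 0 then 1 else 0)"
  "xcoeff (f + g) m = xcoeff f m + xcoeff g m"
  "xcoeff (f - g) m = xcoeff f m - xcoeff g m"
  "xcoeff (- f) m = - xcoeff f m"
  "xcoeff (r *\<^sub>R f) m = r * xcoeff f m"
  by (simp_all add: zero_xseries_def one_xseries_def plus_xseries_def minus_xseries_def
      uminus_xseries_def scaleR_xseries_def)

lemma xcoeff_mult: "xcoeff (f * g) m = (\<Sum>(a, b)\<in>splits m. xcoeff f a * xcoeff g b)"
  by (simp add: times_xseries_def)

instance xseries :: "{comm_ring_1, real_algebra_1}"
proof
  fix f g h :: xseries and r s :: real
  show comm: "f * g = g * f" for f g :: xseries
  proof (rule xseries_eqI, unfold xcoeff_mult)
    fix m
    show "(\<Sum>(a, b)\<in>splits m. xcoeff f a * xcoeff g b) = (\<Sum>(a, b)\<in>splits m. xcoeff g a * xcoeff f b)"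
      by (rule sum.reindex_bij_witness[where i = prod.swap and j = prod.swap])
        (auto simp: splits_def add.commute mult.commute)
  qed
  show "f * g * h = f * (g * h)"
  proof (rule xseries_eqI)
    fix m
    have "xcoeff (f * g * h) m =
        (\<Sum>(p, q)\<in>(SIGMA p:splits m. splits (fst p)).
          xcoeff f (fst q) * xcoeff g (snd q) * xcoeff h (snd p))"
      by (simp add: xcoeff_mult sum_distrib_right split_beta sum.Sigma)
    also have "\<dots> = (\<Sum>(p, q)\<in>(SIGMA p:splits m. splits (snd p)).
          xcoeff f (fst p) * (xcoeff g (fst q) * xcoeff h (snd q)))"
      by (rule sum.reindex_bij_witness
          [where i = "\<lambda>(p, q). ((fst p + fst q, snd q), (fst p, fst q))"
             and j = "\<lambda>(p, q). ((fst q, snd q + snd p), (snd q, snd p))"])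
        (auto simp: splits_def add.assoc mult.assoc)
    also have "\<dots> = xcoeff (f * (g * h)) m"
      by (simp add: xcoeff_mult sum_distrib_left split_beta sum.Sigma)
    finally show "xcoeff (f * g * h) m = xcoeff (f * (g * h)) m" .
  qed
  show one: "1 * f = f" for f :: xseries
  proof (rule xseries_eqI)
    fix m
    have "xcoeff (1 * f) m = (\<Sum>p\<in>splits m. if p = (0, m) then xcoeff f m else 0)"
      unfolding xcoeff_mult by (rule sum.cong) (auto simp: splits_def split: if_splits)
    also have "\<dots> = xcoeff f m"
      by (subst sum.delta[OF finite_splits]) (simp add: splits_def)
    finally show "xcoeff (1 * f) m = xcoeff f m" .
  qed
  show "f * 1 = f"
    by (metis comm one)
  show "(f + g) * h = f * h + g * h"
    by (rule xseries_eqI) (simp add: xcoeff_mult sum.distrib[symmetric] algebra_simps split_beta)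
  show "f * (g + h) = f * g + f * h"
    by (rule xseries_eqI) (simp add: xcoeff_mult sum.distrib[symmetric] algebra_simps split_beta)
  show "(0::xseries) \<noteq> 1"
    by (metis xcoeff_simps(1,2) zero_neq_one)
  show "r *\<^sub>R f * g = r *\<^sub>R (f * g)"
    by (rule xseries_eqI) (simp add: xcoeff_mult sum_distrib_left split_beta mult.assoc)
  show "f * r *\<^sub>R g = r *\<^sub>R (f * g)"
    by (rule xseries_eqI) (simp add: xcoeff_mult sum_distrib_left split_beta mult_ac)
qed (auto intro!: xseries_eqI simp: algebra_simps)

section \<open>Symmetric functions\<close>

definition mdeg :: "xmonom \<Rightarrow> nat" where
  "mdeg m = (\<Sum>i\<in>Poly_Mapping.keys m. Poly_Mapping.lookup m i)"

definition Sym :: "xseries set" (\<open>\<Lambda>\<close>) where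
  "\<Lambda> = {f.
     (\<forall>\<pi> m m'. bij \<pi> \<and> (\<forall>i. Poly_Mapping.lookup m' i = Poly_Mapping.lookup m (\<pi> i))
        \<longrightarrow> xcoeff f m' = xcoeff f m) \<and>
     (\<exists>d. \<forall>m. xcoeff f m \<noteq> 0 \<longrightarrow> mdeg m \<le> d)}"

definition complete_h :: "nat \<Rightarrow> xseries" where
  "complete_h n = Abs_xseries (\<lambda>m. if mdeg m = n then 1 else 0)"

section \<open>The polynomials \<open>Q\<^sub>n\<close>\<close>

abbreviation tvar :: "xseries poly" where
  "tvar \<equiv> [:0, 1:]"

definition H_gf :: "xseries poly fps" where
  "H_gf = Abs_fps (\<lambda>n. [:complete_h n:])"

text \<open>
  The quotient \<open>(1 - t) H(z) / (H(t z) - t H(z))\<close>. The constant term \<open>1 - t\<close> of the denominator is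
  not a unit of the coefficient ring, but the quotient exists and is unique (\<open>ex1_Q_gf\<close>).
\<close>

definition Q_gf :: "xseries poly fps" where
  "Q_gf = (THE F. F * ((H_gf oo (fps_const tvar * fps_X)) - fps_const tvar * H_gf)
                    = fps_const (1 - tvar) * H_gf)"

definition Q :: "nat \<Rightarrow> xseries poly" where
  "Q n = fps_nth Q_gf n"

lemma mdeg_eq_0_iff: "mdeg m = 0 \<longleftrightarrow> m = 0"
  by (auto simp: mdeg_def in_keys_iff intro!: poly_mapping_eqI)

lemma complete_h_0 [simp]: "complete_h 0 = 1"
  by (rule xseries_eqI) (simp add: complete_h_def mdeg_eq_0_iff)

lemma one_minus_tvar_cancel:
  assumes "(1 - tvar) * p = (1 - tvar) * q"
  shows "p = q"
proof -
  have "coeff p n = coeff q n" for n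
  proof (induction n)
    case 0
    from arg_cong[OF assms, of "\<lambda>p. coeff p 0"] show ?case
      by (simp add: one_pCons)
  next
    case (Suc n)
    from arg_cong[OF assms, of "\<lambda>p. coeff p (Suc n)"] Suc show ?case
      by (simp add: algebra_simps)
  qed
  then show ?thesis by (rule poly_eqI)
qed

lemma ex1_Q_gf:
  "\<exists>!F. F * ((H_gf oo (fps_const tvar * fps_X)) - fps_const tvar * H_gf)
          = fps_const (1 - tvar) * H_gf"
proof -
  define E :: "xseries poly fps" where
    "E = Abs_fps (\<lambda>n. if n = 0 then 1 else - (\<Sum>i=1..<n. tvar ^ i * [:complete_h n:]))"
  have tsum: "(1 - tvar) * (\<Sum>i=1..<n. tvar ^ i) = tvar - tvar ^ n" if "n > 0" for n
    using that
  proof (induction n rule: nat_induct_non_zero)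
    case (Suc n)
    then show ?case
      by (simp add: sum.atLeastLessThan_Suc distrib_left del: mult_pCons_left) (simp add: algebra_simps)
  qed simp
  have den: "(H_gf oo (fps_const tvar * fps_X)) - fps_const tvar * H_gf = fps_const (1 - tvar) * E"
  proof (rule fps_ext)
    fix n
    have "fps_nth (H_gf oo (fps_const tvar * fps_X)) n = tvar ^ n * [:complete_h n:]"
      by (simp add: fps_compose_linear H_gf_def)
    then show "fps_nth ((H_gf oo (fps_const tvar * fps_X)) - fps_const tvar * H_gf) n =
        fps_nth (fps_const (1 - tvar) * E) n"
    proof (cases "n = 0")
      case False
      have "fps_nth (fps_const (1 - tvar) * E) n =
          - (((1 - tvar) * (\<Sum>i=1..<n. tvar ^ i)) * [:complete_h n:])"
        using False by (simp only: E_def fps_mult_left_const_nth fps_nth_Abs_fps if_False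
            sum_distrib_right[symmetric] mult_minus_right mult.assoc)
      also have "\<dots> = tvar ^ n * [:complete_h n:] - tvar * [:complete_h n:]"
        using False by (subst tsum) (auto simp only: left_diff_distrib neq0_conv minus_diff_eq)
      finally show ?thesis
        using \<open>fps_nth (H_gf oo _) n = _\<close>
        by (simp only: fps_sub_nth fps_mult_left_const_nth) (simp add: H_gf_def)
    qed (simp add: E_def H_gf_def one_pCons)
  qed
  define E' where "E' = fps_right_inverse E 1"
  have E': "E * E' = 1"
    unfolding E'_def by (rule fps_right_inverse) (simp add: E_def)
  show ?thesis
    unfolding den
  proof (rule ex1I[of _ "H_gf * E'"])
    show "H_gf * E' * (fps_const (1 - tvar) * E) = fps_const (1 - tvar) * H_gf"
      using E' by (metis (no_types, lifting) mult.assoc mult.commute mult.right_neutral)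
    fix F
    assume "F * (fps_const (1 - tvar) * E) = fps_const (1 - tvar) * H_gf"
    then have *: "fps_const (1 - tvar) * (F * E) = fps_const (1 - tvar) * H_gf"
      by (simp only: mult_ac)
    have "F * E = H_gf"
    proof (rule fps_ext)
      fix n
      from arg_cong[OF *, of "\<lambda>f. fps_nth f n"]
      have "(1 - tvar) * fps_nth (F * E) n = (1 - tvar) * fps_nth H_gf n"
        by (simp only: fps_mult_left_const_nth)
      then show "fps_nth (F * E) n = fps_nth H_gf n"
        by (rule one_minus_tvar_cancel)
    qed
    then show "F = H_gf * E'"
      using E' by (metis mult.assoc mult.right_neutral)
  qed
qed

section \<open>Skew diagrams and skew Schur functions\<close>

text \<open>
  A cell is a pair (row, column), both counted from 0, rows downwards and columns to the right
  (English notation). A partition is a weakly decreasing, eventually zero sequence.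
\<close>

type_synonym cell = "nat \<times> nat"

definition is_partition :: "(nat \<Rightarrow> nat) \<Rightarrow> bool" where
  "is_partition \<nu> \<longleftrightarrow> antimono \<nu> \<and> finite {i. \<nu> i \<noteq> 0}"

definition skew_cells :: "(nat \<Rightarrow> nat) \<Rightarrow> (nat \<Rightarrow> nat) \<Rightarrow> cell set" where
  "skew_cells \<nu> \<mu> = {(i, j). \<mu> i \<le> j \<and> j < \<nu> i}"

definition is_skew_diagram :: "cell set \<Rightarrow> bool" where
  "is_skew_diagram D \<longleftrightarrow>
     (\<exists>\<nu> \<mu>. is_partition \<nu> \<and> is_partition \<mu> \<and> (\<forall>i. \<mu> i \<le> \<nu> i) \<and> D = skew_cells \<nu> \<mu>)"

definition ssyt :: "cell set \<Rightarrow> (cell \<Rightarrow> nat) set" where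
  "ssyt D = {T \<in> D \<rightarrow>\<^sub>E UNIV.
     (\<forall>i j j'. (i, j) \<in> D \<and> (i, j') \<in> D \<and> j < j' \<longrightarrow> T (i, j) \<le> T (i, j')) \<and>
     (\<forall>i i' j. (i, j) \<in> D \<and> (i', j) \<in> D \<and> i < i' \<longrightarrow> T (i, j) < T (i', j))}"

definition skew_schur :: "cell set \<Rightarrow> xseries" where
  "skew_schur D = Abs_xseries (\<lambda>m.
     real (card {T \<in> ssyt D. \<forall>v. card {c \<in> D. T c = v} = Poly_Mapping.lookup m v}))"

definition schur :: "(nat \<Rightarrow> nat) \<Rightarrow> xseries" where
  "schur \<nu> = skew_schur (skew_cells \<nu> (\<lambda>i. 0))"

section \<open>Skew hooks\<close>

definition adjacent :: "cell \<Rightarrow> cell \<Rightarrow> bool" where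
  "adjacent c c' \<longleftrightarrow>
     (fst c = fst c' \<and> (snd c' = Suc (snd c) \<or> snd c = Suc (snd c'))) \<or>
     (snd c = snd c' \<and> (fst c' = Suc (fst c) \<or> fst c = Suc (fst c')))"

definition cells_connected :: "cell set \<Rightarrow> bool" where
  "cells_connected D \<longleftrightarrow>
     (\<forall>c\<in>D. \<forall>c'\<in>D. (c, c') \<in> {(a, b). a \<in> D \<and> b \<in> D \<and> adjacent a b}\<^sup>*)"

definition no_square :: "cell set \<Rightarrow> bool" where
  "no_square D \<longleftrightarrow>
     \<not> (\<exists>i j. {(i, j), (i, Suc j), (Suc i, j), (Suc i, Suc j)} \<subseteq> D)"

text \<open>
  Every nonempty skew diagram has exactly one translate that meets both row 0 and column 0. These
  translates represent the translation classes, so that each class is counted once.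
\<close>

definition normalized :: "cell set \<Rightarrow> bool" where
  "normalized D \<longleftrightarrow> 0 \<in> fst ` D \<and> 0 \<in> snd ` D"

definition is_skew_hook :: "cell set \<Rightarrow> bool" where
  "is_skew_hook D \<longleftrightarrow>
     is_skew_diagram D \<and> normalized D \<and> cells_connected D \<and> no_square D"

definition col_size :: "cell set \<Rightarrow> nat \<Rightarrow> nat" where
  "col_size D j = card {i. (i, j) \<in> D}"

definition skew_hooks :: "nat \<Rightarrow> nat \<Rightarrow> cell set set" where
  "skew_hooks n k = {D. is_skew_hook D \<and> card D = n \<and>
     (\<forall>j \<in> snd ` D. col_size D j = 1 \<or> col_size D j = 2) \<and>
     card {j \<in> snd ` D. col_size D j = 2} = k \<and>
     card {j \<in> snd ` D. col_size D j = 1} = n - 2 * k \<and>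
     col_size D (Max (snd ` D)) = 1}"

lemma finite_skew_hooks: "finite (skew_hooks n k)"
proof (rule finite_subset)
  show "skew_hooks n k \<subseteq> Pow ({..<n} \<times> {..<n})"
  proof (clarsimp simp: skew_hooks_def is_skew_hook_def)
    fix D i j
    assume D: "n = card D" "normalized D" "cells_connected D" "(i, j) \<in> D" "is_skew_diagram D"
    obtain \<nu> \<mu> where lm: "is_partition \<nu>" "D = skew_cells \<nu> \<mu>"
      using D(5) by (auto simp: is_skew_diagram_def)
    have "D \<subseteq> (SIGMA i:{i. \<nu> i \<noteq> 0}. {..<\<nu> i})"
      using lm by (auto simp: skew_cells_def)
    then have fin: "finite D"
      by (rule finite_subset) (use lm in \<open>auto simp: is_partition_def\<close>)
    have *: "f c < card D"
      if "0 \<in> f ` D" "c \<in> D" and adj: "\<And>a b. adjacent a b \<Longrightarrow> f b \<le> Suc (f a)"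
      for f :: "cell \<Rightarrow> nat" and c
    proof -
      obtain o' where o': "o' \<in> D" "f o' = 0" using \<open>0 \<in> f ` D\<close> by auto
      have "(o', c) \<in> {(a, b). a \<in> D \<and> b \<in> D \<and> adjacent a b}\<^sup>*"
        using D(3) o' \<open>c \<in> D\<close> by (auto simp: cells_connected_def)
      then have "{..f c} \<subseteq> f ` D"
      proof (induction rule: rtrancl_induct)
        case base
        then show ?case using o' by force
      next
        case (step b c)
        have "{..f c} \<subseteq> insert (f c) {..f b}"
          using step(2) adj by fastforce
        then show ?case
          using step by blast
      qed
      then have "card {..f c} \<le> card D"
        by (meson card_image_le card_mono fin finite_imageI le_trans)
      then show ?thesis by simp
    qed
    have "i < card D"
      proof -
      have "fst (i, j) < card D"
        by (rule *) (use D in \<open>auto simp: normalized_def adjacent_def\<close>)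
      then show ?thesis by simp
    qed
    moreover have "j < card D"
      proof -
      have "snd (i, j) < card D"
        by (rule *) (use D in \<open>auto simp: normalized_def adjacent_def\<close>)
      then show ?thesis by simp
    qed
    ultimately show "i < card D \<and> j < card D" by blast
  qed
qed simp

definition gamma_hook :: "nat \<Rightarrow> nat \<Rightarrow> xseries" where
  "gamma_hook n k = (\<Sum>D\<in>skew_hooks n k. skew_schur D)"

section \<open>Schur positivity\<close>

text \<open>
  The Schur functions form a basis of \<open>\<Lambda>\<close>, so the expansion below is the only one: some expansion has
  nonnegative coefficients exactly if the Schur expansion does.
\<close>

definition schur_positive :: "xseries \<Rightarrow> bool" where
  "schur_positive f \<longleftrightarrow> f \<in> \<Lambda> \<and>
     (\<exists>P c. finite P \<and> (\<forall>\<nu>\<in>P. is_partition \<nu> \<and> 0 \<le> c \<nu>) \<and>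
        f = (\<Sum>\<nu>\<in>P. c \<nu> *\<^sub>R schur \<nu>))"

definition schur_gamma_positive :: "xseries poly \<Rightarrow> bool" where
  "schur_gamma_positive A \<longleftrightarrow> (\<forall>i. coeff A i \<in> \<Lambda>) \<and>
     (\<exists>d \<gamma>. (\<forall>k \<le> d div 2. schur_positive (\<gamma> k)) \<and>
        A = (\<Sum>k = 0..d div 2. smult (\<gamma> k) (tvar ^ k * (1 + tvar) ^ (d - 2 * k))))"

end

theory Submission
  imports Defs
begin

text \<open>
  Read from right to left, a skew hook is a pattern of descents and ascents, and its skew Schur
  function is the ribbon series \<open>r\<^sub>p\<close> of all words with pattern \<open>p\<close>. Cutting a word gives
  \<open>r\<^sub>p r\<^sub>q = r\<^bsub>p D q\<^esub> + r\<^bsub>p A q\<^esub>\<close>, while \<open>r\<close> of \<open>l\<close> ascents is \<open>h\<^bsub>l+1\<^esub>\<close>; these two rules determine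
  all ribbon series. The hooks in \<open>\<H>\<^bsub>n,k\<^esub>\<close> correspond to the patterns that are products of blocks \<open>A\<close> and
  \<open>A D\<close>. Weighting these blocks by \<open>1 + t\<close> and \<open>t\<close>, the two rules yield a recursion for the weighted sum
  of ribbon series that is equivalent to the functional equation defining the \<open>Q\<^sub>n\<close>.

  For Schur positivity, the sum of \<open>s\<close> over the contents of all lattice words with a given pattern obeys the
  same two rules: letters appended in increasing order build a horizontal strip, so the Pieri rule
  applies. Hence every ribbon series is such a sum. The Pieri rule itself is proved one variable at a
  time from Fomin's local rule for horizontal strips.
\<close>

section \<open>Admissible descent patterns and the polynomials \<open>Q\<^sub>n\<close>\<close>

text \<open>Applied to a leading block \<open>[False, True]\<close>, the descent rule turns the
  descent into an ascent and leaves a sum over patterns that start with a longer, unweighted run of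
  ascents. The full weighted sums are therefore not closed under the rules, and
  \<open>pat_sum\<close> carries the length of this run as a second argument. The linear recurrence
  that results has characteristic roots 1 and t, which is where the q-integers come from. As
  \<open>1 - tvar\<close> is not invertible, the functional equation is never divided by it: the
  recursion is multiplied by 1 - t, and \<open>ex1_Q_gf\<close> identifies the series. The descent
  rule has a minus sign, so positivity cannot be read off from it. It only serves to identify two
  functions of patterns; for lattice words the negative term is moved to the other side, where the
  Pieri rule splits a product into two sums. The same rule gives membership of ribbon series in
  \<Lambda>, as it expresses them through the \<open>complete_h\<close>.\<close>

text \<open>
  Patterns encode a descent as \<open>True\<close> and an ascent as \<open>False\<close>. The good ones are the products of blocks
  \<open>[False]\<close> and \<open>[False, True]\<close>; as hooks are read from the right, the last column comes first.
\<close>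
fun good :: "bool list \<Rightarrow> bool" where
  "good [] = True"
| "good (True # p) = False"
| "good [False] = True"
| "good (False # False # p) = good (False # p)"
| "good (False # True # p) = good p"

definition good_pats :: "nat \<Rightarrow> bool list set" where
  "good_pats n = {p. length p = n \<and> good p}"

lemma finite_good_pats [simp]: "finite (good_pats n)"
  by (rule finite_subset[OF _ finite_lists_length_eq[of UNIV n]]) (auto simp: good_pats_def)

lemma good_pats_0: "good_pats 0 = {[]}"
  by (auto simp: good_pats_def)

lemma good_pats_1: "good_pats (Suc 0) = {[False]}"
  by (auto simp: good_pats_def length_Suc_conv elim: good.elims)

text \<open>A nonempty good pattern starts with \<open>False\<close>, so the second letter decides
  whether the first block is \<open>[False]\<close> or \<open>[False, True]\<close>.\<close>

lemma good_pats_Suc_Suc: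
  "good_pats (Suc (Suc n)) =
     Cons False ` good_pats (Suc n) \<union> (\<lambda>p. False # True # p) ` good_pats n"
proof (intro equalityI subsetI)
  fix p assume "p \<in> good_pats (Suc (Suc n))"
  then show "p \<in> Cons False ` good_pats (Suc n) \<union> (\<lambda>p. False # True # p) ` good_pats n"
    by (cases p rule: good.cases) (auto simp: good_pats_def)
next
  fix p assume "p \<in> Cons False ` good_pats (Suc n) \<union> (\<lambda>p. False # True # p) ` good_pats n"
  then show "p \<in> good_pats (Suc (Suc n))"
  proof
    assume "p \<in> Cons False ` good_pats (Suc n)"
    then obtain q where "p = False # q" "length q = Suc n" "good q"
      by (auto simp: good_pats_def)
    then show ?thesis
      by (cases q rule: good.cases) (auto simp: good_pats_def)
  qed (auto simp: good_pats_def)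
qed

lemma sum_good_pats_Suc_Suc:
  fixes f :: "bool list \<Rightarrow> 'a::comm_monoid_add"
  shows "sum f (good_pats (Suc (Suc n))) =
    (\<Sum>p\<in>good_pats (Suc n). f (False # p)) + (\<Sum>p\<in>good_pats n. f (False # True # p))"
proof -
  have "sum f (good_pats (Suc (Suc n))) =
      sum f (Cons False ` good_pats (Suc n)) + sum f ((\<lambda>p. False # True # p) ` good_pats n)"
    unfolding good_pats_Suc_Suc
    by (rule sum.union_disjoint) (simp_all, auto simp: good_pats_def)
  then show ?thesis
    by (simp add: sum.reindex inj_on_def o_def)
qed

lemma good_downs_le: "good p \<Longrightarrow> 2 * count_list p True \<le> length p"
  by (induction p rule: good.induct) auto

section \<open>Weighted sums over good patterns\<close>

text \<open>A block \<open>[False, True]\<close> takes two letters, so n minus twice the number of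
  descents counts the blocks \<open>[False]\<close>; by \<open>good_downs_le\<close> the subtraction
  is exact. The \<open>l\<close> leading ascents carry no weight.\<close>

definition pat_sum :: "'a::comm_ring_1 \<Rightarrow> (bool list \<Rightarrow> 'a) \<Rightarrow> nat \<Rightarrow> nat \<Rightarrow> 'a" where
  "pat_sum t r n l = (\<Sum>p\<in>good_pats n.
     t ^ count_list p True * (1 + t) ^ (n - 2 * count_list p True) * r (replicate l False @ p))"

text \<open>The q-integer [n] at q = t.\<close>

definition qnum :: "'a::comm_ring_1 \<Rightarrow> nat \<Rightarrow> 'a" where
  "qnum t n = (\<Sum>i<n. t ^ i)"

text \<open>The second-order form, with characteristic roots 1 and t, matches the coefficients 1 + t
  and -t in \<open>pat_sum_Suc_Suc\<close>.\<close>

lemma qnum_Suc_Suc: "qnum t (Suc (Suc n)) = (1 + t) * qnum t (Suc n) - t * qnum t n"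
proof -
  have "qnum t (Suc m) = 1 + t * qnum t m" for m
    unfolding qnum_def by (subst sum.lessThan_Suc_shift) (simp add: sum_distrib_left)
  note * = this[of "Suc n"] this[of n]
  show ?thesis
    unfolding *(1) using *(2) by (simp add: algebra_simps)
qed

lemma one_minus_qnum: "(1 - t) * qnum t n = 1 - t ^ n"
  by (simp add: qnum_def one_diff_power_eq)

text \<open>Stated over an arbitrary ring so that the weight t and the values of \<open>r\<close>
  can live together: the instance uses constant polynomials over \<open>xseries\<close>.\<close>

locale ribbon_like =
  fixes h :: "nat \<Rightarrow> 'a::comm_ring_1" and r :: "bool list \<Rightarrow> 'a"
  assumes ascents: "r (replicate l False) = h (Suc l)"
    and descent: "r (replicate l False @ True # p) =
        h (Suc l) * r p - r (replicate (Suc l) False @ p)"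
begin

lemma pat_sum_0: "pat_sum t r 0 l = h (Suc l)"
  by (simp add: pat_sum_def good_pats_0 ascents)

lemma pat_sum_1: "pat_sum t r (Suc 0) l = (1 + t) * h (Suc (Suc l))"
  using ascents[of "Suc l"] by (simp add: pat_sum_def good_pats_1 replicate_append_same)

text \<open>Split by the first block: \<open>[False]\<close> joins the leading run, while
  \<open>[False, True]\<close> is resolved by the descent rule.\<close>

lemma pat_sum_Suc_Suc:
  "pat_sum t r (Suc (Suc n)) l = (1 + t) * pat_sum t r (Suc n) (Suc l)
     + t * (h (Suc (Suc l)) * pat_sum t r n 0 - pat_sum t r n (Suc (Suc l)))"
proof -
  have 1: "(\<Sum>p\<in>good_pats (Suc n). t ^ count_list (False # p) True *
        (1 + t) ^ (Suc (Suc n) - 2 * count_list (False # p) True) *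
        r (replicate l False @ False # p)) = (1 + t) * pat_sum t r (Suc n) (Suc l)"
    unfolding pat_sum_def sum_distrib_left
  proof (rule sum.cong[OF refl])
    fix p assume "p \<in> good_pats (Suc n)"
    then have "2 * count_list p True \<le> Suc n"
      using good_downs_le[of p] by (simp add: good_pats_def)
    then have "Suc (Suc n) - 2 * count_list p True = Suc (Suc n - 2 * count_list p True)"
      by simp
    moreover have "replicate l False @ False # p = replicate (Suc l) False @ p"
      by (simp add: replicate_app_Cons_same[symmetric])
    ultimately show "t ^ count_list (False # p) True *
        (1 + t) ^ (Suc (Suc n) - 2 * count_list (False # p) True) *
        r (replicate l False @ False # p) =
        (1 + t) * (t ^ count_list p True * (1 + t) ^ (Suc n - 2 * count_list p True) *
        r (replicate (Suc l) False @ p))"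
      by (simp only: count_list.simps bool_simps if_False power_Suc mult_ac)
  qed
  have 2: "(\<Sum>p\<in>good_pats n. t ^ count_list (False # True # p) True *
        (1 + t) ^ (Suc (Suc n) - 2 * count_list (False # True # p) True) *
        r (replicate l False @ False # True # p)) =
        t * (h (Suc (Suc l)) * pat_sum t r n 0 - pat_sum t r n (Suc (Suc l)))"
    unfolding pat_sum_def sum_distrib_left sum_subtractf[symmetric]
  proof (rule sum.cong[OF refl])
    fix p
    have *: "r (replicate l False @ False # True # p) =
        h (Suc (Suc l)) * r p - r (replicate (Suc (Suc l)) False @ p)"
      using descent[of "Suc l" p] by (simp add: replicate_app_Cons_same)
    show "t ^ count_list (False # True # p) True *
        (1 + t) ^ (Suc (Suc n) - 2 * count_list (False # True # p) True) *
        r (replicate l False @ False # True # p) =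
        t * (h (Suc (Suc l)) * (t ^ count_list p True * (1 + t) ^ (n - 2 * count_list p True) *
          r (replicate 0 False @ p)) - t ^ count_list p True *
          (1 + t) ^ (n - 2 * count_list p True) * r (replicate (Suc (Suc l)) False @ p))"
      unfolding * by (simp add: algebra_simps)
  qed
  show ?thesis
    unfolding pat_sum_def[of t r "Suc (Suc n)"] sum_good_pats_Suc_Suc 1 2 ..
qed

text \<open>In \<open>pat_sum_Suc_Suc\<close> every step lowers n and raises l, so this is a linear
  recurrence along n + l with a source term. The initial values for n = 0 and n = 1 have
  coefficients [1] and [2], whence [n+1]; the source met after i steps is propagated with the factor
  [i+1].\<close>

lemma pat_sum_recursion:
  "pat_sum t r n l = qnum t (Suc n) * h (Suc (l + n))
     + t * (\<Sum>i<n - 1. qnum t (Suc i) * h (l + i + 2) * pat_sum t r (n - 2 - i) 0)"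
proof (induction n arbitrary: l rule: less_induct)
  case (less n)
  let ?X = "\<lambda>n. pat_sum t r n 0"
  \<comment> \<open>The case n = 2 falls back on n = 0, where the truncated bound
    \<open>n - 1\<close> no longer drops along with n; it is checked directly.\<close>
  consider "n = 0" | "n = 1" | "n = 2" | m where "n = Suc (Suc (Suc m))"
    by (metis One_nat_def numeral_2_eq_2 not0_implies_Suc)
  then show ?case
  proof cases
    case 3
    have [simp]: "qnum t 0 = 0" "qnum t (Suc 0) = 1" "qnum t (Suc (Suc 0)) = 1 + t"
      by (simp_all add: qnum_def)
    have [simp]: "qnum t 3 = (1 + t) * (1 + t) - t"
      using qnum_Suc_Suc[of t 1] by (simp add: numeral_3_eq_3)
    show ?thesis
      by (simp add: 3 numeral_2_eq_2 pat_sum_Suc_Suc pat_sum_0 pat_sum_1 qnum_Suc_Suc algebra_simps)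
  next
    case 4
    let ?f = "\<lambda>i. h (l + i + 3) * ?X (m - i)"
    have S: "(\<Sum>i<Suc m. qnum t (Suc i) * h (Suc l + i + 2) * ?X (Suc (Suc m) - 2 - i))
        = (\<Sum>i<Suc m. qnum t (Suc i) * ?f i)"
      by (intro sum.cong) (simp_all add: mult_ac eval_nat_numeral)
    \<comment> \<open>The term added at index 0 vanishes because [0] = 0, so the sums can be
      combined over a common range.\<close>
    have T: "(\<Sum>i<m. qnum t (Suc i) * h (Suc (Suc l) + i + 2) * ?X (Suc m - 2 - i))
        = (\<Sum>i<Suc m. qnum t i * ?f i)"
      unfolding sum.lessThan_Suc_shift
      by (simp add: qnum_def[of t 0] eval_nat_numeral mult_ac)
    have U: "(\<Sum>i<Suc (Suc m). qnum t (Suc i) * h (l + i + 2) * ?X (Suc (Suc (Suc m)) - 2 - i))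
        = h (Suc (Suc l)) * ?X (Suc m) + (\<Sum>i<Suc m. qnum t (Suc (Suc i)) * ?f i)"
      unfolding sum.lessThan_Suc_shift[of _ "Suc m"]
      by (simp add: qnum_def[of t "Suc 0"] eval_nat_numeral mult_ac
          del: sum.lessThan_Suc)
    have V: "(\<Sum>i<Suc m. qnum t (Suc (Suc i)) * ?f i) =
        (1 + t) * (\<Sum>i<Suc m. qnum t (Suc i) * ?f i) - t * (\<Sum>i<Suc m. qnum t i * ?f i)"
      unfolding sum_distrib_left sum_subtractf[symmetric]
      by (rule sum.cong) (simp_all add: qnum_Suc_Suc algebra_simps)
    have "pat_sum t r n l = (1 + t) * (qnum t (Suc (Suc (Suc m))) * h (Suc (Suc l + Suc (Suc m)))
          + t * (\<Sum>i<Suc m. qnum t (Suc i) * ?f i))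
        + t * (h (Suc (Suc l)) * ?X (Suc m)
          - (qnum t (Suc (Suc m)) * h (Suc (Suc (Suc l) + Suc m))
          + t * (\<Sum>i<Suc m. qnum t i * ?f i)))"
      unfolding 4 pat_sum_Suc_Suc[of t "Suc m"]
      using less.IH[of "Suc (Suc m)" "Suc l"] less.IH[of "Suc m" "Suc (Suc l)"]
      by (simp only: 4 lessI less_SucI diff_Suc_1 S T)
    also have "\<dots> = qnum t (Suc n) * h (Suc (l + n)) + t * (h (Suc (Suc l)) * ?X (Suc m)
        + (\<Sum>i<Suc m. qnum t (Suc (Suc i)) * ?f i))"
      unfolding V 4 qnum_Suc_Suc[of t "Suc (Suc m)"] by (simp add: algebra_simps del: sum.lessThan_Suc)
    finally show ?thesis
      using U 4 by simp
  qed (simp_all add: pat_sum_0 pat_sum_1, simp_all add: qnum_def)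
qed

end

text \<open>Multiplication by 1 - t turns t [i+1] into t - t^(i+2), the negated coefficient of h at
  i + 2 in the denominator. The recursion at l = 0 thus becomes the comparison of coefficients in
  the functional equation.\<close>

lemma Q_eq_pat_sum:
  assumes "ribbon_like (\<lambda>n. [:complete_h n:]) r" "n \<ge> 1"
  shows "Q n = pat_sum tvar r (n - 1) 0"
proof -
  interpret ribbon_like "\<lambda>n. [:complete_h n:]" r by fact
  define t where "t = tvar"
  define h where "h n = [:complete_h n:]" for n
  \<comment> \<open>The shift by one reflects that a pattern of length n - 1 describes n cells; the
    constant term 1 is forced by the equation.\<close>
  define F where "F = Abs_fps (\<lambda>n. if n = 0 then 1 else pat_sum t r (n - 1) 0)"
  have h0: "h 0 = 1" by (simp add: h_def one_pCons)
  have "F * ((H_gf oo (fps_const t * fps_X)) - fps_const t * H_gf) = fps_const (1 - t) * H_gf"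
  proof (rule fps_ext)
    fix n
    have den: "fps_nth ((H_gf oo (fps_const t * fps_X)) - fps_const t * H_gf) n =
        (t ^ n - t) * h n" for n
      by (simp add: fps_compose_linear H_gf_def left_diff_distrib h_def
        del: mult_pCons_left mult_pCons_right)
    have rhs: "fps_nth (fps_const (1 - t) * H_gf) n = (1 - t) * h n"
      by (simp add: H_gf_def h_def del: mult_pCons_left mult_pCons_right)
    have lhs: "fps_nth (F * ((H_gf oo (fps_const t * fps_X)) - fps_const t * H_gf)) n =
        (\<Sum>i=0..n. fps_nth F i * ((t ^ (n - i) - t) * h (n - i)))"
      by (simp only: fps_mult_nth den)
    have "(\<Sum>i=0..n. fps_nth F i * ((t ^ (n - i) - t) * h (n - i))) = (1 - t) * h n"
    proof (cases n)
      case (Suc m)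
      let ?X = "\<lambda>n. pat_sum t r n 0"
      let ?g = "\<lambda>i. ?X i * ((t ^ (m - i) - t) * h (m - i))"
      have "?X m = qnum t (Suc m) * h (Suc m)
          + t * (\<Sum>i<m - 1. qnum t (Suc i) * h (i + 2) * ?X (m - 2 - i))"
        using pat_sum_recursion[of t m 0] by (simp add: h_def)
      then have "(1 - t) * ?X m = (1 - t) * qnum t (Suc m) * h (Suc m)
          + (\<Sum>i<m - 1. (t * ((1 - t) * qnum t (Suc i))) * h (i + 2) * ?X (m - 2 - i))"
        by (simp add: distrib_left sum_distrib_left mult_ac)
      also have "(\<Sum>i<m - 1. (t * ((1 - t) * qnum t (Suc i))) * h (i + 2) * ?X (m - 2 - i))
          = (\<Sum>i<m - 1. - ?g (m - 2 - i))"
      proof (rule sum.cong[OF refl])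
        fix i assume "i \<in> {..<m - 1}"
        then have "m - (m - 2 - i) = i + 2" by auto
        then show "(t * ((1 - t) * qnum t (Suc i))) * h (i + 2) * ?X (m - 2 - i) = - ?g (m - 2 - i)"
          unfolding one_minus_qnum by (simp add: algebra_simps)
      qed
      also have "\<dots> = - (\<Sum>i<m - 1. ?g i)"
        unfolding sum_negf[symmetric]
        by (rule sum.reindex_bij_witness[where i = "\<lambda>i. m - 2 - i" and j = "\<lambda>i. m - 2 - i"]) auto
      \<comment> \<open>The term at m - 1 contains t^1 - t = 0: the denominator has no linear
        term.\<close>
      also have "(\<Sum>i<m - 1. ?g i) = (\<Sum>i<m. ?g i)"
        by (cases m) simp_all
      finally have X: "(1 - t) * ?X m = (1 - t ^ Suc m) * h (Suc m) - (\<Sum>i<m. ?g i)"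
        by (simp add: one_minus_qnum del: power_Suc)
      have "(\<Sum>i=0..n. fps_nth F i * ((t ^ (n - i) - t) * h (n - i))) =
          (t ^ Suc m - t) * h (Suc m) + (\<Sum>i=0..m. ?g i)"
        unfolding Suc sum.atLeast0_atMost_Suc_shift by (simp add: F_def)
      also have "(\<Sum>i=0..m. ?g i) = (\<Sum>i<m. ?g i) + (1 - t) * ?X m"
        by (simp add: atLeast0AtMost lessThan_Suc_atMost[symmetric] h0 mult_ac)
      finally show ?thesis
        unfolding X Suc by (simp add: algebra_simps)
    qed (simp add: F_def h0)
    then show "fps_nth (F * ((H_gf oo (fps_const t * fps_X)) - fps_const t * H_gf)) n =
        fps_nth (fps_const (1 - t) * H_gf) n"
      unfolding lhs rhs .
  qed
  then have "Q_gf = F"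
    unfolding Q_gf_def t_def by (rule the1_equality[OF ex1_Q_gf])
  then have "Q n = fps_nth F n"
    by (simp add: Q_def)
  with assms(2) show ?thesis
    by (simp add: F_def t_def)
qed

section \<open>The algebra of symmetric functions\<close>

lemma mdeg_eq_sum: "finite A \<Longrightarrow> Poly_Mapping.keys m \<subseteq> A \<Longrightarrow> mdeg m = (\<Sum>i\<in>A. Poly_Mapping.lookup m i)"
  unfolding mdeg_def by (rule sum.mono_neutral_left) (auto simp: in_keys_iff)

lemma mdeg_add: "mdeg (a + b) = mdeg a + mdeg b"
proof -
  let ?A = "Poly_Mapping.keys a \<union> Poly_Mapping.keys b"
  have "Poly_Mapping.keys (a + b) \<subseteq> ?A"
    by (rule Poly_Mapping.keys_add)
  then show ?thesis
    by (simp add: mdeg_eq_sum[of ?A] lookup_add sum.distrib)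
qed

lemma mdeg_permute:
  assumes "bij \<pi>" "\<And>i. Poly_Mapping.lookup m' i = Poly_Mapping.lookup m (\<pi> i)"
  shows "mdeg m' = mdeg m"
  unfolding mdeg_def using assms
  by (intro sum.reindex_bij_witness[where i = "inv \<pi>" and j = \<pi>])
    (auto simp: in_keys_iff bij_is_inj bij_is_surj surj_f_inv_f)

lemma SymI:
  assumes "\<And>\<pi> m m'. bij \<pi> \<Longrightarrow> (\<And>i. Poly_Mapping.lookup m' i = Poly_Mapping.lookup m (\<pi> i)) \<Longrightarrow>
      xcoeff f m' = xcoeff f m"
    and "\<And>m. xcoeff f m \<noteq> 0 \<Longrightarrow> mdeg m \<le> d"
  shows "f \<in> \<Lambda>"
  using assms unfolding Sym_def by blast

lemma Sym_permute:
  assumes "f \<in> \<Lambda>" "bij \<pi>" "\<And>i. Poly_Mapping.lookup m' i = Poly_Mapping.lookup m (\<pi> i)"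
  shows "xcoeff f m' = xcoeff f m"
  using assms unfolding Sym_def by blast

lemma Sym_bounded:
  assumes "f \<in> \<Lambda>"
  obtains d where "\<And>m. xcoeff f m \<noteq> 0 \<Longrightarrow> mdeg m \<le> d"
  using assms unfolding Sym_def by blast

lemma Sym_0: "0 \<in> \<Lambda>"
  by (rule SymI) auto

lemma Sym_1: "1 \<in> \<Lambda>"
proof (rule SymI)
  fix \<pi> and m m' :: xmonom
  assume "bij \<pi>" "\<And>i. Poly_Mapping.lookup m' i = Poly_Mapping.lookup m (\<pi> i)"
  then have "mdeg m' = mdeg m" by (rule mdeg_permute)
  then show "xcoeff 1 m' = xcoeff 1 m"
    by (metis mdeg_eq_0_iff xcoeff_simps(2))
qed (auto simp: mdeg_def split: if_splits)

lemma Sym_uminus: "f \<in> \<Lambda> \<Longrightarrow> - f \<in> \<Lambda>"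
  unfolding Sym_def mem_Collect_eq xcoeff_simps neg_equal_iff_equal neg_equal_0_iff_equal .

lemma Sym_add:
  assumes "f \<in> \<Lambda>" "g \<in> \<Lambda>"
  shows "f + g \<in> \<Lambda>"
proof -
  obtain d e where "\<And>m. xcoeff f m \<noteq> 0 \<Longrightarrow> mdeg m \<le> d" "\<And>m. xcoeff g m \<noteq> 0 \<Longrightarrow> mdeg m \<le> e"
    using assms by (metis Sym_bounded)
  then show ?thesis
    using assms
    by (intro SymI[of _ "max d e"])
      (auto simp: Sym_permute le_max_iff_disj, metis add_cancel_right_left)
qed

lemma Sym_diff: "f \<in> \<Lambda> \<Longrightarrow> g \<in> \<Lambda> \<Longrightarrow> f - g \<in> \<Lambda>"
  using Sym_add[of f "- g"] Sym_uminus[of g] by simp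

text \<open>A permutation of the variables acts additively on exponent vectors, hence permutes the
  splittings of a monomial compatibly with both factors.\<close>

lemma Sym_mult:
  assumes "f \<in> \<Lambda>" "g \<in> \<Lambda>"
  shows "f * g \<in> \<Lambda>"
proof -
  obtain d e where de: "\<And>m. xcoeff f m \<noteq> 0 \<Longrightarrow> mdeg m \<le> d" "\<And>m. xcoeff g m \<noteq> 0 \<Longrightarrow> mdeg m \<le> e"
    using assms by (metis Sym_bounded)
  show ?thesis
  proof (rule SymI[of _ "d + e"])
    fix m assume "xcoeff (f * g) m \<noteq> 0"
    then obtain a b where "a + b = m" "xcoeff f a * xcoeff g b \<noteq> 0"
      unfolding xcoeff_mult by (auto simp: splits_def elim!: sum.not_neutral_contains_not_neutral)
    then show "mdeg m \<le> d + e"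
      using de(1)[of a] de(2)[of b] by (auto simp: mdeg_add)
  next
    fix \<pi> and m m' :: xmonom
    assume \<pi>: "bij \<pi>" "\<And>i. Poly_Mapping.lookup m' i = Poly_Mapping.lookup m (\<pi> i)"
    define act :: "(nat \<Rightarrow> nat) \<Rightarrow> xmonom \<Rightarrow> xmonom" where "act = Poly_Mapping.map_key"
    have lookup_act: "Poly_Mapping.lookup (act \<sigma> a) i = Poly_Mapping.lookup a (\<sigma> i)" if "bij \<sigma>" for \<sigma> a i
      using that by (simp add: act_def map_key.rep_eq bij_is_inj)
    have bij': "bij (inv \<pi>)" using \<pi> by (simp add: bij_imp_bij_inv)
    have m': "m' = act \<pi> m" "m = act (inv \<pi>) m'"
      using \<pi> bij' by (auto intro!: poly_mapping_eqI simp: lookup_act bij_is_surj surj_f_inv_f)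
    have inv: "act \<pi> (act (inv \<pi>) a) = a" "act (inv \<pi>) (act \<pi> a) = a" for a
      using \<pi> bij'
      by (auto intro!: poly_mapping_eqI simp: lookup_act bij_is_surj bij_is_inj surj_f_inv_f)
    have add: "act \<sigma> (a + b) = act \<sigma> a + act \<sigma> b" if "bij \<sigma>" for \<sigma> a b
      using that by (auto intro!: poly_mapping_eqI simp: lookup_act lookup_add)
    have perm: "xcoeff f (act \<pi> a) = xcoeff f a" "xcoeff g (act \<pi> a) = xcoeff g a" for a
      by (rule Sym_permute[of _ \<pi>]; use assms \<pi> in \<open>simp add: lookup_act\<close>)+
    show "xcoeff (f * g) m' = xcoeff (f * g) m"
      unfolding xcoeff_mult m'(1)
      by (rule sum.reindex_bij_witness[where i = "\<lambda>(a, b). (act \<pi> a, act \<pi> b)"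
            and j = "\<lambda>(a, b). (act (inv \<pi>) a, act (inv \<pi>) b)"])
        (use \<pi>(1) bij' in \<open>auto simp: splits_def inv perm add\<close>,
         metis add inv(2) bij', metis inv(1) perm)
  qed
qed

lemma Sym_sum: "(\<And>i. i \<in> A \<Longrightarrow> f i \<in> \<Lambda>) \<Longrightarrow> sum f A \<in> \<Lambda>"
  by (induction A rule: infinite_finite_induct) (auto simp: Sym_0 Sym_add)

lemma Sym_complete_h: "complete_h n \<in> \<Lambda>"
proof (rule SymI[of _ n])
  fix \<pi> and m m' :: xmonom
  assume "bij \<pi>" "\<And>i. Poly_Mapping.lookup m' i = Poly_Mapping.lookup m (\<pi> i)"
  then have "mdeg m' = mdeg m" by (rule mdeg_permute)
  then show "xcoeff (complete_h n) m' = xcoeff (complete_h n) m"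
    by (simp add: complete_h_def)
qed (auto simp: complete_h_def split: if_splits)

section \<open>Ribbon series\<close>

text \<open>The relation is a parameter because ribbon words are compared by \<open><\<close> and
  lattice words by \<open>>\<close>.\<close>

fun pattern :: "('a \<Rightarrow> 'a \<Rightarrow> bool) \<Rightarrow> 'a list \<Rightarrow> bool list" where
  "pattern R (u # v # w) = R u v # pattern R (v # w)"
| "pattern R _ = []"

lemma length_pattern: "length (pattern R w) = length w - 1"
  by (induction R w rule: pattern.induct) auto

lemma pattern_append:
  "u \<noteq> [] \<Longrightarrow> v \<noteq> [] \<Longrightarrow> pattern R (u @ v) = pattern R u @ R (last u) (hd v) # pattern R v"
proof (induction R u rule: pattern.induct)
  case ("2_2" R x)
  then show ?case by (cases v) auto
qed auto

lemma pattern_eq_replicate_False: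
  assumes "transp (\<lambda>u v. \<not> R u v)"
  shows "pattern R w = replicate (length w - 1) False \<longleftrightarrow> sorted_wrt (\<lambda>u v. \<not> R u v) w"
  using assms by (induction R w rule: pattern.induct) (simp_all add: sorted_wrt1 sorted_wrt2 del: sorted_wrt.simps(2))

text \<open>With \<open><\<close>, the letter \<open>True\<close> of a pattern is a strict increase:
  along a hook, a step down must raise the entry, and a step to the left must not.\<close>

abbreviation pat :: "nat list \<Rightarrow> bool list" where
  "pat \<equiv> pattern (<)"

lemma pat_eq_replicate_False:
  "pat w = replicate (length w - 1) False \<longleftrightarrow> sorted_wrt (\<ge>) w"
  using pattern_eq_replicate_False[of "(<)" w] by (simp add: not_less transp_def)

definition ribbon_words :: "bool list \<Rightarrow> xmonom \<Rightarrow> nat list set" where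
  "ribbon_words p m = {w. length w = Suc (length p) \<and> pat w = p \<and>
     (\<forall>v. count_list w v = Poly_Mapping.lookup m v)}"

definition ribbon :: "bool list \<Rightarrow> xseries" where
  "ribbon p = Abs_xseries (\<lambda>m. real (card (ribbon_words p m)))"

lemma finite_ribbon_words [simp]: "finite (ribbon_words p m)"
proof (rule finite_subset)
  show "ribbon_words p m \<subseteq> {w. set w \<subseteq> Poly_Mapping.keys m \<and> length w = Suc (length p)}"
  proof
    fix w assume w: "w \<in> ribbon_words p m"
    have "v \<in> Poly_Mapping.keys m" if "v \<in> set w" for v
      using w that count_list_0_iff[of w v] by (simp add: ribbon_words_def in_keys_iff)
    with w show "w \<in> {w. set w \<subseteq> Poly_Mapping.keys m \<and> length w = Suc (length p)}"
      by (simp add: ribbon_words_def subset_iff)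
  qed
qed (rule finite_lists_length_eq, simp)

definition weight :: "nat list \<Rightarrow> xmonom" where
  "weight w = (\<Sum>x\<leftarrow>w. Poly_Mapping.single x 1)"

lemma lookup_weight [simp]: "Poly_Mapping.lookup (weight w) v = count_list w v"
  by (induction w) (auto simp: weight_def lookup_add lookup_single when_def)

lemma weight_append: "weight (u @ v) = weight u + weight v"
  by (simp add: weight_def)

lemma mdeg_weight: "mdeg (weight w) = length w"
proof -
  have "mdeg (Poly_Mapping.single x 1) = 1" for x by (simp add: mdeg_def)
  then show ?thesis
    by (induction w) (auto simp: weight_def mdeg_add mdeg_eq_0_iff)
qed

lemma ribbon_words_altdef:
  "ribbon_words p m = {w. length w = Suc (length p) \<and> pat w = p \<and> weight w = m}"
  by (simp add: ribbon_words_def poly_mapping_eq_iff fun_eq_iff)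

lemma ex1_decreasing_word: "\<exists>!w. sorted_wrt (\<ge>) w \<and> weight w = m"
proof -
  have weight: "weight w = m \<longleftrightarrow> count (mset w) = Poly_Mapping.lookup m" for w
    by (simp add: poly_mapping_eq_iff fun_eq_iff count_mset)
  define M where "M = Abs_multiset (Poly_Mapping.lookup m)"
  have "finite {x. 0 < Poly_Mapping.lookup m x}"
    using finite_lookup[of m] by simp
  then have M: "count M = Poly_Mapping.lookup m"
    by (simp add: M_def)
  show ?thesis
  proof (rule ex1I[of _ "rev (sorted_list_of_multiset M)"])
    have "weight (rev (sorted_list_of_multiset M)) = m"
      unfolding weight M[symmetric] mset_rev mset_sorted_list_of_multiset ..
    then show "sorted_wrt (\<ge>) (rev (sorted_list_of_multiset M)) \<and>
        weight (rev (sorted_list_of_multiset M)) = m"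
      by (simp add: sorted_wrt_rev)
    fix w assume w: "sorted_wrt (\<ge>) w \<and> weight w = m"
    then have "count (mset w) = count M"
      unfolding weight M by blast
    then have "mset w = M"
      unfolding count_inject .
    then have "mset (rev w) = mset (sorted_list_of_multiset M)" by simp
    moreover have "sorted (rev w)" using w by (simp add: sorted_wrt_rev)
    ultimately have "sort (sorted_list_of_multiset M) = rev w"
      by (rule properties_for_sort)
    then have "sorted_list_of_multiset M = rev w"
      using sorted_sorted_list_of_multiset[of M] by (simp add: sorted_sort_id)
    then show "w = rev (sorted_list_of_multiset M)" by simp
  qed
qed

lemma ribbon_words_ascents:
  assumes "mdeg m = Suc l"
  shows "\<exists>w. ribbon_words (replicate l False) m = {w}"
proof -
  obtain w where w: "sorted_wrt (\<ge>) w" "weight w = m"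
    and unique: "\<And>u. sorted_wrt (\<ge>) u \<Longrightarrow> weight u = m \<Longrightarrow> u = w"
    using ex1_decreasing_word[of m] by blast
  have len: "length w = Suc l" using assms w mdeg_weight by metis
  have "ribbon_words (replicate l False) m = {w}"
  proof (intro equalityI subsetI)
    fix u assume "u \<in> ribbon_words (replicate l False) m"
    then have "pat u = replicate (length u - 1) False" "weight u = m"
      by (auto simp: ribbon_words_altdef)
    then show "u \<in> {w}" using unique[of u] pat_eq_replicate_False[of u] by blast
  next
    fix u assume "u \<in> {w}"
    then show "u \<in> ribbon_words (replicate l False) m"
      using w(2) len iffD2[OF pat_eq_replicate_False w(1)] by (simp add: ribbon_words_altdef)
  qed
  then show ?thesis ..
qed

text \<open>Words without a strict increase are weakly decreasing, and each monomial is the content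
  of exactly one of them.\<close>

lemma ribbon_ascents: "ribbon (replicate l False) = complete_h (Suc l)"
proof (rule xseries_eqI)
  fix m
  have "card (ribbon_words (replicate l False) m) = (if mdeg m = Suc l then 1 else 0)"
  proof (cases "mdeg m = Suc l")
    case True
    then obtain w where "ribbon_words (replicate l False) m = {w}"
      using ribbon_words_ascents by blast
    with True show ?thesis by simp
  next
    case False
    have "ribbon_words (replicate l False) m = {}"
      using False unfolding ribbon_words_altdef by (force simp: mdeg_weight)
    with False show ?thesis by simp
  qed
  then show "xcoeff (ribbon (replicate l False)) m = xcoeff (complete_h (Suc l)) m"
    unfolding ribbon_def complete_h_def xcoeff_Abs by simp
qed

text \<open>Cutting a word between two letters does not constrain how these two letters compare.\<close>
lemma ribbon_mult: "ribbon p * ribbon q = ribbon (p @ True # q) + ribbon (p @ False # q)"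
proof (rule xseries_eqI)
  fix m
  let ?W = "\<lambda>x. ribbon_words (p @ x # q) m"
  let ?P = "SIGMA s:splits m. ribbon_words p (fst s) \<times> ribbon_words q (snd s)"
  have "xcoeff (ribbon p * ribbon q) m = real (card ?P)"
    by (simp add: xcoeff_mult ribbon_def split_beta card_SigmaI card_cartesian_product)
  also have "card ?P = card (?W True \<union> ?W False)"
  proof (rule bij_betw_same_card)
    have W: "?W True \<union> ?W False = {w. length w = Suc (Suc (length p + length q)) \<and>
        (\<exists>x. pat w = p @ x # q) \<and> weight w = m}" (is "_ = ?R")
      unfolding ribbon_words_altdef ex_bool_eq by auto
    define cut where "cut w = (take (Suc (length p)) w, drop (Suc (length p)) w)" for w :: "nat list"
    show "bij_betw (\<lambda>(s, u, v). u @ v) ?P (?W True \<union> ?W False)"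
      unfolding W
    \<comment> \<open>The splitting of \<open>m\<close> is recovered as the weights of the two
      parts, whose lengths are fixed by \<open>p\<close> and \<open>q\<close>.\<close>
    proof (rule bij_betw_byWitness[where
          f' = "\<lambda>w. ((weight (fst (cut w)), weight (snd (cut w))), cut w)"])
      show "\<forall>x\<in>?P. ((weight (fst (cut ((\<lambda>(s, u, v). u @ v) x))),
          weight (snd (cut ((\<lambda>(s, u, v). u @ v) x)))), cut ((\<lambda>(s, u, v). u @ v) x)) = x"
        by (auto simp: cut_def ribbon_words_altdef)
      show "\<forall>w\<in>?R. (\<lambda>(s, u, v). u @ v) ((weight (fst (cut w)), weight (snd (cut w))), cut w) = w"
        by (simp add: cut_def)
      show "(\<lambda>(s, u, v). u @ v) ` ?P \<subseteq> ?R"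
      proof (rule image_subsetI, clarify)
        fix a b u v assume *: "(a, b) \<in> splits m" "u \<in> ribbon_words p (fst (a, b))"
          "v \<in> ribbon_words q (snd (a, b))"
        then have "length u = Suc (length p)" "length v = Suc (length q)"
          by (simp_all add: ribbon_words_altdef)
        then have "u \<noteq> []" "v \<noteq> []" by auto
        then have "pat (u @ v) = pat u @ (last u < hd v) # pat v" by (rule pattern_append)
        then show "length (u @ v) = Suc (Suc (length p + length q)) \<and>
            (\<exists>x. pat (u @ v) = p @ x # q) \<and> weight (u @ v) = m"
          using * by (simp add: ribbon_words_altdef splits_def weight_append)
      qed
      show "(\<lambda>w. ((weight (fst (cut w)), weight (snd (cut w))), cut w)) ` ?R \<subseteq> ?P"
      proof (rule image_subsetI)
        fix w assume "w \<in> ?R"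
        then obtain x where x: "length w = Suc (Suc (length p + length q))"
          "pat w = p @ x # q" "weight w = m" by blast
        obtain u v where uv: "cut w = (u, v)" by fastforce
        have w: "w = u @ v" and len: "length u = Suc (length p)" "length v = Suc (length q)"
          using uv x(1) by (auto simp: cut_def)
        then have "u \<noteq> []" "v \<noteq> []" by auto
        then have "pat (u @ v) = pat u @ (last u < hd v) # pat v" by (rule pattern_append)
        then have "pat u @ (last u < hd v) # pat v = p @ x # q"
          using x(2) unfolding w by (rule subst)
        moreover have "length (pat u) = length p"
          using len by (simp add: length_pattern)
        ultimately have "pat u = p" "pat v = q" by simp_all
        then show "((weight (fst (cut w)), weight (snd (cut w))), cut w) \<in> ?P"
          unfolding uv using len x(3)[unfolded w] by (simp add: ribbon_words_altdef splits_def weight_append)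
      qed
    qed
  qed
  also have "\<dots> = card (?W True) + card (?W False)"
    by (rule card_Un_disjoint) (simp_all, auto simp: ribbon_words_altdef)
  finally show "xcoeff (ribbon p * ribbon q) m =
      xcoeff (ribbon (p @ True # q) + ribbon (p @ False # q)) m"
    by (simp add: ribbon_def)
qed

lemma ribbon_descent:
  "ribbon (replicate l False @ True # p) =
     complete_h (Suc l) * ribbon p - ribbon (replicate (Suc l) False @ p)"
proof -
  have *: "replicate l False @ False # p = replicate (Suc l) False @ p"
    by (simp add: replicate_app_Cons_same)
  show ?thesis
    unfolding eq_diff_eq ribbon_ascents[symmetric] ribbon_mult * ..
qed

lemma pattern_cases:
  "(\<exists>l. p = replicate l False) \<or> (\<exists>l q. p = replicate l False @ True # q)"
proof (induction p)
  case (Cons x p)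
  show ?case
  proof (cases x)
    case True
    then have "x # p = replicate 0 False @ True # p" by simp
    then show ?thesis by blast
  next
    case False
    with Cons show ?thesis
      by (metis (full_types) append_Cons replicate_Suc)
  qed
qed simp

text \<open>A descent can be removed or turned into an ascent, so the number of descents decreases.\<close>
lemma pattern_induct [case_names ascents descent]:
  assumes "\<And>l. P (replicate l False)"
    and "\<And>l q. P q \<Longrightarrow> P (replicate (Suc l) False @ q) \<Longrightarrow> P (replicate l False @ True # q)"
  shows "P p"
proof (induction "count_list p True" arbitrary: p rule: less_induct)
  case less
  have ascents: "count_list (replicate l False) True = 0" for l
    by (induction l) auto
  from pattern_cases[of p] show ?case
  proof (elim disjE exE)
    fix l q assume p: "p = replicate l False @ True # q"
    show ?thesis
      unfolding p
    proof (rule assms(2))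
      show "P q" "P (replicate (Suc l) False @ q)"
        by (rule less; simp add: p ascents)+
    qed
  qed (simp add: assms(1))
qed

text \<open>The two rules write every ribbon series as a polynomial in the
  \<open>complete_h\<close>; this takes the place of an involution on tableaux.\<close>

lemma Sym_ribbon: "ribbon p \<in> \<Lambda>"
proof (induction p rule: pattern_induct)
  case (ascents l)
  show ?case unfolding ribbon_ascents by (rule Sym_complete_h)
next
  case (descent l q)
  then show ?case
    unfolding ribbon_descent by (intro Sym_diff Sym_mult Sym_complete_h)
qed

section \<open>Skew hooks\<close>

text \<open>
  The pattern describes the walk through the cells of a skew hook from the top right to the bottom
  left: \<open>True\<close> is a step down, \<open>False\<close> is a step to the left.
\<close>
definition row_at :: "bool list \<Rightarrow> nat \<Rightarrow> nat" where
  "row_at p i = count_list (take i p) True"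

text \<open>Counting the steps to the left that are still to come puts the last cell into column 0.
  As the first cell lies in row 0, the hook is normalized.\<close>

definition col_at :: "bool list \<Rightarrow> nat \<Rightarrow> nat" where
  "col_at p i = count_list (drop i p) False"

definition cell_at :: "bool list \<Rightarrow> nat \<Rightarrow> cell" where
  "cell_at p i = (row_at p i, col_at p i)"

definition hook :: "bool list \<Rightarrow> cell set" where
  "hook p = cell_at p ` {..length p}"

lemma row_at_0 [simp]: "row_at p 0 = 0"
  by (simp add: row_at_def)

lemma col_at_length [simp]: "col_at p (length p) = 0"
  by (simp add: col_at_def)

lemma row_at_Suc: "i < length p \<Longrightarrow> row_at p (Suc i) = row_at p i + of_bool (p ! i)"
  by (simp add: row_at_def take_Suc_conv_app_nth)

lemma col_at_Suc: "i < length p \<Longrightarrow> col_at p i = col_at p (Suc i) + of_bool (\<not> p ! i)"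
  by (simp add: col_at_def Cons_nth_drop_Suc[symmetric])

lemma row_at_mono: "i \<le> j \<Longrightarrow> j \<le> length p \<Longrightarrow> row_at p i \<le> row_at p j"
  by (induction j rule: dec_induct) (auto simp: row_at_Suc)

lemma col_at_antimono: "i \<le> j \<Longrightarrow> j \<le> length p \<Longrightarrow> col_at p j \<le> col_at p i"
  by (induction j rule: dec_induct) (auto simp: col_at_Suc)

text \<open>Each step raises row minus column by one, so the diagonal of a cell tells its position
  on the walk.\<close>

lemma position_eq: "i \<le> length p \<Longrightarrow> i + col_at p i = col_at p 0 + row_at p i"
proof (induction i)
  case (Suc i)
  then show ?case
    using row_at_Suc[of i p] col_at_Suc[of i p] by (cases "p ! i") auto
qed simp

lemma cell_at_inj: "inj_on (cell_at p) {..length p}"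
proof (rule inj_onI)
  fix i j assume "i \<in> {..length p}" "j \<in> {..length p}" "cell_at p i = cell_at p j"
  then show "i = j"
    using position_eq[of i p] position_eq[of j p] by (simp add: cell_at_def)
qed

lemma finite_hook [simp]: "finite (hook p)"
  by (simp add: hook_def)

lemma card_hook: "card (hook p) = Suc (length p)"
  by (simp add: hook_def card_image cell_at_inj)

lemma hook_Nil: "hook [] = {(0, 0)}"
  by (auto simp: hook_def cell_at_def row_at_def col_at_def)

lemma hook_Cons: "hook (x # p) = insert (0, count_list (x # p) False) (cell_at (x # p) ` Suc ` {..length p})"
  by (simp add: hook_def atMost_Suc_eq_insert_0 cell_at_def[of _ 0] col_at_def row_at_def)

text \<open>Columns count steps to come, so a new first step moves no cell sideways; only a step
  down shifts the old cells, by one row.\<close>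

lemma hook_Cons_False: "hook (False # p) = insert (0, Suc (count_list p False)) (hook p)"
  unfolding hook_Cons image_image by (simp add: hook_def cell_at_def col_at_def row_at_def)

lemma hook_Cons_True: "hook (True # p) = insert (0, count_list p False) (map_prod Suc id ` hook p)"
  unfolding hook_Cons image_image by (simp add: hook_def cell_at_def col_at_def row_at_def image_image)

lemma in_hook_Cons_False:
  "(i, j) \<in> hook (False # p) \<longleftrightarrow> i = 0 \<and> j = Suc (count_list p False) \<or> (i, j) \<in> hook p"
  by (simp add: hook_Cons_False)

lemma in_hook_Cons_True:
  "(i, j) \<in> hook (True # p) \<longleftrightarrow> (case i of 0 \<Rightarrow> j = count_list p False | Suc i' \<Rightarrow> (i', j) \<in> hook p)"
  unfolding hook_Cons_True by (cases i) force+

lemma is_partition_mono: "is_partition \<nu> \<Longrightarrow> i \<le> j \<Longrightarrow> \<nu> j \<le> \<nu> i"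
  by (auto simp: is_partition_def antimono_def)

lemma is_partition_iff: "is_partition \<nu> \<longleftrightarrow> (\<forall>i. \<nu> (Suc i) \<le> \<nu> i) \<and> finite {i. \<nu> i \<noteq> 0}"
  unfolding is_partition_def antimono_iff_le_Suc ..

lemma is_partition_case_nat:
  assumes "is_partition \<nu>" "\<nu> 0 \<le> a"
  shows "is_partition (case_nat a \<nu>)"
  unfolding is_partition_iff
proof (intro conjI allI)
  show "case_nat a \<nu> (Suc i) \<le> case_nat a \<nu> i" for i
    using assms by (auto simp: is_partition_iff split: nat.split)
  have "{i. case_nat a \<nu> i \<noteq> 0} \<subseteq> insert 0 (Suc ` {i. \<nu> i \<noteq> 0})"
  proof
    fix i assume "i \<in> {i. case_nat a \<nu> i \<noteq> 0}"
    then show "i \<in> insert 0 (Suc ` {i. \<nu> i \<noteq> 0})" by (cases i) auto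
  qed
  then show "finite {i. case_nat a \<nu> i \<noteq> 0}"
    by (rule finite_subset) (use assms in \<open>auto simp: is_partition_def\<close>)
qed

text \<open>The induction adds the first cell of the walk, either at the right end of the top row or
  as a new top row of length one. The clause on \<open>\<nu> 0\<close> strengthens the claim: it
  locates the right end of the top row.\<close>

lemma hook_skew:
  "\<exists>\<nu> \<mu>. is_partition \<nu> \<and> is_partition \<mu> \<and> (\<forall>i. \<mu> i \<le> \<nu> i) \<and>
     \<nu> 0 = Suc (count_list p False) \<and> hook p = skew_cells \<nu> \<mu>"
proof (induction p)
  case Nil
  have zero: "is_partition (\<lambda>i. 0)" by (simp add: is_partition_iff)
  moreover have "is_partition (case_nat (Suc 0) (\<lambda>i. 0))"
    by (rule is_partition_case_nat[OF zero]) simp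
  moreover have "(i, j) \<in> hook [] \<longleftrightarrow> (i, j) \<in> skew_cells (case_nat (Suc 0) (\<lambda>i. 0)) (\<lambda>i. 0)" for i j
    by (cases i) (auto simp: hook_Nil skew_cells_def)
  then have "hook [] = skew_cells (case_nat (Suc 0) (\<lambda>i. 0)) (\<lambda>i. 0)"
    by (intro set_eqI) (simp add: split_paired_all)
  ultimately show ?case
    by (intro exI[of _ "case_nat (Suc 0) (\<lambda>i. 0)"] exI[of _ "\<lambda>i. 0"] conjI) simp_all
next
  case (Cons x p)
  then obtain \<nu> \<mu> where *: "is_partition \<nu>" "is_partition \<mu>" "\<forall>i. \<mu> i \<le> \<nu> i"
    "\<nu> 0 = Suc (count_list p False)" "hook p = skew_cells \<nu> \<mu>" by (elim exE conjE)
  show ?case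
  proof (cases x)
    case True
    let ?\<nu> = "case_nat (\<nu> 0) \<nu>" and ?\<mu> = "case_nat (count_list p False) \<mu>"
    \<comment> \<open>The first cell of the old walk lies in row 0, so the inner shape cannot pass
      its column; this makes the extended inner shape a partition.\<close>
    have "\<mu> 0 \<le> count_list p False"
    proof (rule ccontr)
      assume "\<not> \<mu> 0 \<le> count_list p False"
      moreover have "cell_at p 0 \<in> hook p" by (simp add: hook_def)
      then have "(0, count_list p False) \<in> hook p"
        by (simp add: cell_at_def col_at_def)
      ultimately show False by (simp add: *(5) skew_cells_def)
    qed
    then have "is_partition ?\<nu>" "is_partition ?\<mu>"
      by (simp_all add: is_partition_case_nat *(1,2))
    moreover have "?\<mu> i \<le> ?\<nu> i" for i
      by (cases i) (simp_all add: *(3,4))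
    moreover have "(i, j) \<in> hook (x # p) \<longleftrightarrow> (i, j) \<in> skew_cells ?\<nu> ?\<mu>" for i j
      using True by (cases i) (auto simp: in_hook_Cons_True *(4,5) skew_cells_def)
    then have "hook (x # p) = skew_cells ?\<nu> ?\<mu>"
      by (intro set_eqI) (simp add: split_paired_all)
    moreover have "?\<nu> 0 = Suc (count_list (x # p) False)"
      using True by (simp add: *(4))
    ultimately show ?thesis by blast
  next
    case False
    let ?\<nu> = "\<nu>(0 := Suc (\<nu> 0))"
    have "?\<nu> (Suc i) \<le> ?\<nu> i" for i
      using is_partition_mono[OF *(1), of i "Suc i"] by (cases i) simp_all
    moreover have "finite {i. ?\<nu> i \<noteq> 0}"
    proof (rule finite_subset)
      show "{i. ?\<nu> i \<noteq> 0} \<subseteq> insert 0 {i. \<nu> i \<noteq> 0}"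
        by (rule subsetI) (simp split: if_splits)
      show "finite (insert 0 {i. \<nu> i \<noteq> 0})"
        using *(1) unfolding is_partition_def finite_insert by (rule conjunct2)
    qed
    ultimately have "is_partition ?\<nu>"
      unfolding is_partition_iff by (rule_tac conjI[OF allI])
    moreover have "\<mu> i \<le> ?\<nu> i" for i
      using spec[OF *(3), of i] by (cases i) simp_all
    moreover have "(i, j) \<in> hook (x # p) \<longleftrightarrow> (i, j) \<in> skew_cells ?\<nu> \<mu>" for i j
    proof (cases i)
      case 0
      have "\<mu> 0 \<le> Suc (count_list p False)" using *(3,4) by metis
      with False 0 show ?thesis
        unfolding skew_cells_def *(4) by (simp add: in_hook_Cons_False *(4,5) skew_cells_def) linarith
    next
      case (Suc i')
      with False show ?thesis
        by (simp add: in_hook_Cons_False *(5) skew_cells_def)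
    qed
    then have "hook (x # p) = skew_cells ?\<nu> \<mu>"
      by (intro set_eqI) (simp add: split_paired_all)
    moreover have "?\<nu> 0 = Suc (count_list (x # p) False)"
      using False by (simp add: *(4))
    ultimately show ?thesis using *(2) by blast
  qed
qed

lemma adjacent_sym: "adjacent c c' \<Longrightarrow> adjacent c' c"
  by (auto simp: adjacent_def)

lemma adjacent_cell_at: "i < length p \<Longrightarrow> adjacent (cell_at p i) (cell_at p (Suc i))"
  using row_at_Suc[of i p] col_at_Suc[of i p]
  by (cases "p ! i") (auto simp: adjacent_def cell_at_def)

lemma hook_connected: "cells_connected (hook p)"
proof -
  let ?R = "{(a, b). a \<in> hook p \<and> b \<in> hook p \<and> adjacent a b}"
  have "sym (?R\<^sup>*)"
    by (intro sym_rtrancl symI) (auto intro: adjacent_sym)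
  moreover have "(cell_at p 0, cell_at p i) \<in> ?R\<^sup>*" if "i \<le> length p" for i
    using that
  proof (induction i)
    case (Suc i)
    then have "(cell_at p i, cell_at p (Suc i)) \<in> ?R"
      by (auto simp: hook_def intro: adjacent_cell_at)
    with Suc show ?case by (meson Suc_leD rtrancl.rtrancl_into_rtrancl)
  qed simp
  ultimately show ?thesis
    unfolding cells_connected_def hook_def by (auto dest: symD intro: rtrancl_trans)
qed

text \<open>The walk only goes down and to the left. The corners (i, j) and (i+1, j+1) of a square
  would contradict this.\<close>

lemma hook_chain:
  assumes "(i, j) \<in> hook p" "(i', j') \<in> hook p" "i < i'"
  shows "j' \<le> j"
proof -
  obtain x y where xy: "x \<le> length p" "y \<le> length p" "i = row_at p x" "j = col_at p x"
    "i' = row_at p y" "j' = col_at p y"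
    using assms(1,2) by (auto simp: hook_def cell_at_def)
  have "x \<le> y"
    using assms(3) row_at_mono[of y x p] xy by (meson nle_le not_less)
  then show ?thesis using col_at_antimono[of x y p] xy by simp
qed

lemma is_skew_hook_hook: "is_skew_hook (hook p)"
  unfolding is_skew_hook_def
proof (intro conjI hook_connected)
  show "is_skew_diagram (hook p)"
    using hook_skew[of p] unfolding is_skew_diagram_def by blast
  show "normalized (hook p)"
  proof -
    have "cell_at p 0 \<in> hook p" "cell_at p (length p) \<in> hook p"
      by (simp_all add: hook_def)
    then show ?thesis
      unfolding normalized_def by (force simp: cell_at_def)
  qed
  show "no_square (hook p)"
    unfolding no_square_def using hook_chain[of _ _ p "Suc _" "Suc _"] by fastforce
qed

lemma skew_cells_convex:
  assumes "is_partition \<nu>" "is_partition \<mu>" "(i, j) \<in> skew_cells \<nu> \<mu>" "(i', j') \<in> skew_cells \<nu> \<mu>"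
    "i \<le> a" "a \<le> i'" "j \<le> b" "b \<le> j'"
  shows "(a, b) \<in> skew_cells \<nu> \<mu>"
  using assms is_partition_mono[of \<nu> a i'] is_partition_mono[of \<mu> i a]
  by (auto simp: skew_cells_def)

lemma finite_skew_cells: "is_partition \<nu> \<Longrightarrow> finite (skew_cells \<nu> \<mu>)"
  by (rule finite_subset[of _ "SIGMA i:{i. \<nu> i \<noteq> 0}. {..<\<nu> i}"])
    (auto simp: skew_cells_def is_partition_def)

text \<open>
  The cells of a skew hook lie on distinct diagonals, which form an interval by connectedness.
\<close>
lemma skew_hook_is_hook:
  assumes "is_skew_hook D"
  shows "\<exists>p. D = hook p"
proof -
  obtain \<nu> \<mu> where part: "is_partition \<nu>" "is_partition \<mu>" and D: "D = skew_cells \<nu> \<mu>"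
    using assms by (auto simp: is_skew_hook_def is_skew_diagram_def)
  have conn: "cells_connected D" and nosq: "no_square D"
    using assms by (auto simp: is_skew_hook_def)
  obtain c\<^sub>0 c\<^sub>1 where c0: "c\<^sub>0 \<in> D" "fst c\<^sub>0 = 0" and c1: "c\<^sub>1 \<in> D" "snd c\<^sub>1 = 0"
    using assms by (auto simp: is_skew_hook_def normalized_def)
  have fin: "finite D"
    unfolding D by (rule finite_skew_cells[OF part(1)])
  \<comment> \<open>Otherwise \<open>c'\<close> lies strictly below and to the right of
    \<open>c\<close>; convexity fills the rectangle between them, and this contains a
    square.\<close>
  have chain: "snd c' \<le> snd c" if "c \<in> D" "c' \<in> D" "fst c < fst c'" for c c'
  proof (rule ccontr)
    assume *: "\<not> snd c' \<le> snd c"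
    have "(a, b) \<in> D" if "fst c \<le> a" "a \<le> fst c'" "snd c \<le> b" "b \<le> snd c'" for a b
      using skew_cells_convex[OF part, of "fst c" "snd c" "fst c'" "snd c'" a b] that
        \<open>c \<in> D\<close> \<open>c' \<in> D\<close> by (simp add: D)
    then have "{(fst c, snd c), (fst c, Suc (snd c)), (Suc (fst c), snd c), (Suc (fst c), Suc (snd c))} \<subseteq> D"
      using * that(1,3) by simp
    then show False
      using nosq unfolding no_square_def by blast
  qed
  define A where "A = Max (snd ` D)"
  have le_A: "snd c \<le> A" if "c \<in> D" for c
    unfolding A_def using fin that by (intro Max_ge) auto
  obtain cA where cA: "cA \<in> D" "snd cA = A"
  proof -
    have "A \<in> snd ` D"
      unfolding A_def using fin c0(1) by (intro Max_in) auto
    then show ?thesis using that by auto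
  qed
  \<comment> \<open>The diagonal of the cell, shifted by the largest column \<open>A\<close> to stay
    in the naturals. By \<open>order\<close>, the cells form a chain going down and left along
    increasing \<open>f\<close>.\<close>
  define f where "f c = fst c + (A - snd c)" for c :: cell
  have order: "fst c \<le> fst c' \<and> snd c' \<le> snd c" if "c \<in> D" "c' \<in> D" "f c \<le> f c'" for c c'
    using chain[of c c'] chain[of c' c] le_A[of c] le_A[of c'] that
    by (cases "fst c" "fst c'" rule: linorder_cases) (auto simp: f_def)
  have inj: "inj_on f D"
  proof (rule inj_onI)
    fix c c' assume "c \<in> D" "c' \<in> D" "f c = f c'"
    then show "c = c'"
      using order[of c c'] order[of c' c] by (intro prod_eqI) auto
  qed
  \<comment> \<open>Whichever of \<open>cA\<close> (rightmost column) and \<open>c\<^sub>0\<close>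
    (top row) comes first in the chain lies in both the top row and the rightmost column.\<close>
  have "0 \<in> f ` D"
  proof (cases "f cA \<le> f c\<^sub>0")
    case True
    then have "f cA = 0" using order[of cA c\<^sub>0] cA c0 by (simp add: f_def)
    then show ?thesis using cA(1) by force
  next
    case False
    then have "f c\<^sub>0 = 0" using order[of c\<^sub>0 cA] cA c0 by (simp add: f_def)
    then show ?thesis using c0(1) by force
  qed
  then obtain o' where o': "o' \<in> D" "f o' = 0" by auto
  \<comment> \<open>A step to an adjacent cell raises \<open>f\<close> by at most one, so a
    connecting path skips no diagonal.\<close>
  have down: "{..f c} \<subseteq> f ` D" if "c \<in> D" for c
  proof -
    have "(o', c) \<in> {(a, b). a \<in> D \<and> b \<in> D \<and> adjacent a b}\<^sup>*"
      using conn o'(1) that by (auto simp: cells_connected_def)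
    then show ?thesis
    proof (induction rule: rtrancl_induct)
      case base
      then show ?case using o' by force
    next
      case (step b c)
      then have "f c \<le> Suc (f b)"
        by (auto simp: adjacent_def f_def)
      then have "{..f c} \<subseteq> insert (f c) {..f b}" by auto
      then show ?case using step by blast
    qed
  qed
  define N where "N = Max (f ` D)"
  have image: "f ` D = {..N}"
  proof
    show "f ` D \<subseteq> {..N}" unfolding N_def using fin by auto
    have "N \<in> f ` D" unfolding N_def using fin c0(1) by (intro Max_in) auto
    then show "{..N} \<subseteq> f ` D" using down by auto
  qed
  define g where "g = inv_into D f"
  have g: "g i \<in> D" "f (g i) = i" if "i \<le> N" for i
    using that image unfolding g_def by (auto intro: inv_into_into f_inv_into_f)
  have D_eq: "D = g ` {..N}"
    unfolding g_def image[symmetric] by (simp add: inj)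
  define p where "p = map (\<lambda>i. fst (g i) < fst (g (Suc i))) [0..<N]"
  have [simp]: "length p = N" by (simp add: p_def)
  have step: "fst (g (Suc i)) = fst (g i) + of_bool (p ! i)" if "i < N" for i
  proof -
    have "fst (g i) \<le> fst (g (Suc i)) \<and> snd (g (Suc i)) \<le> snd (g i)"
      using that by (intro order) (auto simp: g)
    moreover have "f (g (Suc i)) = Suc (f (g i))" using that by (simp add: g)
    ultimately have "fst (g (Suc i)) \<le> Suc (fst (g i))"
      using le_A[of "g i"] g[of i] that by (auto simp: f_def)
    with \<open>_ \<and> _\<close> show ?thesis using that by (auto simp: p_def)
  qed
  have row: "row_at p i = fst (g i)" if "i \<le> N" for i
    using that
  proof (induction i)
    case 0
    then show ?case using g(2)[of 0] by (simp add: f_def)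
  qed (simp add: step row_at_Suc)
  \<comment> \<open>The last cell reaches column 0 because \<open>c\<^sub>1\<close> does; this
    calibrates the columns of the walk against \<open>A\<close>.\<close>
  have "snd (g N) \<le> snd c\<^sub>1"
    using order[of c\<^sub>1 "g N"] c1(1) image g[of N] by auto
  then have "snd (g N) = 0" using c1(2) by simp
  then have "A = col_at p 0"
    using g(2)[of N] position_eq[of N p] col_at_length[of p] row[of N]
    by (simp add: f_def)
  then have "col_at p i = snd (g i)" if "i \<le> N" for i
    using g[of i] le_A[of "g i"] position_eq[of i p] row[of i] that by (simp add: f_def)
  then have "g ` {..N} = hook p"
    unfolding hook_def using row by (intro image_cong) (auto simp: cell_at_def prod_eq_iff)
  then show ?thesis using D_eq by blast
qed

section \<open>Column sizes of a hook\<close>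

text \<open>For either kind of first step, the new cell lies in the rightmost column and every old
  cell keeps its column.\<close>

lemma col_size_hook_Cons:
  "col_size (hook (x # p)) j = col_size (hook p) j + of_bool (j = count_list (x # p) False)"
proof (cases x)
  case True
  have "{i. (i, j) \<in> hook (x # p)} =
      Suc ` {i. (i, j) \<in> hook p} \<union> (if j = count_list p False then {0} else {})"
  proof (rule set_eqI)
    fix i
    show "i \<in> {i. (i, j) \<in> hook (x # p)} \<longleftrightarrow>
        i \<in> Suc ` {i. (i, j) \<in> hook p} \<union> (if j = count_list p False then {0} else {})"
      using True by (cases i) (auto simp: in_hook_Cons_True)
  qed
  moreover have "finite {i. (i, j) \<in> hook p}"
    by (rule finite_subset[of _ "fst ` hook p"]) force+
  ultimately show ?thesis
    using True by (cases "j = count_list p False") (simp_all add: col_size_def card_image)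
next
  case False
  have bound: "j \<le> count_list p False" if "(i, j) \<in> hook p" for i j
    using that col_at_antimono[of 0 _ p] by (auto simp: hook_def cell_at_def col_at_def)
  have eq: "{i. (i, j) \<in> hook (x # p)} =
      {i. (i, j) \<in> hook p} \<union> (if j = Suc (count_list p False) then {0} else {})"
    using False by (auto simp: hook_Cons_False)
  show ?thesis
  proof (cases "j = Suc (count_list p False)")
    case True
    then have "{i. (i, j) \<in> hook p} = {}"
      using bound[of _ j] by (intro equals0I) fastforce
    with True eq False show ?thesis by (simp add: col_size_def)
  next
    case ne: False
    with eq False show ?thesis by (simp add: col_size_def)
  qed
qed

lemma col_size_hook_Nil: "col_size (hook []) j = of_bool (j = 0)"
  by (auto simp: hook_Nil col_size_def)

lemma snd_hook: "snd ` hook p = {..count_list p False}"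
proof (induction p)
  case (Cons x p)
  then show ?case
    by (cases x) (auto simp: hook_Cons_True hook_Cons_False image_image atMost_Suc)
qed (simp add: hook_Nil)

lemma col_size_hook_outside: "count_list p False < j \<Longrightarrow> col_size (hook p) j = 0"
  by (induction p) (auto simp: col_size_hook_Nil col_size_hook_Cons split: if_splits)

definition top_size :: "bool list \<Rightarrow> nat" where
  "top_size p = col_size (hook p) (count_list p False)"

definition short_cols :: "bool list \<Rightarrow> bool" where
  "short_cols p \<longleftrightarrow> (\<forall>j\<le>count_list p False. col_size (hook p) j = 1 \<or> col_size (hook p) j = 2)"

lemma top_size_simps [simp]:
  "top_size [] = 1" "top_size (False # p) = 1" "top_size (True # p) = Suc (top_size p)"
  by (simp_all add: top_size_def col_size_hook_Nil col_size_hook_Cons col_size_hook_outside)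

lemma top_size_pos: "0 < top_size p"
  by (induction p rule: good.induct) simp_all

lemma short_cols_simps [simp]:
  "short_cols []" "short_cols (False # p) \<longleftrightarrow> short_cols p"
  "short_cols (True # p) \<longleftrightarrow> short_cols p \<and> top_size p = 1"
proof -
  show "short_cols []" by (simp add: short_cols_def col_size_hook_Nil)
  show "short_cols (False # p) \<longleftrightarrow> short_cols p"
    by (auto simp: short_cols_def col_size_hook_Cons le_Suc_eq col_size_hook_outside)
  show "short_cols (True # p) \<longleftrightarrow> short_cols p \<and> top_size p = 1"
    using top_size_pos[of p] by (auto simp: short_cols_def top_size_def col_size_hook_Cons)
qed

text \<open>A run of k steps down creates a column of size k + 1. Columns of size at most 2 exclude
  consecutive descents, a last column of size 1 excludes a leading one; then every
  \<open>True\<close> pairs with the \<open>False\<close> before it.\<close>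

lemma good_iff: "good p \<longleftrightarrow> short_cols p \<and> top_size p = 1"
  by (induction p rule: good.induct) (use top_size_pos in \<open>auto\<close>)

lemma sum_col_size_hook: "(\<Sum>j\<le>count_list p False. col_size (hook p) j) = Suc (length p)"
proof (induction p)
  case (Cons x p)
  then show ?case
    by (cases x) (simp_all add: col_size_hook_Cons sum.distrib col_size_hook_outside)
qed (simp add: col_size_hook_Nil)

lemma length_eq_count: "length p = count_list p True + count_list p False"
  by (induction p) auto

lemma hook_in_skew_hooks_iff:
  "hook p \<in> skew_hooks (Suc n) k \<longleftrightarrow> length p = n \<and> good p \<and> count_list p True = k"
proof -
  let ?a = "count_list p False" and ?s = "col_size (hook p)"
  have max: "Max {..?a} = ?a"
    by (rule Max_eqI) auto
  \<comment> \<open>Counting columns and counting cells gives two linear equations for the numbers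
    of columns of sizes 1 and 2.\<close>
  have counts: "card {j \<in> {..?a}. ?s j = 2} = count_list p True \<and>
      card {j \<in> {..?a}. ?s j = 1} = Suc (length p) - 2 * count_list p True"
    if "short_cols p"
  proof -
    let ?A = "{j \<in> {..?a}. ?s j = 1}" and ?B = "{j \<in> {..?a}. ?s j = 2}"
    have split: "{..?a} = ?A \<union> ?B" "?A \<inter> ?B = {}"
      using that by (auto simp: short_cols_def)
    have "card {..?a} = card (?A \<union> ?B)" "sum ?s {..?a} = sum ?s (?A \<union> ?B)"
      using split(1) by (rule arg_cong)+
    moreover have "card (?A \<union> ?B) = card ?A + card ?B" "sum ?s (?A \<union> ?B) = sum ?s ?A + sum ?s ?B"
      by (rule card_Un_disjoint[OF _ _ split(2)] sum.union_disjoint[OF _ _ split(2)]; simp)+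
    ultimately have "Suc ?a = card ?A + card ?B" "Suc (length p) = sum ?s ?A + sum ?s ?B"
      by (simp_all only: card_atMost sum_col_size_hook)
    moreover have "sum ?s ?A = card ?A" "sum ?s ?B = 2 * card ?B"
      by simp_all
    ultimately show ?thesis
      using length_eq_count[of p] by linarith
  qed
  show ?thesis
    unfolding skew_hooks_def mem_Collect_eq snd_hook max card_hook
    using counts good_iff[of p] is_skew_hook_hook[of p]
    by (auto simp: short_cols_def top_size_def)
qed

text \<open>The set of columns fixes the start, and then the diagonal of each cell fixes its
  position, so the rows along the walk are determined.\<close>

lemma hook_inj: "inj hook"
proof (rule injI)
  fix p q assume eq: "hook p = hook q"
  then have len: "length p = length q"
    by (metis card_hook Suc_inject)
  have "{..count_list p False} = {..count_list q False}"
    using eq by (simp flip: snd_hook)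
  then have col0: "col_at p 0 = col_at q 0"
    by (simp add: col_at_def)
  have row: "row_at p i = row_at q i" if "i \<le> length p" for i
  proof -
    have "cell_at p i \<in> hook p"
      using that by (auto simp: hook_def)
    then have "cell_at p i \<in> hook q"
      by (simp add: eq)
    then obtain j where j: "j \<le> length q" "cell_at p i = cell_at q j"
      by (auto simp: hook_def)
    then have "i = j"
      using position_eq[of i p] position_eq[of j q] that col0 by (simp add: cell_at_def)
    with j show ?thesis by (simp add: cell_at_def)
  qed
  show "p = q"
  proof (rule nth_equalityI[OF len])
    fix i assume "i < length p"
    then show "p ! i = q ! i"
      using row[of i] row[of "Suc i"] row_at_Suc[of i p] row_at_Suc[of i q] len
      by (cases "p ! i"; cases "q ! i") simp_all
  qed
qed

lemma skew_hooks_Suc: "skew_hooks (Suc n) k = hook ` {p \<in> good_pats n. count_list p True = k}"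
proof (intro equalityI subsetI)
  fix D assume D: "D \<in> skew_hooks (Suc n) k"
  then obtain p where "D = hook p"
    using skew_hook_is_hook[of D] by (auto simp: skew_hooks_def)
  with D show "D \<in> hook ` {p \<in> good_pats n. count_list p True = k}"
    by (auto simp: hook_in_skew_hooks_iff good_pats_def)
qed (auto simp: hook_in_skew_hooks_iff good_pats_def)

section \<open>Tableaux on a hook as words\<close>

lemma nth_pat: "Suc i < length w \<Longrightarrow> pat w ! i = (w ! i < w ! Suc i)"
proof (induction "(<) :: nat \<Rightarrow> nat \<Rightarrow> bool" w arbitrary: i rule: pattern.induct)
  case (1 u v w)
  then show ?case by (cases i) auto
qed auto

lemma row_weakly_decreasing:
  assumes "\<And>i. i < length p \<Longrightarrow> (w i < w (Suc i)) = p ! i"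
    and "i \<le> j" "j \<le> length p" "row_at p i = row_at p j"
  shows "w j \<le> (w i :: nat)"
  using assms(2-)
proof (induction j rule: dec_induct)
  case (step j)
  then have "row_at p i \<le> row_at p j" by (intro row_at_mono) auto
  with step show ?case
    using assms(1)[of j] row_at_Suc[of j p] by (cases "p ! j") auto
qed simp

lemma col_strictly_increasing:
  assumes "\<And>i. i < length p \<Longrightarrow> (w i < w (Suc i)) = p ! i"
    and "i < j" "j \<le> length p" "col_at p i = col_at p j"
  shows "w i < (w j :: nat)"
proof -
  \<comment> \<open>The strict inequality fails at j = i, where the induction starts; this stronger
    form holds there.\<close>
  have "w i + (j - i) \<le> w j"
    using less_imp_le[OF assms(2)] assms(3-)
  proof (induction j rule: dec_induct)
    case (step j)
    then have "col_at p j \<le> col_at p i" by (intro col_at_antimono) auto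
    with step show ?case
      using assms(1)[of j] col_at_Suc[of j p] by (cases "p ! j") auto
  qed simp
  then show ?thesis using assms(2) by simp
qed

text \<open>Cells in a common row or column are joined by a straight piece of the walk, so comparing
  consecutive cells is enough.\<close>

lemma ssyt_hook_iff:
  assumes "T \<in> hook p \<rightarrow>\<^sub>E UNIV"
  shows "T \<in> ssyt (hook p) \<longleftrightarrow>
    (\<forall>i<length p. (T (cell_at p i) < T (cell_at p (Suc i))) = p ! i)"
proof
  assume T: "T \<in> ssyt (hook p)"
  have rows: "T (a, b) \<le> T (a, b')" if "(a, b) \<in> hook p" "(a, b') \<in> hook p" "b < b'" for a b b'
    using T that unfolding ssyt_def by blast
  have cols: "T (a, b) < T (a', b)" if "(a, b) \<in> hook p" "(a', b) \<in> hook p" "a < a'" for a a' b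
    using T that unfolding ssyt_def by blast
  show "\<forall>i<length p. (T (cell_at p i) < T (cell_at p (Suc i))) = p ! i"
  proof (intro allI impI)
    fix i assume i: "i < length p"
    then have in_hook: "cell_at p i \<in> hook p" "cell_at p (Suc i) \<in> hook p"
      by (auto simp: hook_def)
    show "(T (cell_at p i) < T (cell_at p (Suc i))) = p ! i"
    proof (cases "p ! i")
      case True
      define a b where "a = row_at p i" "b = col_at p i"
      have "cell_at p i = (a, b)" "cell_at p (Suc i) = (Suc a, b)"
        using i True row_at_Suc[of i p] col_at_Suc[of i p] by (simp_all add: cell_at_def a_b_def)
      then show ?thesis
        using cols[of a b "Suc a"] in_hook True by simp
    next
      case False
      define a b where "a = row_at p i" "b = col_at p (Suc i)"
      have "cell_at p i = (a, Suc b)" "cell_at p (Suc i) = (a, b)"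
        using i False row_at_Suc[of i p] col_at_Suc[of i p] by (simp_all add: cell_at_def a_b_def)
      then show ?thesis
        using rows[of a b "Suc b"] in_hook False by simp
    qed
  qed
next
  assume *: "\<forall>i<length p. (T (cell_at p i) < T (cell_at p (Suc i))) = p ! i"
  have step: "(T (cell_at p i) < T (cell_at p (Suc i))) = p ! i" if "i < length p" for i
    using * that by blast
  have position: "\<exists>x\<le>length p. c = cell_at p x" if "c \<in> hook p" for c
    using that unfolding hook_def by blast
  show "T \<in> ssyt (hook p)"
    unfolding ssyt_def
  proof (intro CollectI conjI allI impI assms)
    fix i j j' assume *: "(i, j) \<in> hook p \<and> (i, j') \<in> hook p \<and> j < j'"
    then obtain x y where xy: "x \<le> length p" "y \<le> length p" "(i, j) = cell_at p x" "(i, j') = cell_at p y"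
      using position by metis
    have "y \<le> x"
    proof (rule ccontr)
      assume "\<not> y \<le> x"
      then have "col_at p y \<le> col_at p x" using xy by (intro col_at_antimono) simp_all
      then show False using * xy(3,4) by (simp add: cell_at_def)
    qed
    moreover have "row_at p y = row_at p x"
      using xy(3,4) by (simp add: cell_at_def)
    ultimately have "T (cell_at p x) \<le> T (cell_at p y)"
      using step xy(1) by (intro row_weakly_decreasing[of p "\<lambda>i. T (cell_at p i)"])
    then show "T (i, j) \<le> T (i, j')"
      by (simp only: xy)
  next
    fix i i' j assume *: "(i, j) \<in> hook p \<and> (i', j) \<in> hook p \<and> i < i'"
    then obtain x y where xy: "x \<le> length p" "y \<le> length p" "(i, j) = cell_at p x" "(i', j) = cell_at p y"
      using position by metis
    have "x < y"
    proof (rule ccontr)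
      assume "\<not> x < y"
      then have "row_at p y \<le> row_at p x" using xy by (intro row_at_mono) simp_all
      then show False using * xy(3,4) by (simp add: cell_at_def)
    qed
    moreover have "col_at p x = col_at p y"
      using xy(3,4) by (simp add: cell_at_def)
    ultimately have "T (cell_at p x) < T (cell_at p y)"
      using step xy(2) by (intro col_strictly_increasing[of p "\<lambda>i. T (cell_at p i)"])
    then show "T (i, j) < T (i', j)"
      by (simp only: xy)
  qed
qed

lemma skew_schur_hook: "skew_schur (hook p) = ribbon p"
proof (rule xseries_eqI)
  fix m
  define read where "read T = map (\<lambda>i. T (cell_at p i)) [0..<Suc (length p)]" for T :: "cell \<Rightarrow> nat"
  let ?S = "{T \<in> ssyt (hook p). \<forall>v. card {c \<in> hook p. T c = v} = Poly_Mapping.lookup m v}"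
  have count: "count_list (read T) v = card {c \<in> hook p. T c = v}" for T v
  proof -
    have "count_list (read T) v = card {i. i < Suc (length p) \<and> T (cell_at p i) = v}"
      unfolding read_def count_list_eq_length_filter length_filter_conv_card
      by (intro arg_cong[where f = card]) (auto simp del: upt_Suc)
    also have "\<dots> = card (cell_at p ` {i. i < Suc (length p) \<and> T (cell_at p i) = v})"
      by (rule card_image[symmetric], rule inj_on_subset[OF cell_at_inj]) auto
    also have "cell_at p ` {i. i < Suc (length p) \<and> T (cell_at p i) = v} = {c \<in> hook p. T c = v}"
      by (auto simp: hook_def)
    finally show ?thesis .
  qed
  have pat_read: "pat (read T) = p \<longleftrightarrow> T \<in> ssyt (hook p)" if "T \<in> hook p \<rightarrow>\<^sub>E UNIV" for T
  proof -
    have len: "length (read T) = Suc (length p)" by (simp add: read_def)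
    have nth: "read T ! i = T (cell_at p i)" if "i \<le> length p" for i
      using that by (simp add: read_def del: upt_Suc)
    have "pat (read T) = p \<longleftrightarrow> (\<forall>i<length p. pat (read T) ! i = p ! i)"
      using len by (simp add: list_eq_iff_nth_eq length_pattern)
    also have "\<dots> \<longleftrightarrow> (\<forall>i<length p. (T (cell_at p i) < T (cell_at p (Suc i))) = p ! i)"
      by (simp add: nth_pat len nth)
    finally show ?thesis using ssyt_hook_iff[OF that] by simp
  qed
  have "bij_betw read ?S (ribbon_words p m)"
  proof (rule bij_betw_imageI)
    show "inj_on read ?S"
    proof (rule inj_onI)
      fix T T' assume *: "T \<in> ?S" "T' \<in> ?S" "read T = read T'"
      then have ext: "T \<in> hook p \<rightarrow>\<^sub>E UNIV" "T' \<in> hook p \<rightarrow>\<^sub>E UNIV" by (auto simp: ssyt_def)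
      show "T = T'"
      proof (rule PiE_ext[OF ext])
        fix c assume "c \<in> hook p"
        then obtain i where "i \<le> length p" "c = cell_at p i" by (auto simp: hook_def)
        then show "T c = T' c"
          using *(3) unfolding read_def by (auto simp del: upt_Suc)
      qed
    qed
    show "read ` ?S = ribbon_words p m"
    proof (intro equalityI subsetI)
      fix w assume "w \<in> read ` ?S"
      then obtain T where T: "T \<in> ?S" "w = read T" by blast
      then have "T \<in> hook p \<rightarrow>\<^sub>E UNIV" by (simp add: ssyt_def)
      with T show "w \<in> ribbon_words p m"
        using pat_read[of T] by (simp add: ribbon_words_def count) (simp add: read_def)
    next
      fix w assume w: "w \<in> ribbon_words p m"
      \<comment> \<open>The tableau writes each letter into the cell at its position;
        \<open>cell_at\<close> is injective on positions.\<close>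
      define T where "T = restrict (\<lambda>c. w ! (inv_into {..length p} (cell_at p) c)) (hook p)"
      have "T (cell_at p i) = w ! i" if "i \<le> length p" for i
        using that cell_at_inj[of p] by (auto simp: T_def hook_def)
      then have read: "read T = w"
        using w by (auto simp: read_def ribbon_words_def list_eq_iff_nth_eq simp del: upt_Suc)
      moreover have "T \<in> hook p \<rightarrow>\<^sub>E UNIV" by (simp add: T_def)
      ultimately have "T \<in> ?S"
        using w pat_read[of T] count[of T] by (simp add: ribbon_words_def)
      with read show "w \<in> read ` ?S" by blast
    qed
  qed
  then show "xcoeff (skew_schur (hook p)) m = xcoeff (ribbon p) m"
    unfolding skew_schur_def ribbon_def xcoeff_Abs by (simp add: bij_betw_same_card)
qed

lemma gamma_hook_Suc:
  "gamma_hook (Suc n) k = (\<Sum>p\<in>{p \<in> good_pats n. count_list p True = k}. ribbon p)"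
  unfolding gamma_hook_def skew_hooks_Suc
  by (simp add: sum.reindex inj_on_subset[OF hook_inj] skew_schur_hook)

section \<open>The Pieri rule\<close>

text \<open>\<open>strip \<kappa> \<nu>\<close> says that \<open>\<nu> / \<kappa>\<close> is a horizontal strip.\<close>
definition strip :: "(nat \<Rightarrow> nat) \<Rightarrow> (nat \<Rightarrow> nat) \<Rightarrow> bool" where
  "strip \<kappa> \<nu> \<longleftrightarrow> (\<forall>i. \<kappa> i \<le> \<nu> i \<and> \<nu> (Suc i) \<le> \<kappa> i)"

definition psize :: "(nat \<Rightarrow> nat) \<Rightarrow> nat" where
  "psize \<nu> = (\<Sum>i | \<nu> i \<noteq> 0. \<nu> i)"

text \<open>If \<nu> is a partition, so are the members, by \<open>strip_partition_up\<close>;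
  likewise for \<open>downs\<close>.\<close>

definition ups :: "nat \<Rightarrow> (nat \<Rightarrow> nat) \<Rightarrow> (nat \<Rightarrow> nat) set" where
  "ups r \<nu> = {\<mu>. strip \<nu> \<mu> \<and> psize \<mu> = psize \<nu> + r}"

definition downs :: "nat \<Rightarrow> (nat \<Rightarrow> nat) \<Rightarrow> (nat \<Rightarrow> nat) set" where
  "downs r \<nu> = {\<kappa>. strip \<kappa> \<nu> \<and> psize \<nu> = psize \<kappa> + r}"

lemma psize_eq_sum: "(\<And>i. L \<le> i \<Longrightarrow> \<nu> i = 0) \<Longrightarrow> psize \<nu> = (\<Sum>i<L. \<nu> i)"
proof -
  assume *: "\<And>i. L \<le> i \<Longrightarrow> \<nu> i = 0"
  have "{i. \<nu> i \<noteq> 0} \<subseteq> {..<L}"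
    by (rule subsetI) (metis * leI lessThan_iff mem_Collect_eq)
  then show ?thesis
    unfolding psize_def by (intro sum.mono_neutral_left) simp_all
qed

lemma is_partition_bound:
  assumes "is_partition \<nu>"
  shows "\<exists>L. \<forall>i\<ge>L. \<nu> i = 0"
proof -
  have "finite {i. \<nu> i \<noteq> 0}" using assms by (simp add: is_partition_def)
  then obtain L where "\<forall>i\<in>{i. \<nu> i \<noteq> 0}. i < L"
    using finite_nat_set_iff_bounded by blast
  then have "\<forall>i\<ge>L. \<nu> i = 0" by (metis mem_Collect_eq not_le)
  then show ?thesis ..
qed

lemma is_partitionI:
  assumes "\<And>i. \<nu> (Suc i) \<le> \<nu> i" "\<And>i. L \<le> i \<Longrightarrow> \<nu> i = 0"
  shows "is_partition \<nu>"
proof -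
  have "{i. \<nu> i \<noteq> 0} \<subseteq> {..<L}"
  proof
    fix i assume "i \<in> {i. \<nu> i \<noteq> 0}"
    then show "i \<in> {..<L}" using assms(2)[of i] by (cases "i < L") simp_all
  qed
  then have "finite {i. \<nu> i \<noteq> 0}" by (rule finite_subset) simp
  with assms(1) show ?thesis by (simp add: is_partition_iff)
qed

lemma stripD: "strip \<kappa> \<nu> \<Longrightarrow> \<kappa> i \<le> \<nu> i" "strip \<kappa> \<nu> \<Longrightarrow> \<nu> (Suc i) \<le> \<kappa> i"
  by (simp_all add: strip_def)

lemma strip_partition_down:
  assumes "strip \<kappa> \<nu>" "is_partition \<nu>"
  shows "is_partition \<kappa>"
proof -
  obtain L where "\<forall>i\<ge>L. \<nu> i = 0" using is_partition_bound[OF assms(2)] ..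
  then have L: "\<nu> i = 0" if "L \<le> i" for i using that by blast
  show ?thesis
  proof (rule is_partitionI[of _ L])
    show "\<kappa> (Suc i) \<le> \<kappa> i" for i
      using stripD[OF assms(1), of i] stripD[OF assms(1), of "Suc i"] by linarith
    show "\<kappa> i = 0" if "L \<le> i" for i
      using stripD(1)[OF assms(1), of i] L[OF that] by simp
  qed
qed

lemma strip_partition_up:
  assumes "strip \<nu> \<mu>" "is_partition \<nu>"
  shows "is_partition \<mu>"
proof -
  obtain L where "\<forall>i\<ge>L. \<nu> i = 0" using is_partition_bound[OF assms(2)] ..
  then have L: "\<nu> i = 0" if "L \<le> i" for i using that by blast
  show ?thesis
  proof (rule is_partitionI[of _ "Suc L"])
    show "\<mu> (Suc i) \<le> \<mu> i" for i
      using stripD[OF assms(1), of i] by linarith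
    show "\<mu> i = 0" if "Suc L \<le> i" for i
      using that stripD(2)[OF assms(1), of "i - 1"] L[of "i - 1"] by (cases i) simp_all
  qed
qed

lemma strip_psize_le:
  assumes "strip \<kappa> \<nu>" "is_partition \<nu>"
  shows "psize \<kappa> \<le> psize \<nu>"
proof -
  obtain L where "\<forall>i\<ge>L. \<nu> i = 0" using is_partition_bound[OF assms(2)] ..
  then have L: "\<nu> i = 0" if "L \<le> i" for i using that by blast
  have "\<kappa> i = 0" if "L \<le> i" for i
    using stripD(1)[OF assms(1), of i] L[OF that] by simp
  then have "psize \<kappa> = (\<Sum>i<L. \<kappa> i)" by (rule psize_eq_sum)
  also have "\<dots> \<le> (\<Sum>i<L. \<nu> i)" by (rule sum_mono) (rule stripD(1)[OF assms(1)])
  also have "\<dots> = psize \<nu>" using L by (rule psize_eq_sum[symmetric])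
  finally show ?thesis .
qed

lemma finite_bounded_support:
  fixes F :: "(nat \<Rightarrow> nat) set"
  assumes "\<And>f. f \<in> F \<Longrightarrow> (\<forall>i. f i \<le> B) \<and> (\<forall>i\<ge>L. f i = 0)"
  shows "finite F"
proof (rule finite_subset)
  show "F \<subseteq> {f. \<forall>i. (i \<in> {..<L} \<longrightarrow> f i \<in> {..B}) \<and> (i \<notin> {..<L} \<longrightarrow> f i = 0)}"
  proof
    fix f assume "f \<in> F"
    from assms[OF this] show "f \<in> {f. \<forall>i. (i \<in> {..<L} \<longrightarrow> f i \<in> {..B}) \<and> (i \<notin> {..<L} \<longrightarrow> f i = 0)}"
      by (simp add: not_less)
  qed
qed (rule finite_set_of_finite_funs; simp)

lemma le_psize:
  assumes "is_partition \<nu>"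
  shows "\<nu> i \<le> psize \<nu>"
proof (cases "\<nu> i = 0")
  case False
  then show ?thesis
    unfolding psize_def using assms by (intro member_le_sum) (auto simp: is_partition_def)
qed simp

lemma finite_downs [simp]:
  assumes "is_partition \<nu>"
  shows "finite (downs r \<nu>)"
proof -
  obtain L where "\<forall>i\<ge>L. \<nu> i = 0" using is_partition_bound[OF assms] ..
  then have L: "\<nu> i = 0" if "L \<le> i" for i using that by blast
  show ?thesis
  proof (rule finite_bounded_support[of _ "psize \<nu>" L], intro conjI allI impI)
    fix \<kappa> i assume "\<kappa> \<in> downs r \<nu>"
    then have le: "\<kappa> i \<le> \<nu> i" by (simp add: downs_def stripD)
    also have "\<nu> i \<le> psize \<nu>" by (rule le_psize[OF assms])
    finally show "\<kappa> i \<le> psize \<nu>" .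
    show "\<kappa> i = 0" if "L \<le> i" using le L[OF that] by simp
  qed
qed

lemma finite_ups [simp]:
  assumes "is_partition \<nu>"
  shows "finite (ups r \<nu>)"
proof -
  obtain L where "\<forall>i\<ge>L. \<nu> i = 0" using is_partition_bound[OF assms] ..
  then have L: "\<nu> i = 0" if "L \<le> i" for i using that by blast
  show ?thesis
  proof (rule finite_bounded_support[of _ "psize \<nu> + r" "Suc L"], intro conjI allI impI)
    fix \<mu> i assume \<mu>: "\<mu> \<in> ups r \<nu>"
    then have "strip \<nu> \<mu>" and size: "psize \<mu> = psize \<nu> + r" by (simp_all add: ups_def)
    then show "\<mu> i \<le> psize \<nu> + r"
      using le_psize[OF strip_partition_up[OF _ assms], of \<mu> i] by simp
    show "\<mu> i = 0" if "Suc L \<le> i"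
      using that stripD(2)[OF \<open>strip \<nu> \<mu>\<close>, of "i - 1"] L[of "i - 1"] by (cases i) simp_all
  qed
qed

text \<open>
  Fomin's local rule. Fix partitions \<open>\<rho>\<close> and \<open>\<nu>\<close>. Both \<open>\<mu> (Suc i)\<close>, for \<open>\<mu>\<close> a horizontal strip above \<open>\<rho>\<close> and \<open>\<nu>\<close>,
  and \<open>\<kappa> i\<close>, for \<open>\<kappa>\<close> a horizontal strip below \<open>\<rho>\<close> and \<open>\<nu>\<close>, range over the same interval; reflecting this interval
  matches the two. The first part of \<open>\<mu>\<close>, which is unbounded, accounts for the number \<open>s\<close>.
\<close>
definition local_rule :: "nat \<Rightarrow> (nat \<Rightarrow> nat) \<Rightarrow> (nat \<Rightarrow> nat) \<Rightarrow> (nat \<Rightarrow> nat) \<Rightarrow> (nat \<Rightarrow> nat) \<Rightarrow> bool" where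
  "local_rule s \<rho> \<nu> \<kappa> \<mu> \<longleftrightarrow> \<mu> 0 = s + max (\<rho> 0) (\<nu> 0) \<and>
     (\<forall>i. \<mu> (Suc i) + \<kappa> i = max (\<rho> (Suc i)) (\<nu> (Suc i)) + min (\<rho> i) (\<nu> i))"

text \<open>The reflection exchanges the two bounds: the lower bound on \<open>\<mu> (Suc i)\<close>
  is the upper bound on \<open>\<kappa> i\<close>, and conversely. At row 0 the lower bound on \<mu>
  is built into the rule.\<close>

lemma local_rule_strip:
  assumes "local_rule s \<rho> \<nu> \<kappa> \<mu>"
  shows "strip \<nu> \<mu> \<and> strip \<rho> \<mu> \<longleftrightarrow> strip \<kappa> \<nu> \<and> strip \<kappa> \<rho>"
proof -
  have *: "\<mu> 0 = s + max (\<rho> 0) (\<nu> 0)"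
    "\<mu> (Suc i) + \<kappa> i = max (\<rho> (Suc i)) (\<nu> (Suc i)) + min (\<rho> i) (\<nu> i)" for i
    using assms by (simp_all add: local_rule_def)
  have "strip \<nu> \<mu> \<and> strip \<rho> \<mu> \<longleftrightarrow> (\<forall>i. max (\<rho> i) (\<nu> i) \<le> \<mu> i) \<and> (\<forall>i. \<mu> (Suc i) \<le> min (\<rho> i) (\<nu> i))"
    unfolding strip_def max.bounded_iff min.bounded_iff by blast
  also have "(\<forall>i. max (\<rho> i) (\<nu> i) \<le> \<mu> i) \<longleftrightarrow> (\<forall>i. max (\<rho> (Suc i)) (\<nu> (Suc i)) \<le> \<mu> (Suc i))"
    (is "?L \<longleftrightarrow> ?R")
  proof (intro iffI allI)
    fix i assume ?R
    then show "max (\<rho> i) (\<nu> i) \<le> \<mu> i" using *(1) by (cases i) simp_all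
  qed simp
  also have "\<dots> \<longleftrightarrow> (\<forall>i. \<kappa> i \<le> min (\<rho> i) (\<nu> i))"
  proof -
    have "max (\<rho> (Suc i)) (\<nu> (Suc i)) \<le> \<mu> (Suc i) \<longleftrightarrow> \<kappa> i \<le> min (\<rho> i) (\<nu> i)" for i
      using *(2)[of i] by linarith
    then show ?thesis by simp
  qed
  also have "(\<forall>i. \<mu> (Suc i) \<le> min (\<rho> i) (\<nu> i)) \<longleftrightarrow> (\<forall>i. max (\<rho> (Suc i)) (\<nu> (Suc i)) \<le> \<kappa> i)"
  proof -
    have "\<mu> (Suc i) \<le> min (\<rho> i) (\<nu> i) \<longleftrightarrow> max (\<rho> (Suc i)) (\<nu> (Suc i)) \<le> \<kappa> i" for i
      using *(2)[of i] by linarith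
    then show ?thesis by simp
  qed
  also have "(\<forall>i. \<kappa> i \<le> min (\<rho> i) (\<nu> i)) \<and> (\<forall>i. max (\<rho> (Suc i)) (\<nu> (Suc i)) \<le> \<kappa> i) \<longleftrightarrow>
      strip \<kappa> \<nu> \<and> strip \<kappa> \<rho>"
    unfolding strip_def max.bounded_iff min.bounded_iff by blast
  finally show ?thesis .
qed

text \<open>Summed over all rows, the maxima and minima recombine because max a b + min a b = a +
  b.\<close>

lemma local_rule_psize:
  assumes "local_rule s \<rho> \<nu> \<kappa> \<mu>" "is_partition \<rho>" "is_partition \<nu>"
  shows "psize \<mu> + psize \<kappa> = s + psize \<rho> + psize \<nu>"
proof -
  have *: "\<mu> 0 = s + max (\<rho> 0) (\<nu> 0)"
    "\<mu> (Suc i) + \<kappa> i = max (\<rho> (Suc i)) (\<nu> (Suc i)) + min (\<rho> i) (\<nu> i)" for i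
    using assms(1) by (simp_all add: local_rule_def)
  obtain L1 where "\<forall>i\<ge>L1. \<rho> i = 0" using is_partition_bound[OF assms(2)] ..
  then have L1: "\<rho> i = 0" if "L1 \<le> i" for i using that by blast
  obtain L2 where "\<forall>i\<ge>L2. \<nu> i = 0" using is_partition_bound[OF assms(3)] ..
  then have L2: "\<nu> i = 0" if "L2 \<le> i" for i using that by blast
  define L where "L = max L1 L2"
  have zero: "\<rho> i = 0" "\<nu> i = 0" if "L \<le> i" for i
    using that L1[of i] L2[of i] by (simp_all add: L_def)
  have zero': "\<mu> (Suc i) = 0" "\<kappa> i = 0" if "L \<le> i" for i
    using *(2)[of i] zero[of i] zero[of "Suc i"] that by simp_all
  have "psize \<mu> = (\<Sum>i<Suc L. \<mu> i)"
  proof (rule psize_eq_sum)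
    show "\<mu> i = 0" if "Suc L \<le> i" for i using that zero'(1)[of "i - 1"] by (cases i) simp_all
  qed
  also have "\<dots> = s + max (\<rho> 0) (\<nu> 0) + (\<Sum>i<L. \<mu> (Suc i))"
    unfolding sum.lessThan_Suc_shift *(1) ..
  finally have "psize \<mu> + psize \<kappa> = s + max (\<rho> 0) (\<nu> 0) + (\<Sum>i<L. \<mu> (Suc i) + \<kappa> i)"
    using psize_eq_sum[of L \<kappa>] zero'(2) by (simp add: sum.distrib)
  also have "\<dots> = s + (\<Sum>i<Suc L. max (\<rho> i) (\<nu> i)) + (\<Sum>i<L. min (\<rho> i) (\<nu> i))"
    unfolding *(2) sum.lessThan_Suc_shift sum.distrib by simp
  also have "\<dots> = s + (\<Sum>i<L. max (\<rho> i) (\<nu> i) + min (\<rho> i) (\<nu> i))"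
    using zero[of L] by (simp add: sum.distrib)
  also have "(\<Sum>i<L. max (\<rho> i) (\<nu> i) + min (\<rho> i) (\<nu> i)) = (\<Sum>i<L. \<rho> i + \<nu> i)"
    by (rule sum.cong[OF refl]) linarith
  also have "\<dots> = psize \<rho> + psize \<nu>"
    using psize_eq_sum[of L \<rho>] psize_eq_sum[of L \<nu>] zero by (simp add: sum.distrib)
  finally show ?thesis by simp
qed

text \<open>With |\<mu>| = |\<nu>| + r = |\<rho>| + c, the size identity leaves c - s for \<nu> /
  \<kappa> and r - s for \<rho> / \<kappa>.\<close>

lemma local_rule_membership:
  assumes lr: "local_rule s \<rho> \<nu> \<kappa> \<mu>" and \<nu>: "is_partition \<nu>"
  shows "\<mu> \<in> ups r \<nu> \<and> \<rho> \<in> downs c \<mu> \<longleftrightarrow>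
    s \<le> min c r \<and> \<kappa> \<in> downs (c - s) \<nu> \<and> \<rho> \<in> ups (r - s) \<kappa>"
proof
  assume *: "\<mu> \<in> ups r \<nu> \<and> \<rho> \<in> downs c \<mu>"
  then have strips: "strip \<kappa> \<nu>" "strip \<kappa> \<rho>"
    using local_rule_strip[OF lr] by (simp_all add: ups_def downs_def)
  have \<rho>: "is_partition \<rho>"
    using strip_partition_up[OF strips(2) strip_partition_down[OF strips(1) \<nu>]] .
  have "psize \<mu> = psize \<nu> + r" "psize \<mu> = psize \<rho> + c"
    using * by (simp_all add: ups_def downs_def)
  moreover note local_rule_psize[OF lr \<rho> \<nu>] strip_psize_le[OF strips(1) \<nu>] strip_psize_le[OF strips(2) \<rho>]
  ultimately have "s \<le> min c r" "psize \<nu> = psize \<kappa> + (c - s)" "psize \<rho> = psize \<kappa> + (r - s)"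
    by simp_all
  with strips show "s \<le> min c r \<and> \<kappa> \<in> downs (c - s) \<nu> \<and> \<rho> \<in> ups (r - s) \<kappa>"
    by (simp add: ups_def downs_def)
next
  assume *: "s \<le> min c r \<and> \<kappa> \<in> downs (c - s) \<nu> \<and> \<rho> \<in> ups (r - s) \<kappa>"
  then have strips: "strip \<kappa> \<nu>" "strip \<kappa> \<rho>" by (simp_all add: ups_def downs_def)
  have \<rho>: "is_partition \<rho>"
    using strip_partition_up[OF strips(2) strip_partition_down[OF strips(1) \<nu>]] .
  have "psize \<nu> = psize \<kappa> + (c - s)" "psize \<rho> = psize \<kappa> + (r - s)" "s \<le> c" "s \<le> r"
    using * by (simp_all add: ups_def downs_def)
  moreover note local_rule_psize[OF lr \<rho> \<nu>]
  ultimately have "psize \<mu> = psize \<nu> + r" "psize \<mu> = psize \<rho> + c" by simp_all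
  moreover have "strip \<nu> \<mu>" "strip \<rho> \<mu>"
    using local_rule_strip[OF lr] strips by simp_all
  ultimately show "\<mu> \<in> ups r \<nu> \<and> \<rho> \<in> downs c \<mu>"
    by (simp add: ups_def downs_def)
qed

text \<open>The local rule solved for \<mu>, as \<open>toggle_down\<close> solves it for \<kappa>.
  The subtractions are exact whenever the given shape forms horizontal strips with \<rho> and
  \<nu>.\<close>

definition toggle_up :: "nat \<Rightarrow> (nat \<Rightarrow> nat) \<Rightarrow> (nat \<Rightarrow> nat) \<Rightarrow> (nat \<Rightarrow> nat) \<Rightarrow> nat \<Rightarrow> nat" where
  "toggle_up s \<rho> \<nu> \<kappa> = case_nat (s + max (\<rho> 0) (\<nu> 0))
     (\<lambda>i. max (\<rho> (Suc i)) (\<nu> (Suc i)) + min (\<rho> i) (\<nu> i) - \<kappa> i)"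

definition toggle_down :: "(nat \<Rightarrow> nat) \<Rightarrow> (nat \<Rightarrow> nat) \<Rightarrow> (nat \<Rightarrow> nat) \<Rightarrow> nat \<Rightarrow> nat" where
  "toggle_down \<rho> \<nu> \<mu> = (\<lambda>i. max (\<rho> (Suc i)) (\<nu> (Suc i)) + min (\<rho> i) (\<nu> i) - \<mu> (Suc i))"

lemma local_rule_toggle_up:
  assumes "strip \<kappa> \<nu>" "strip \<kappa> \<rho>"
  shows "local_rule s \<rho> \<nu> \<kappa> (toggle_up s \<rho> \<nu> \<kappa>)"
proof -
  have "\<kappa> i \<le> min (\<rho> i) (\<nu> i)" for i
    using stripD(1)[OF assms(1), of i] stripD(1)[OF assms(2), of i] by simp
  then show ?thesis
    unfolding local_rule_def toggle_up_def by (simp add: trans_le_add2)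
qed

lemma local_rule_toggle_down:
  assumes "strip \<nu> \<mu>" "strip \<rho> \<mu>"
  shows "local_rule (\<mu> 0 - max (\<rho> 0) (\<nu> 0)) \<rho> \<nu> (toggle_down \<rho> \<nu> \<mu>) \<mu>"
proof -
  have "\<mu> (Suc i) \<le> min (\<rho> i) (\<nu> i)" for i
    using stripD(2)[OF assms(1), of i] stripD(2)[OF assms(2), of i] by simp
  moreover have "max (\<rho> 0) (\<nu> 0) \<le> \<mu> 0"
    using stripD(1)[OF assms(1), of 0] stripD(1)[OF assms(2), of 0] by simp
  ultimately show ?thesis
    unfolding local_rule_def toggle_down_def by (simp add: trans_le_add2)
qed

lemma local_rule_unique_up:
  assumes "local_rule s \<rho> \<nu> \<kappa> \<mu>"
  shows "toggle_up s \<rho> \<nu> \<kappa> = \<mu>"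
proof
  fix i
  have "\<mu> (Suc i) + \<kappa> i = max (\<rho> (Suc i)) (\<nu> (Suc i)) + min (\<rho> i) (\<nu> i)" for i
    using assms by (simp add: local_rule_def)
  then have "max (\<rho> (Suc i)) (\<nu> (Suc i)) + min (\<rho> i) (\<nu> i) - \<kappa> i = \<mu> (Suc i)" for i
    by (metis add_diff_cancel_right')
  then show "toggle_up s \<rho> \<nu> \<kappa> i = \<mu> i"
    using assms by (cases i) (simp_all add: toggle_up_def local_rule_def)
qed

lemma local_rule_unique_down:
  assumes "local_rule s \<rho> \<nu> \<kappa> \<mu>"
  shows "\<mu> 0 - max (\<rho> 0) (\<nu> 0) = s" "toggle_down \<rho> \<nu> \<mu> = \<kappa>"
proof -
  show "\<mu> 0 - max (\<rho> 0) (\<nu> 0) = s"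
    using assms by (simp add: local_rule_def)
  have "\<mu> (Suc i) + \<kappa> i = max (\<rho> (Suc i)) (\<nu> (Suc i)) + min (\<rho> i) (\<nu> i)" for i
    using assms by (simp add: local_rule_def)
  then have "max (\<rho> (Suc i)) (\<nu> (Suc i)) + min (\<rho> i) (\<nu> i) - \<mu> (Suc i) = \<kappa> i" for i
    by (metis add_diff_cancel_left')
  then show "toggle_down \<rho> \<nu> \<mu> = \<kappa>"
    by (simp add: toggle_down_def)
qed

text \<open>The commutation relation of the operators that add and remove horizontal strips. The
  bijection keeps \<rho> and trades \<mu> for the pair of s and \<kappa>.\<close>

lemma sum_ups_downs:
  fixes f :: "(nat \<Rightarrow> nat) \<Rightarrow> 'a::comm_monoid_add"
  assumes \<nu>: "is_partition \<nu>"
  shows "(\<Sum>\<mu>\<in>ups r \<nu>. \<Sum>\<rho>\<in>downs c \<mu>. f \<rho>) =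
    (\<Sum>s\<le>min c r. \<Sum>\<kappa>\<in>downs (c - s) \<nu>. \<Sum>\<rho>\<in>ups (r - s) \<kappa>. f \<rho>)"
proof -
  let ?A = "SIGMA \<mu>:ups r \<nu>. downs c \<mu>"
  let ?B = "SIGMA s:{..min c r}. SIGMA \<kappa>:downs (c - s) \<nu>. ups (r - s) \<kappa>"
  have up: "is_partition \<mu>" if "\<mu> \<in> ups r \<nu>" for \<mu>
    using that strip_partition_up[OF _ \<nu>] by (simp add: ups_def)
  have down: "is_partition \<kappa>" if "\<kappa> \<in> downs k \<nu>" for \<kappa> k
    using that strip_partition_down[OF _ \<nu>] by (simp add: downs_def)
  have "(\<Sum>\<mu>\<in>ups r \<nu>. \<Sum>\<rho>\<in>downs c \<mu>. f \<rho>) = (\<Sum>x\<in>?A. f (snd x))"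
    by (subst sum.Sigma) (simp_all add: up \<nu> split_beta)
  also have "\<dots> = (\<Sum>x\<in>?B. f (snd (snd x)))"
  proof (rule sum.reindex_bij_witness[where
        i = "\<lambda>(s, \<kappa>, \<rho>). (toggle_up s \<rho> \<nu> \<kappa>, \<rho>)" and
        j = "\<lambda>(\<mu>, \<rho>). (\<mu> 0 - max (\<rho> 0) (\<nu> 0), toggle_down \<rho> \<nu> \<mu>, \<rho>)"])
    fix x assume "x \<in> ?A"
    then obtain \<mu> \<rho> where x: "x = (\<mu>, \<rho>)" and mem: "\<mu> \<in> ups r \<nu>" "\<rho> \<in> downs c \<mu>" by blast
    then have lr: "local_rule (\<mu> 0 - max (\<rho> 0) (\<nu> 0)) \<rho> \<nu> (toggle_down \<rho> \<nu> \<mu>) \<mu>"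
      by (intro local_rule_toggle_down) (simp_all add: ups_def downs_def)
    show "(\<lambda>(s, \<kappa>, \<rho>). (toggle_up s \<rho> \<nu> \<kappa>, \<rho>))
        ((\<lambda>(\<mu>, \<rho>). (\<mu> 0 - max (\<rho> 0) (\<nu> 0), toggle_down \<rho> \<nu> \<mu>, \<rho>)) x) = x"
      using local_rule_unique_up[OF lr] by (simp add: x)
    show "(\<lambda>(\<mu>, \<rho>). (\<mu> 0 - max (\<rho> 0) (\<nu> 0), toggle_down \<rho> \<nu> \<mu>, \<rho>)) x \<in> ?B"
      using local_rule_membership[OF lr \<nu>, of r c] mem by (simp add: x)
    show "f (snd (snd ((\<lambda>(\<mu>, \<rho>). (\<mu> 0 - max (\<rho> 0) (\<nu> 0), toggle_down \<rho> \<nu> \<mu>, \<rho>)) x))) = f (snd x)"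
      by (simp add: x)
  next
    fix y assume "y \<in> ?B"
    then obtain s \<kappa> \<rho> where y: "y = (s, \<kappa>, \<rho>)"
      and mem: "s \<le> min c r" "\<kappa> \<in> downs (c - s) \<nu>" "\<rho> \<in> ups (r - s) \<kappa>" by blast
    then have lr: "local_rule s \<rho> \<nu> \<kappa> (toggle_up s \<rho> \<nu> \<kappa>)"
      by (intro local_rule_toggle_up) (simp_all add: ups_def downs_def)
    show "(\<lambda>(\<mu>, \<rho>). (\<mu> 0 - max (\<rho> 0) (\<nu> 0), toggle_down \<rho> \<nu> \<mu>, \<rho>))
        ((\<lambda>(s, \<kappa>, \<rho>). (toggle_up s \<rho> \<nu> \<kappa>, \<rho>)) y) = y"
      using local_rule_unique_down[OF lr] by (simp add: y)
    show "(\<lambda>(s, \<kappa>, \<rho>). (toggle_up s \<rho> \<nu> \<kappa>, \<rho>)) y \<in> ?A"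
      using local_rule_membership[OF lr \<nu>, of r c] mem by (simp add: y)
  qed
  also have "\<dots> = (\<Sum>s\<le>min c r. \<Sum>x\<in>(SIGMA \<kappa>:downs (c - s) \<nu>. ups (r - s) \<kappa>). f (snd x))"
    by (subst sum.Sigma) (simp_all add: down \<nu> split_beta finite_SigmaI)
  also have "\<dots> = (\<Sum>s\<le>min c r. \<Sum>\<kappa>\<in>downs (c - s) \<nu>. \<Sum>\<rho>\<in>ups (r - s) \<kappa>. f \<rho>)"
    by (rule sum.cong[OF refl], subst sum.Sigma) (simp_all add: down \<nu> split_beta)
  finally show ?thesis .
qed

section \<open>Kostka numbers and the Pieri rule for coefficients\<close>

text \<open>Counts the tableaux of shape \<nu> whose content is given by the first N exponents of m
  (see \<open>card_tableaux\<close>). The strip of the largest entry is removed at each step, which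
  is the form \<open>sum_ups_downs\<close> acts on.\<close>

fun kostka :: "nat \<Rightarrow> xmonom \<Rightarrow> (nat \<Rightarrow> nat) \<Rightarrow> nat" where
  "kostka 0 m \<nu> = of_bool (\<nu> = (\<lambda>i. 0))"
| "kostka (Suc N) m \<nu> = (\<Sum>\<kappa>\<in>downs (Poly_Mapping.lookup m N) \<nu>. kostka N m \<kappa>)"

lemma kostka_cong:
  "(\<And>i. i < N \<Longrightarrow> Poly_Mapping.lookup m i = Poly_Mapping.lookup m' i) \<Longrightarrow> kostka N m \<nu> = kostka N m' \<nu>"
  by (induction N arbitrary: \<nu>) simp_all

text \<open>Splitting off the last variable reduces the Pieri rule to the local rule.\<close>
lemma kostka_pieri:
  assumes "Poly_Mapping.keys m \<subseteq> {..<N}" "is_partition \<nu>"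
  shows "(\<Sum>(a, b)\<in>splits m. of_bool (mdeg a = r) * kostka N b \<nu>) = (\<Sum>\<mu>\<in>ups r \<nu>. kostka N m \<mu>)"
  using assms
proof (induction N arbitrary: m \<nu> r)
  case 0
  then have m: "m = 0" by simp
  have "a + b = 0 \<longleftrightarrow> a = 0 \<and> b = 0" for a b :: xmonom
    by (metis add_is_0 mdeg_add mdeg_eq_0_iff)
  then have splits: "splits 0 = {(0, 0)}"
    unfolding splits_def by simp
  have zero: "(\<lambda>i. 0) \<in> ups r \<nu> \<longleftrightarrow> r = 0 \<and> \<nu> = (\<lambda>i. 0)"
    by (auto simp: ups_def strip_def psize_def fun_eq_iff)
  have "(\<Sum>\<mu>\<in>ups r \<nu>. kostka 0 m \<mu>) = (\<Sum>\<mu>\<in>ups r \<nu>. if (\<lambda>i. 0) = \<mu> then 1 else 0)"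
    by (rule sum.cong) auto
  also have "\<dots> = (if (\<lambda>i. 0) \<in> ups r \<nu> then 1 else 0)"
    using 0 by (simp add: sum.delta')
  finally show ?case
    unfolding m splits zero by (simp add: mdeg_def)
next
  case (Suc N)
  define c where "c = Poly_Mapping.lookup m N"
  define m' where "m' = Poly_Mapping.update N 0 m"
  have lookup_m': "Poly_Mapping.lookup m' i = (if i = N then 0 else Poly_Mapping.lookup m i)" for i
    by (simp add: m'_def lookup_update)
  have m: "m = m' + Poly_Mapping.single N c"
    by (rule poly_mapping_eqI) (simp add: lookup_add lookup_m' lookup_single c_def when_def)
  have keys: "Poly_Mapping.keys m' \<subseteq> {..<N}"
  proof
    fix i assume "i \<in> Poly_Mapping.keys m'"
    then have "i \<in> Poly_Mapping.keys m" "i \<noteq> N"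
      by (simp_all add: in_keys_iff lookup_m' split: if_splits)
    then show "i \<in> {..<N}" using Suc.prems(1) by force
  qed
  define F where "F a b = (of_bool (mdeg a = r) :: nat) * kostka (Suc N) b \<nu>" for a b
  let ?S = "\<lambda>s. Poly_Mapping.single N s"
  have single_diff: "a - ?S (Poly_Mapping.lookup a N) + ?S (Poly_Mapping.lookup a N) = a" for a :: xmonom
    by (rule poly_mapping_eqI) (simp add: lookup_add lookup_minus lookup_single when_def)
  \<comment> \<open>Of the \<open>c\<close> factors of the last variable, \<open>s\<close> go to the
    complete symmetric function and \<open>c - s\<close> to the Schur function.\<close>
  have "(\<Sum>(a, b)\<in>splits m. F a b) =
      (\<Sum>(s, a, b)\<in>{..c} \<times> splits m'. F (a + ?S s) (b + ?S (c - s)))"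
  proof (rule sum.reindex_bij_witness[where
        i = "\<lambda>(s, a, b). (a + ?S s, b + ?S (c - s))" and
        j = "\<lambda>(a, b). (Poly_Mapping.lookup a N, a - ?S (Poly_Mapping.lookup a N), b - ?S (Poly_Mapping.lookup b N))"])
    fix x assume "x \<in> splits m"
    then obtain a b where x: "x = (a, b)" and ab: "a + b = m" by (auto simp: splits_def)
    have c: "c = Poly_Mapping.lookup a N + Poly_Mapping.lookup b N"
      by (simp add: c_def ab[symmetric] lookup_add)
    have "a - ?S (Poly_Mapping.lookup a N) + (b - ?S (Poly_Mapping.lookup b N)) = m'"
      by (rule poly_mapping_eqI)
        (simp add: lookup_add lookup_minus lookup_single when_def lookup_m' ab[symmetric])
    then show "(\<lambda>(a, b). (Poly_Mapping.lookup a N, a - ?S (Poly_Mapping.lookup a N), b - ?S (Poly_Mapping.lookup b N))) x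
        \<in> {..c} \<times> splits m'"
      by (simp add: x c splits_def)
    show "(\<lambda>(s, a, b). (a + ?S s, b + ?S (c - s)))
        ((\<lambda>(a, b). (Poly_Mapping.lookup a N, a - ?S (Poly_Mapping.lookup a N), b - ?S (Poly_Mapping.lookup b N))) x) = x"
      by (simp add: x c single_diff)
    show "(case (\<lambda>(a, b). (Poly_Mapping.lookup a N, a - ?S (Poly_Mapping.lookup a N), b - ?S (Poly_Mapping.lookup b N))) x of
        (s, a, b) \<Rightarrow> F (a + ?S s) (b + ?S (c - s))) = (case x of (a, b) \<Rightarrow> F a b)"
      by (simp add: x c single_diff)
  next
    fix y assume "y \<in> {..c} \<times> splits m'"
    then obtain s a b where y: "y = (s, a, b)" and s: "s \<le> c" and ab: "a + b = m'"
      by (auto simp: splits_def)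
    have "Poly_Mapping.lookup a N + Poly_Mapping.lookup b N = 0"
      using lookup_m'[of N] by (simp add: ab[symmetric] lookup_add)
    then have zero: "Poly_Mapping.lookup a N = 0" "Poly_Mapping.lookup b N = 0" by simp_all
    have "a + ?S s - ?S s = a" "b + ?S (c - s) - ?S (c - s) = b" by simp_all
    then show "(\<lambda>(a, b). (Poly_Mapping.lookup a N, a - ?S (Poly_Mapping.lookup a N), b - ?S (Poly_Mapping.lookup b N)))
        ((\<lambda>(s, a, b). (a + ?S s, b + ?S (c - s))) y) = y"
      by (simp add: y lookup_add zero)
    have "a + ?S s + (b + ?S (c - s)) = a + b + (?S s + ?S (c - s))" by (simp only: ac_simps)
    also have "\<dots> = m" using s by (simp add: ab m flip: single_add)
    finally show "(\<lambda>(s, a, b). (a + ?S s, b + ?S (c - s))) y \<in> splits m"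
      by (simp add: y splits_def)
  qed
  also have "\<dots> = (\<Sum>s\<le>c. \<Sum>(a, b)\<in>splits m'. F (a + ?S s) (b + ?S (c - s)))"
    by (simp add: sum.cartesian_product)
  \<comment> \<open>For s > r the first monomial already exceeds degree r.\<close>
  also have "\<dots> = (\<Sum>s\<le>min c r. \<Sum>(a, b)\<in>splits m'. F (a + ?S s) (b + ?S (c - s)))"
  proof (rule sum.mono_neutral_right)
    show "\<forall>s\<in>{..c} - {..min c r}. (\<Sum>(a, b)\<in>splits m'. F (a + ?S s) (b + ?S (c - s))) = 0"
    proof
      fix s assume "s \<in> {..c} - {..min c r}"
      then have "r < s" by auto
      then have "F (a + ?S s) b = 0" for a b
        by (simp add: F_def mdeg_add mdeg_def[of "?S s"])
      then show "(\<Sum>(a, b)\<in>splits m'. F (a + ?S s) (b + ?S (c - s))) = 0"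
        by (simp add: split_beta)
    qed
  qed auto
  also have "\<dots> = (\<Sum>s\<le>min c r. \<Sum>\<kappa>\<in>downs (c - s) \<nu>. \<Sum>\<rho>\<in>ups (r - s) \<kappa>. kostka N m' \<rho>)"
  proof (rule sum.cong[OF refl])
    fix s assume "s \<in> {..min c r}"
    then have s: "s \<le> r" by simp
    have F: "F (a + ?S s) (b + ?S (c - s)) =
        (\<Sum>\<kappa>\<in>downs (c - s) \<nu>. of_bool (mdeg a = r - s) * kostka N b \<kappa>)" if "(a, b) \<in> splits m'" for a b
    proof -
      have "Poly_Mapping.lookup a N + Poly_Mapping.lookup b N = 0"
        using lookup_m'[of N] that by (auto simp: splits_def lookup_add[symmetric])
      then have "Poly_Mapping.lookup (b + ?S (c - s)) N = c - s"
        by (simp add: lookup_add)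
      moreover have "kostka N (b + ?S (c - s)) \<kappa> = kostka N b \<kappa>" for \<kappa>
        by (rule kostka_cong) (simp add: lookup_add lookup_single when_def)
      moreover have "mdeg (a + ?S s) = r \<longleftrightarrow> mdeg a = r - s"
        using s by (auto simp: mdeg_add mdeg_def[of "?S s"])
      ultimately show ?thesis by (simp add: F_def sum_distrib_left)
    qed
    have "(\<Sum>(a, b)\<in>splits m'. F (a + ?S s) (b + ?S (c - s))) =
        (\<Sum>(a, b)\<in>splits m'. \<Sum>\<kappa>\<in>downs (c - s) \<nu>. of_bool (mdeg a = r - s) * kostka N b \<kappa>)"
      by (rule sum.cong[OF refl]) (auto simp: F)
    also have "\<dots> = (\<Sum>\<kappa>\<in>downs (c - s) \<nu>. \<Sum>(a, b)\<in>splits m'. of_bool (mdeg a = r - s) * kostka N b \<kappa>)"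
      unfolding split_beta by (rule sum.swap)
    also have "\<dots> = (\<Sum>\<kappa>\<in>downs (c - s) \<nu>. \<Sum>\<rho>\<in>ups (r - s) \<kappa>. kostka N m' \<rho>)"
    proof (rule sum.cong[OF refl])
      fix \<kappa> assume "\<kappa> \<in> downs (c - s) \<nu>"
      then have "is_partition \<kappa>"
        using strip_partition_down[OF _ Suc.prems(2)] by (simp add: downs_def)
      then show "(\<Sum>(a, b)\<in>splits m'. of_bool (mdeg a = r - s) * kostka N b \<kappa>) =
          (\<Sum>\<rho>\<in>ups (r - s) \<kappa>. kostka N m' \<rho>)"
        by (rule Suc.IH[OF keys])
    qed
    finally show "(\<Sum>(a, b)\<in>splits m'. F (a + ?S s) (b + ?S (c - s))) =
        (\<Sum>\<kappa>\<in>downs (c - s) \<nu>. \<Sum>\<rho>\<in>ups (r - s) \<kappa>. kostka N m' \<rho>)" .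
  qed
  also have "\<dots> = (\<Sum>\<mu>\<in>ups r \<nu>. \<Sum>\<rho>\<in>downs c \<mu>. kostka N m' \<rho>)"
    by (rule sum_ups_downs[OF Suc.prems(2), symmetric])
  also have "\<dots> = (\<Sum>\<mu>\<in>ups r \<nu>. kostka (Suc N) m \<mu>)"
  proof -
    have "kostka N m' \<rho> = kostka N m \<rho>" for \<rho>
      by (rule kostka_cong) (simp add: lookup_m')
    then show ?thesis by (simp add: c_def)
  qed
  finally show ?case by (simp only: F_def)
qed

section \<open>Counting tableaux by removing the largest entry\<close>

definition diagram :: "(nat \<Rightarrow> nat) \<Rightarrow> cell set" where
  "diagram \<nu> = skew_cells \<nu> (\<lambda>i. 0)"

lemma in_diagram [simp]: "(i, j) \<in> diagram \<nu> \<longleftrightarrow> j < \<nu> i"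
  by (simp add: diagram_def skew_cells_def)

lemma finite_diagram [simp]: "is_partition \<nu> \<Longrightarrow> finite (diagram \<nu>)"
  unfolding diagram_def by (rule finite_skew_cells)

lemma card_diagram:
  assumes "is_partition \<nu>"
  shows "card (diagram \<nu>) = psize \<nu>"
proof -
  have "diagram \<nu> = (SIGMA i:{i. \<nu> i \<noteq> 0}. {..<\<nu> i})"
    by (rule set_eqI) (simp add: split_paired_all, linarith)
  then show ?thesis
    using assms by (simp add: psize_def is_partition_def)
qed

definition tableaux :: "nat \<Rightarrow> xmonom \<Rightarrow> (nat \<Rightarrow> nat) \<Rightarrow> (cell \<Rightarrow> nat) set" where
  "tableaux N m \<nu> = {T \<in> ssyt (diagram \<nu>). (\<forall>c\<in>diagram \<nu>. T c < N) \<and>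
     (\<forall>v<N. card {c \<in> diagram \<nu>. T c = v} = Poly_Mapping.lookup m v)}"

lemma tableaux_0: "is_partition \<nu> \<Longrightarrow> card (tableaux 0 m \<nu>) = of_bool (\<nu> = (\<lambda>i. 0))"
proof (cases "\<nu> = (\<lambda>i. 0)")
  case True
  then have "diagram \<nu> = {}" by (auto simp: diagram_def skew_cells_def)
  then have "tableaux 0 m \<nu> = {\<lambda>c. undefined}"
    by (auto simp: tableaux_def ssyt_def)
  with True show ?thesis by simp
next
  case False
  then obtain i where "0 < \<nu> i" by (auto simp: fun_eq_iff)
  then have "(i, 0) \<in> diagram \<nu>" by simp
  then have "tableaux 0 m \<nu> = {}" by (auto simp only: tableaux_def)
  with False show ?thesis by simp
qed

lemma initial_segment_eq:
  assumes "finite A" "\<And>i j. j \<in> A \<Longrightarrow> i < j \<Longrightarrow> i \<in> (A :: nat set)"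
  shows "A = {..<card A}"
proof -
  define k where "k = (LEAST k. k \<notin> A)"
  have "\<exists>k. k \<notin> A" using assms(1) infinite_UNIV_nat by (metis UNIV_eq_I)
  then have k: "k \<notin> A" unfolding k_def by (rule LeastI_ex)
  have "A = {..<k}"
  proof (rule set_eqI)
    fix i
    show "i \<in> A \<longleftrightarrow> i \<in> {..<k}"
    proof
      assume "i \<in> A"
      then show "i \<in> {..<k}" using k assms(2)[of i k] by (cases i k rule: linorder_cases) auto
    next
      assume "i \<in> {..<k}"
      then show "i \<in> A" using not_less_Least[of i "\<lambda>k. k \<notin> A"] by (simp add: k_def)
    qed
  qed
  then show ?thesis by (metis card_lessThan)
qed

lemma ssytD:
  assumes "T \<in> ssyt (diagram \<nu>)"
  shows "j < j' \<Longrightarrow> j' < \<nu> i \<Longrightarrow> T (i, j) \<le> T (i, j')"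
    and "i < i' \<Longrightarrow> j < \<nu> i \<Longrightarrow> j < \<nu> i' \<Longrightarrow> T (i, j) < T (i', j)"
    and "T \<in> diagram \<nu> \<rightarrow>\<^sub>E UNIV"
proof -
  have *: "\<forall>i j j'. (i, j) \<in> diagram \<nu> \<and> (i, j') \<in> diagram \<nu> \<and> j < j' \<longrightarrow> T (i, j) \<le> T (i, j')"
    "\<forall>i i' j. (i, j) \<in> diagram \<nu> \<and> (i', j) \<in> diagram \<nu> \<and> i < i' \<longrightarrow> T (i, j) < T (i', j)"
    "T \<in> diagram \<nu> \<rightarrow>\<^sub>E UNIV"
    using assms unfolding ssyt_def by blast+
  show "j < j' \<Longrightarrow> j' < \<nu> i \<Longrightarrow> T (i, j) \<le> T (i, j')"
    using *(1) by (metis in_diagram less_trans)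
  show "i < i' \<Longrightarrow> j < \<nu> i \<Longrightarrow> j < \<nu> i' \<Longrightarrow> T (i, j) < T (i', j)"
    using *(2) by (metis in_diagram)
  show "T \<in> diagram \<nu> \<rightarrow>\<^sub>E UNIV" by (rule *(3))
qed

lemma ssytI:
  assumes "T \<in> diagram \<nu> \<rightarrow>\<^sub>E UNIV"
    and "\<And>i j j'. j < j' \<Longrightarrow> j' < \<nu> i \<Longrightarrow> T (i, j) \<le> T (i, j')"
    and "\<And>i i' j. i < i' \<Longrightarrow> j < \<nu> i \<Longrightarrow> j < \<nu> i' \<Longrightarrow> T (i, j) < T (i', j)"
  shows "T \<in> ssyt (diagram \<nu>)"
  unfolding ssyt_def
proof (intro CollectI conjI allI impI)
  fix i j j' assume "(i, j) \<in> diagram \<nu> \<and> (i, j') \<in> diagram \<nu> \<and> j < j'"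
  then show "T (i, j) \<le> T (i, j')" by (intro assms(2)) simp_all
next
  fix i i' j assume "(i, j) \<in> diagram \<nu> \<and> (i', j) \<in> diagram \<nu> \<and> i < i'"
  then show "T (i, j) < T (i', j)" by (intro assms(3)) simp_all
qed (rule assms(1))

definition inner_shape :: "nat \<Rightarrow> (nat \<Rightarrow> nat) \<Rightarrow> (cell \<Rightarrow> nat) \<Rightarrow> nat \<Rightarrow> nat" where
  "inner_shape N \<nu> T i = card {j. j < \<nu> i \<and> T (i, j) < N}"

text \<open>Rows increase weakly, so the entries below N fill an initial segment of each row and
  their number determines them.\<close>

lemma inner_shape_iff:
  assumes "T \<in> ssyt (diagram \<nu>)"
  shows "j < inner_shape N \<nu> T i \<longleftrightarrow> j < \<nu> i \<and> T (i, j) < N"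
proof -
  have "{j. j < \<nu> i \<and> T (i, j) < N} = {..<card {j. j < \<nu> i \<and> T (i, j) < N}}"
  proof (rule initial_segment_eq)
    fix j j' assume *: "j' \<in> {j. j < \<nu> i \<and> T (i, j) < N}" "j < j'"
    then have "T (i, j) \<le> T (i, j')" by (intro ssytD(1)[OF assms]) simp_all
    with * show "j \<in> {j. j < \<nu> i \<and> T (i, j) < N}" by simp
  qed simp
  then have "j \<in> {..<inner_shape N \<nu> T i} \<longleftrightarrow> j \<in> {j. j < \<nu> i \<and> T (i, j) < N}"
    unfolding inner_shape_def by (rule arg_cong[symmetric])
  then show ?thesis by simp
qed

lemma tableaux_restrict:
  assumes \<nu>: "is_partition \<nu>" and T: "T \<in> tableaux (Suc N) m \<nu>"
  defines "\<kappa> \<equiv> inner_shape N \<nu> T"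
  shows "\<kappa> \<in> downs (Poly_Mapping.lookup m N) \<nu>" "restrict T (diagram \<kappa>) \<in> tableaux N m \<kappa>"
    "\<And>c. c \<in> diagram \<nu> \<Longrightarrow> T c = (if c \<in> diagram \<kappa> then T c else N)"
proof -
  have ssyt: "T \<in> ssyt (diagram \<nu>)" and bound: "\<And>c. c \<in> diagram \<nu> \<Longrightarrow> T c < Suc N"
    and count: "\<And>v. v < Suc N \<Longrightarrow> card {c \<in> diagram \<nu>. T c = v} = Poly_Mapping.lookup m v"
    using T by (simp_all add: tableaux_def)
  have \<kappa>: "j < \<kappa> i \<longleftrightarrow> j < \<nu> i \<and> T (i, j) < N" for i j
    unfolding \<kappa>_def by (rule inner_shape_iff[OF ssyt])
  have in_\<kappa>: "c \<in> diagram \<kappa> \<longleftrightarrow> c \<in> diagram \<nu> \<and> T c < N" for c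
    by (cases c) (simp add: \<kappa>)
  have strip: "strip \<kappa> \<nu>"
    unfolding strip_def
  proof (intro allI conjI)
    fix i
    show "\<kappa> i \<le> \<nu> i" using \<kappa>[of "\<nu> i" i] by simp
    show "\<nu> (Suc i) \<le> \<kappa> i"
    proof (rule ccontr)
      \<comment> \<open>Then the cell (i, \<kappa> i) has an entry of at least N and a cell below
        it, whose entry would have to exceed N.\<close>
      assume *: "\<not> \<nu> (Suc i) \<le> \<kappa> i"
      then have "\<kappa> i < \<nu> i" using is_partition_mono[OF \<nu>, of i "Suc i"] by simp
      then have "T (i, \<kappa> i) < T (Suc i, \<kappa> i)" using * by (intro ssytD(2)[OF ssyt]) simp_all
      moreover have "T (Suc i, \<kappa> i) < Suc N" using * by (intro bound) simp
      ultimately show False using \<kappa>[of "\<kappa> i" i] \<open>\<kappa> i < \<nu> i\<close> by simp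
    qed
  qed
  have "diagram \<nu> = diagram \<kappa> \<union> {c \<in> diagram \<nu>. T c = N}"
    using bound in_\<kappa> by (auto simp: less_Suc_eq)
  then have "card (diagram \<nu>) = card (diagram \<kappa> \<union> {c \<in> diagram \<nu>. T c = N})"
    by (rule arg_cong)
  also have "\<dots> = card (diagram \<kappa>) + card {c \<in> diagram \<nu>. T c = N}"
  proof (rule card_Un_disjoint)
    show "finite (diagram \<kappa>)" by (rule finite_diagram[OF strip_partition_down[OF strip \<nu>]])
    show "finite {c \<in> diagram \<nu>. T c = N}" using \<nu> by simp
    show "diagram \<kappa> \<inter> {c \<in> diagram \<nu>. T c = N} = {}"
      using in_\<kappa> by auto
  qed
  finally have "card (diagram \<nu>) = card (diagram \<kappa>) + card {c \<in> diagram \<nu>. T c = N}" .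
  then have "psize \<nu> = psize \<kappa> + Poly_Mapping.lookup m N"
    using card_diagram[OF \<nu>] card_diagram[OF strip_partition_down[OF strip \<nu>]] count[of N] by simp
  with strip show "\<kappa> \<in> downs (Poly_Mapping.lookup m N) \<nu>" by (simp add: downs_def)
  have "restrict T (diagram \<kappa>) \<in> ssyt (diagram \<kappa>)"
  proof (rule ssytI)
    fix i j j' assume "j < j'" "j' < \<kappa> i"
    then show "restrict T (diagram \<kappa>) (i, j) \<le> restrict T (diagram \<kappa>) (i, j')"
      using ssytD(1)[OF ssyt, of j j' i] \<kappa>[of j' i] by simp
  next
    fix i i' j assume "i < i'" "j < \<kappa> i" "j < \<kappa> i'"
    then show "restrict T (diagram \<kappa>) (i, j) < restrict T (diagram \<kappa>) (i', j)"
      using ssytD(2)[OF ssyt, of i i' j] \<kappa>[of j i] \<kappa>[of j i'] by simp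
  qed simp
  moreover have "restrict T (diagram \<kappa>) c < N" if "c \<in> diagram \<kappa>" for c
    using that in_\<kappa> by simp
  moreover have "card {c \<in> diagram \<kappa>. restrict T (diagram \<kappa>) c = v} = Poly_Mapping.lookup m v" if "v < N" for v
  proof -
    have "{c \<in> diagram \<kappa>. restrict T (diagram \<kappa>) c = v} = {c \<in> diagram \<nu>. T c = v}"
      using in_\<kappa> that by auto
    then show ?thesis using count[of v] that by simp
  qed
  ultimately show "restrict T (diagram \<kappa>) \<in> tableaux N m \<kappa>"
    by (simp add: tableaux_def)
  fix c assume "c \<in> diagram \<nu>"
  then show "T c = (if c \<in> diagram \<kappa> then T c else N)"
    using bound[of c] in_\<kappa>[of c] by auto
qed

definition extend :: "nat \<Rightarrow> (nat \<Rightarrow> nat) \<Rightarrow> (nat \<Rightarrow> nat) \<Rightarrow> (cell \<Rightarrow> nat) \<Rightarrow> cell \<Rightarrow> nat" where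
  "extend N \<nu> \<kappa> S = restrict (\<lambda>c. if c \<in> diagram \<kappa> then S c else N) (diagram \<nu>)"

lemma tableaux_extend:
  assumes \<nu>: "is_partition \<nu>" and \<kappa>: "\<kappa> \<in> downs (Poly_Mapping.lookup m N) \<nu>"
    and S: "S \<in> tableaux N m \<kappa>"
  shows "extend N \<nu> \<kappa> S \<in> tableaux (Suc N) m \<nu>"
    "inner_shape N \<nu> (extend N \<nu> \<kappa> S) = \<kappa>" "restrict (extend N \<nu> \<kappa> S) (diagram \<kappa>) = S"
proof -
  have ssyt: "S \<in> ssyt (diagram \<kappa>)" and bound: "\<And>c. c \<in> diagram \<kappa> \<Longrightarrow> S c < N"
    and count: "\<And>v. v < N \<Longrightarrow> card {c \<in> diagram \<kappa>. S c = v} = Poly_Mapping.lookup m v"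
    using S by (simp_all add: tableaux_def)
  have strip: "strip \<kappa> \<nu>" and size: "psize \<nu> = psize \<kappa> + Poly_Mapping.lookup m N"
    using \<kappa> by (simp_all add: downs_def)
  have part: "is_partition \<kappa>" by (rule strip_partition_down[OF strip \<nu>])
  have le: "\<kappa> i \<le> \<nu> i" for i by (rule stripD(1)[OF strip])
  have sub: "c \<in> diagram \<nu>" if "c \<in> diagram \<kappa>" for c
  proof (cases c)
    case (Pair i j)
    then show ?thesis using that le[of i] by simp
  qed
  define T where "T = extend N \<nu> \<kappa> S"
  have T: "T (i, j) = (if j < \<kappa> i then S (i, j) else N)" if "j < \<nu> i" for i j
    using that by (simp add: T_def extend_def)
  have T': "T c = (if c \<in> diagram \<kappa> then S c else N)" if "c \<in> diagram \<nu>" for c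
    using that by (simp add: T_def extend_def)
  have T_le: "T c \<le> N" if "c \<in> diagram \<nu>" for c
    using that bound[of c] by (simp add: T' less_imp_le)
  have T_ssyt: "T \<in> ssyt (diagram \<nu>)"
  proof (rule ssytI)
    show "T \<in> diagram \<nu> \<rightarrow>\<^sub>E UNIV" by (simp add: T_def extend_def)
  next
    fix i j j' assume *: "j < j'" "j' < \<nu> i"
    show "T (i, j) \<le> T (i, j')"
    proof (cases "j' < \<kappa> i")
      case True
      then show ?thesis using * ssytD(1)[OF ssyt, of j j' i] by (simp add: T)
    next
      case False
      then show ?thesis using * T_le[of "(i, j)"] T[of j' i] by simp
    qed
  next
    fix i i' j assume *: "i < i'" "j < \<nu> i" "j < \<nu> i'"
    \<comment> \<open>By the strip condition, a cell with another one below it belongs to \<kappa>,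
      so its entry is less than N and a new N may stand below.\<close>
    have "\<nu> i' \<le> \<nu> (Suc i)" using * by (intro is_partition_mono[OF \<nu>]) simp
    also have "\<dots> \<le> \<kappa> i" by (rule stripD(2)[OF strip])
    finally have j: "j < \<kappa> i" using * by simp
    show "T (i, j) < T (i', j)"
    proof (cases "j < \<kappa> i'")
      case True
      then show ?thesis using * j ssytD(2)[OF ssyt, of i i' j] by (simp add: T)
    next
      case False
      then show ?thesis using * j T[of j i'] T[of j i] bound[of "(i, j)"] by simp
    qed
  qed
  moreover have "card {c \<in> diagram \<nu>. T c = v} = Poly_Mapping.lookup m v" if "v < Suc N" for v
  proof (cases "v = N")
    case True
    have "c \<in> diagram \<nu> \<and> T c = N \<longleftrightarrow> c \<in> diagram \<nu> \<and> c \<notin> diagram \<kappa>" for c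
      using T'[of c] bound[of c] by auto
    then have "{c \<in> diagram \<nu>. T c = N} = diagram \<nu> - diagram \<kappa>"
      by blast
    moreover have "diagram \<kappa> \<subseteq> diagram \<nu>" by (rule subsetI) (rule sub)
    ultimately have "card {c \<in> diagram \<nu>. T c = N} = card (diagram \<nu>) - card (diagram \<kappa>)"
      using card_Diff_subset[OF finite_diagram[OF part]] by metis
    then show ?thesis
      using True size card_diagram[OF \<nu>] card_diagram[OF part] by simp
  next
    case False
    then have v: "v < N" using that by simp
    have "c \<in> diagram \<nu> \<and> T c = v \<longleftrightarrow> c \<in> diagram \<kappa> \<and> S c = v" for c
      using v sub[of c] T'[of c] by (auto split: if_splits)
    then have "{c \<in> diagram \<nu>. T c = v} = {c \<in> diagram \<kappa>. S c = v}"
      by blast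
    then show ?thesis using count[OF v] by simp
  qed
  ultimately show "extend N \<nu> \<kappa> S \<in> tableaux (Suc N) m \<nu>"
    using T_le by (simp add: tableaux_def less_Suc_eq_le T_def)
  show "inner_shape N \<nu> (extend N \<nu> \<kappa> S) = \<kappa>"
    unfolding T_def[symmetric]
  proof
    fix i
    have "j < \<nu> i \<and> T (i, j) < N \<longleftrightarrow> j < \<kappa> i" for j
    proof
      show "j < \<kappa> i" if "j < \<nu> i \<and> T (i, j) < N" using that T[of j i] by (simp split: if_splits)
      show "j < \<nu> i \<and> T (i, j) < N" if "j < \<kappa> i"
        using that le[of i] T[of j i] bound[of "(i, j)"] by simp
    qed
    then show "inner_shape N \<nu> T i = \<kappa> i"
      by (simp add: inner_shape_def)
  qed
  show "restrict (extend N \<nu> \<kappa> S) (diagram \<kappa>) = S"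
  proof (rule ext)
    fix c
    show "restrict (extend N \<nu> \<kappa> S) (diagram \<kappa>) c = S c"
    proof (cases "c \<in> diagram \<kappa>")
      case True
      then show ?thesis using sub[of c] by (simp add: extend_def)
    next
      case False
      then show ?thesis using PiE_arb[OF ssytD(3)[OF ssyt], of c] by simp
    qed
  qed
qed

lemma tableaux_Suc:
  assumes "is_partition \<nu>"
  shows "bij_betw (\<lambda>T. (inner_shape N \<nu> T, restrict T (diagram (inner_shape N \<nu> T))))
    (tableaux (Suc N) m \<nu>) (SIGMA \<kappa>:downs (Poly_Mapping.lookup m N) \<nu>. tableaux N m \<kappa>)"
proof (rule bij_betw_byWitness[where f' = "\<lambda>(\<kappa>, S). extend N \<nu> \<kappa> S"])
  show "\<forall>T\<in>tableaux (Suc N) m \<nu>. (\<lambda>(\<kappa>, S). extend N \<nu> \<kappa> S)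
      (inner_shape N \<nu> T, restrict T (diagram (inner_shape N \<nu> T))) = T"
  proof
    fix T assume T: "T \<in> tableaux (Suc N) m \<nu>"
    let ?\<kappa> = "inner_shape N \<nu> T"
    have "extend N \<nu> ?\<kappa> (restrict T (diagram ?\<kappa>)) c = T c" for c
    proof (cases "c \<in> diagram \<nu>")
      case True
      then show ?thesis
        using tableaux_restrict(3)[OF assms T True] by (auto simp: extend_def)
    next
      case False
      have "T \<in> ssyt (diagram \<nu>)" using T by (simp add: tableaux_def)
      then have "T c = undefined"
        using PiE_arb[OF ssytD(3)] False by blast
      with False show ?thesis by (simp add: extend_def)
    qed
    then show "(\<lambda>(\<kappa>, S). extend N \<nu> \<kappa> S) (?\<kappa>, restrict T (diagram ?\<kappa>)) = T"
      by (simp add: fun_eq_iff)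
  qed
  show "\<forall>x\<in>SIGMA \<kappa>:downs (Poly_Mapping.lookup m N) \<nu>. tableaux N m \<kappa>.
      (inner_shape N \<nu> ((\<lambda>(\<kappa>, S). extend N \<nu> \<kappa> S) x),
       restrict ((\<lambda>(\<kappa>, S). extend N \<nu> \<kappa> S) x) (diagram (inner_shape N \<nu> ((\<lambda>(\<kappa>, S). extend N \<nu> \<kappa> S) x)))) = x"
  proof
    fix x assume "x \<in> (SIGMA \<kappa>:downs (Poly_Mapping.lookup m N) \<nu>. tableaux N m \<kappa>)"
    then obtain \<kappa> S where x: "x = (\<kappa>, S)" "\<kappa> \<in> downs (Poly_Mapping.lookup m N) \<nu>" "S \<in> tableaux N m \<kappa>"
      by blast
    show "(inner_shape N \<nu> ((\<lambda>(\<kappa>, S). extend N \<nu> \<kappa> S) x),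
       restrict ((\<lambda>(\<kappa>, S). extend N \<nu> \<kappa> S) x) (diagram (inner_shape N \<nu> ((\<lambda>(\<kappa>, S). extend N \<nu> \<kappa> S) x)))) = x"
      using tableaux_extend(2,3)[OF assms x(2,3)] by (simp add: x(1))
  qed
  show "(\<lambda>T. (inner_shape N \<nu> T, restrict T (diagram (inner_shape N \<nu> T)))) ` tableaux (Suc N) m \<nu>
      \<subseteq> (SIGMA \<kappa>:downs (Poly_Mapping.lookup m N) \<nu>. tableaux N m \<kappa>)"
    using tableaux_restrict(1,2)[OF assms] by blast
  show "(\<lambda>(\<kappa>, S). extend N \<nu> \<kappa> S) ` (SIGMA \<kappa>:downs (Poly_Mapping.lookup m N) \<nu>. tableaux N m \<kappa>)
      \<subseteq> tableaux (Suc N) m \<nu>"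
  proof (rule image_subsetI)
    fix x assume "x \<in> (SIGMA \<kappa>:downs (Poly_Mapping.lookup m N) \<nu>. tableaux N m \<kappa>)"
    then obtain \<kappa> S where x: "x = (\<kappa>, S)" "\<kappa> \<in> downs (Poly_Mapping.lookup m N) \<nu>" "S \<in> tableaux N m \<kappa>"
      by blast
    show "(\<lambda>(\<kappa>, S). extend N \<nu> \<kappa> S) x \<in> tableaux (Suc N) m \<nu>"
      using tableaux_extend(1)[OF assms x(2,3)] by (simp add: x(1))
  qed
qed

lemma finite_tableaux: "is_partition \<nu> \<Longrightarrow> finite (tableaux N m \<nu>)"
proof (rule finite_subset)
  show "tableaux N m \<nu> \<subseteq> diagram \<nu> \<rightarrow>\<^sub>E {..<N}"
  proof
    fix T assume "T \<in> tableaux N m \<nu>"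
    then have "T \<in> ssyt (diagram \<nu>)" and "\<And>c. c \<in> diagram \<nu> \<Longrightarrow> T c < N"
      by (simp_all add: tableaux_def)
    then show "T \<in> diagram \<nu> \<rightarrow>\<^sub>E {..<N}"
      using ssytD(3)[of T \<nu>] by (simp add: PiE_iff)
  qed
qed (simp add: finite_PiE)

lemma card_tableaux: "is_partition \<nu> \<Longrightarrow> card (tableaux N m \<nu>) = kostka N m \<nu>"
proof (induction N arbitrary: \<nu>)
  case 0
  then show ?case by (simp add: tableaux_0)
next
  case (Suc N)
  let ?D = "downs (Poly_Mapping.lookup m N) \<nu>"
  have part: "is_partition \<kappa>" if "\<kappa> \<in> ?D" for \<kappa>
    using that strip_partition_down[OF _ Suc.prems] by (simp add: downs_def)
  have "card (tableaux (Suc N) m \<nu>) = card (SIGMA \<kappa>:?D. tableaux N m \<kappa>)"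
    by (rule bij_betw_same_card[OF tableaux_Suc[OF Suc.prems]])
  also have "\<dots> = (\<Sum>\<kappa>\<in>?D. card (tableaux N m \<kappa>))"
    using Suc.prems by (intro card_SigmaI) (simp_all add: part finite_tableaux)
  also have "\<dots> = kostka (Suc N) m \<nu>"
    by (simp add: part Suc.IH)
  finally show ?case .
qed

lemma xcoeff_schur:
  assumes "is_partition \<nu>" "Poly_Mapping.keys m \<subseteq> {..<N}"
  shows "xcoeff (schur \<nu>) m = kostka N m \<nu>"
proof -
  have zero: "Poly_Mapping.lookup m v = 0" if "\<not> v < N" for v
    using that assms(2) by (metis in_keys_iff lessThan_iff subsetD)
  have "{T \<in> ssyt (diagram \<nu>). \<forall>v. card {c \<in> diagram \<nu>. T c = v} = Poly_Mapping.lookup m v} = tableaux N m \<nu>"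
  proof (rule set_eqI)
    fix T
    have "(\<forall>v. card {c \<in> diagram \<nu>. T c = v} = Poly_Mapping.lookup m v) \<longleftrightarrow>
        (\<forall>c\<in>diagram \<nu>. T c < N) \<and> (\<forall>v<N. card {c \<in> diagram \<nu>. T c = v} = Poly_Mapping.lookup m v)"
    proof (intro iffI conjI ballI allI)
      fix c assume *: "\<forall>v. card {c \<in> diagram \<nu>. T c = v} = Poly_Mapping.lookup m v" "c \<in> diagram \<nu>"
      show "T c < N"
      proof (rule ccontr)
        assume "\<not> T c < N"
        then have "card {d \<in> diagram \<nu>. T d = T c} = 0" using *(1) zero by simp
        moreover have "finite {d \<in> diagram \<nu>. T d = T c}" using assms(1) by simp
        ultimately have "{d \<in> diagram \<nu>. T d = T c} = {}" using card_0_eq by blast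
        then show False using *(2) by blast
      qed
    next
      fix v assume *: "(\<forall>c\<in>diagram \<nu>. T c < N) \<and> (\<forall>v<N. card {c \<in> diagram \<nu>. T c = v} = Poly_Mapping.lookup m v)"
      show "card {c \<in> diagram \<nu>. T c = v} = Poly_Mapping.lookup m v"
      proof (cases "v < N")
        case False
        then have "{c \<in> diagram \<nu>. T c = v} = {}" using * by blast
        then have "card {c \<in> diagram \<nu>. T c = v} = 0" by (simp only: card.empty)
        then show ?thesis using zero[OF False] by simp
      qed (use * in blast)
    qed blast
    then show "T \<in> {T \<in> ssyt (diagram \<nu>). \<forall>v. card {c \<in> diagram \<nu>. T c = v} = Poly_Mapping.lookup m v} \<longleftrightarrow>
        T \<in> tableaux N m \<nu>"
      unfolding tableaux_def mem_Collect_eq by blast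
  qed
  then show ?thesis
    unfolding schur_def skew_schur_def xcoeff_Abs diagram_def[symmetric]
    using card_tableaux[OF assms(1), of N m] by simp
qed

text \<open>A single monomial involves finitely many variables, so each coefficient is an instance
  of \<open>kostka_pieri\<close> with N beyond them.\<close>

theorem pieri:
  assumes "is_partition \<nu>"
  shows "complete_h r * schur \<nu> = (\<Sum>\<mu>\<in>ups r \<nu>. schur \<mu>)"
proof (rule xseries_eqI)
  fix m :: xmonom
  obtain N where "\<forall>i\<in>Poly_Mapping.keys m. i < N"
    using finite_nat_set_iff_bounded[of "Poly_Mapping.keys m"] by auto
  then have N: "Poly_Mapping.keys m \<subseteq> {..<N}" by auto
  have keys: "Poly_Mapping.keys b \<subseteq> {..<N}" if "(a, b) \<in> splits m" for a b
  proof -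
    have "Poly_Mapping.keys b \<subseteq> Poly_Mapping.keys m"
      using that by (auto simp: splits_def in_keys_iff lookup_add)
    with N show ?thesis by blast
  qed
  have part: "is_partition \<mu>" if "\<mu> \<in> ups r \<nu>" for \<mu>
    using that strip_partition_up[OF _ assms] by (simp add: ups_def)
  have xcoeff_sum: "xcoeff (sum f A) m = (\<Sum>x\<in>A. xcoeff (f x) m)" for f and A :: "(nat \<Rightarrow> nat) set"
    by (induction A rule: infinite_finite_induct) simp_all
  have "xcoeff (complete_h r * schur \<nu>) m =
      (\<Sum>(a, b)\<in>splits m. real (of_bool (mdeg a = r) * kostka N b \<nu>))"
    unfolding xcoeff_mult
  proof (rule sum.cong[OF refl])
    fix x assume "x \<in> splits m"
    moreover obtain a b where x: "x = (a, b)" by fastforce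
    ultimately show "(case x of (a, b) \<Rightarrow> xcoeff (complete_h r) a * xcoeff (schur \<nu>) b) =
        (case x of (a, b) \<Rightarrow> real (of_bool (mdeg a = r) * kostka N b \<nu>))"
      using xcoeff_schur[OF assms keys] by (simp add: complete_h_def)
  qed
  also have "\<dots> = real (\<Sum>(a, b)\<in>splits m. of_bool (mdeg a = r) * kostka N b \<nu>)"
    by (simp add: split_beta)
  also have "\<dots> = (\<Sum>\<mu>\<in>ups r \<nu>. real (kostka N m \<mu>))"
    unfolding kostka_pieri[OF N assms] by simp
  also have "\<dots> = xcoeff (\<Sum>\<mu>\<in>ups r \<nu>. schur \<mu>) m"
    by (simp add: xcoeff_sum part xcoeff_schur[OF _ N])
  finally show "xcoeff (complete_h r * schur \<nu>) m = xcoeff (\<Sum>\<mu>\<in>ups r \<nu>. schur \<mu>) m" .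
qed

section \<open>Schur positivity of ribbon functions\<close>

text \<open>A letter i stands for a box added to row i, so the content of a word is the shape it
  builds.\<close>

definition shape :: "nat list \<Rightarrow> nat \<Rightarrow> nat" where
  "shape y = count_list y"

text \<open>Reversed lattice words: the suffixes have partitions as contents.\<close>
fun lattice_word :: "nat list \<Rightarrow> bool" where
  "lattice_word [] = True"
| "lattice_word (x # y) \<longleftrightarrow> lattice_word y \<and> is_partition (shape (x # y))"

lemma shape_Nil: "shape [] = (\<lambda>i. 0)"
  by (simp add: shape_def fun_eq_iff)

lemma shape_append: "shape (u @ y) i = shape u i + shape y i"
  by (simp add: shape_def)

lemma shape_Cons: "shape (x # y) i = shape y i + of_bool (x = i)"
  by (simp add: shape_def)

lemma lattice_word_partition: "lattice_word y \<Longrightarrow> is_partition (shape y)"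
  by (cases y) (simp_all add: shape_Nil is_partition_iff)

lemma psize_shape: "psize (shape y) = length y"
proof -
  have "{i. shape y i \<noteq> 0} = set y"
    by (simp add: shape_def count_list_0_iff)
  then show ?thesis
    unfolding psize_def by (simp add: shape_def sum_count_set)
qed

text \<open>A partition content with a letter x also has all smaller letters. This bounds the
  alphabet and makes the sets of lattice words of fixed length finite.\<close>

lemma lattice_word_less_length:
  assumes "lattice_word y" "x \<in> set y"
  shows "x < length y"
proof -
  have "{..x} \<subseteq> set y"
  proof
    fix i assume "i \<in> {..x}"
    then have "shape y x \<le> shape y i"
      by (intro is_partition_mono[OF lattice_word_partition[OF assms(1)]]) simp
    moreover have "shape y x \<noteq> 0"
      using assms(2) by (simp add: shape_def count_list_0_iff)
    ultimately have "count_list y i \<noteq> 0" by (simp add: shape_def)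
    then show "i \<in> set y" by (simp add: count_list_0_iff)
  qed
  then have "card {..x} \<le> card (set y)" by (intro card_mono) simp_all
  also have "\<dots> \<le> length y" by (rule card_length)
  finally show ?thesis by simp
qed

text \<open>Letters enter from the right. When a letter \<open>Suc i\<close> of the sorted word
  \<open>u\<close> enters, no letter i of \<open>u\<close> has entered yet, so row i still has its
  length in \<open>shape y\<close> and bounds row i + 1.\<close>

lemma strip_append_sorted:
  assumes "lattice_word (u @ y)" "sorted u"
  shows "strip (shape y) (shape (u @ y))"
proof -
  have "shape (u @ y) (Suc i) \<le> shape y i" for i
    using assms
  proof (induction u)
    case Nil
    then show ?case
      using is_partition_mono[OF lattice_word_partition, of y i "Suc i"] by simp
  next
    case (Cons x u)
    show ?case
    proof (cases "x = Suc i")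
      case True
      have "shape ((x # u) @ y) (Suc i) \<le> shape ((x # u) @ y) i"
        by (rule is_partition_mono[OF lattice_word_partition[OF Cons.prems(1)]]) simp
      also have "count_list (x # u) i = 0"
        using Cons.prems(2) True by (intro count_notin) force
      then have "shape ((x # u) @ y) i = shape y i"
        by (simp only: shape_append) (simp add: shape_def)
      finally show ?thesis .
    next
      case False
      then have "shape ((x # u) @ y) (Suc i) = shape (u @ y) (Suc i)"
        by (simp add: shape_Cons)
      also have "\<dots> \<le> shape y i" using Cons by simp
      finally show ?thesis .
    qed
  qed
  then show ?thesis by (simp add: strip_def shape_append)
qed

text \<open>A shape lying row by row between \<open>shape y\<close> and the final one still forms a
  horizontal strip over \<open>shape y\<close>, so all intermediate contents are partitions.\<close>

lemma lattice_word_append: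
  assumes "lattice_word y" "strip (shape y) (shape (u @ y))"
  shows "lattice_word (u @ y)"
  using assms(2)
proof (induction u)
  case Nil
  then show ?case using assms(1) by simp
next
  case (Cons x u)
  have "strip (shape y) (shape (u @ y))"
    unfolding strip_def
  proof (intro allI conjI)
    fix i
    show "shape y i \<le> shape (u @ y) i" by (simp add: shape_append)
    have "shape (u @ y) (Suc i) \<le> shape ((x # u) @ y) (Suc i)" by (simp add: shape_Cons)
    also have "\<dots> \<le> shape y i" by (rule stripD(2)[OF Cons.prems])
    finally show "shape (u @ y) (Suc i) \<le> shape y i" .
  qed
  moreover have "is_partition (shape ((x # u) @ y))"
    by (rule strip_partition_up[OF Cons.prems lattice_word_partition[OF assms(1)]])
  ultimately show ?case using Cons.IH by simp
qed

text \<open>A sorted word is determined by its content, which here is the row-by-row difference of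
  the two shapes.\<close>

lemma sorted_extensions:
  assumes y: "lattice_word y"
  shows "bij_betw (\<lambda>u. shape (u @ y)) {u. sorted u \<and> length u = r \<and> lattice_word (u @ y)} (ups r (shape y))"
proof (rule bij_betw_imageI)
  let ?U = "{u. sorted u \<and> length u = r \<and> lattice_word (u @ y)}"
  show "inj_on (\<lambda>u. shape (u @ y)) ?U"
  proof (rule inj_onI)
    fix u u' assume *: "u \<in> ?U" "u' \<in> ?U" "shape (u @ y) = shape (u' @ y)"
    have "count (mset u) i = count (mset u') i" for i
      using fun_cong[OF *(3), of i] by (simp add: shape_append count_mset) (simp add: shape_def)
    then have "mset u = mset u'" by (rule multiset_eqI)
    then have "sort u' = u" using * by (intro properties_for_sort) simp_all
    with * show "u = u'" by (simp add: sorted_sort_id)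
  qed
  show "(\<lambda>u. shape (u @ y)) ` ?U = ups r (shape y)"
  proof (intro equalityI subsetI)
    fix \<mu> assume "\<mu> \<in> (\<lambda>u. shape (u @ y)) ` ?U"
    then obtain u where "u \<in> ?U" "\<mu> = shape (u @ y)" by blast
    then show "\<mu> \<in> ups r (shape y)"
      using strip_append_sorted[of u y] by (simp add: ups_def psize_shape)
  next
    fix \<mu> assume "\<mu> \<in> ups r (shape y)"
    then have strip: "strip (shape y) \<mu>" and size: "psize \<mu> = psize (shape y) + r"
      by (simp_all add: ups_def)
    have part: "is_partition \<mu>"
      by (rule strip_partition_up[OF strip lattice_word_partition[OF y]])
    define M where "M = Abs_multiset (\<lambda>i. \<mu> i - shape y i)"
    have "{i. 0 < \<mu> i - shape y i} \<subseteq> {i. \<mu> i \<noteq> 0}" by (rule subsetI) simp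
    then have "finite {i. 0 < \<mu> i - shape y i}"
      by (rule finite_subset) (use part in \<open>simp add: is_partition_def\<close>)
    then have count: "count M i = \<mu> i - shape y i" for i by (simp add: M_def)
    define u where "u = sorted_list_of_multiset M"
    have "shape (u @ y) i = \<mu> i" for i
      using stripD(1)[OF strip, of i] count_mset[of u i] count[of i]
      by (simp add: shape_append shape_def u_def)
    then have shape: "shape (u @ y) = \<mu>" by (rule ext)
    have "length u = r"
      using size shape psize_shape[of "u @ y"] by (simp add: psize_shape)
    moreover have "lattice_word (u @ y)"
      by (rule lattice_word_append[OF y]) (simp add: shape strip)
    moreover have "sorted u" by (simp add: u_def)
    ultimately show "\<mu> \<in> (\<lambda>u. shape (u @ y)) ` ?U"
      using shape by blast
  qed
qed

lemma pieri_words: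
  assumes "lattice_word y"
  shows "complete_h r * schur (shape y) =
    (\<Sum>u | sorted u \<and> length u = r \<and> lattice_word (u @ y). schur (shape (u @ y)))"
  unfolding pieri[OF lattice_word_partition[OF assms]]
  by (rule sum.reindex_bij_betw[OF sorted_extensions[OF assms], symmetric])

text \<open>Read from the right, the word lists the rows of the entries of a standard Young tableau,
  and \<open>True\<close> marks a tableau descent: the next entry is in a lower row. A run of
  ascents is a sorted list.\<close>

definition lattice_words :: "bool list \<Rightarrow> nat list set" where
  "lattice_words p = {y. length y = Suc (length p) \<and> lattice_word y \<and> pattern (>) y = p}"

lemma finite_lattice_words_length: "finite {y. length y = n \<and> lattice_word y}"
proof (rule finite_subset)
  show "{y. length y = n \<and> lattice_word y} \<subseteq> {y. set y \<subseteq> {..<n} \<and> length y = n}"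
    using lattice_word_less_length by auto
qed (simp add: finite_lists_length_eq)

lemma finite_lattice_words [simp]: "finite (lattice_words p)"
  by (rule finite_subset[OF _ finite_lattice_words_length[of "Suc (length p)"]])
    (auto simp: lattice_words_def)

lemma pattern_greater_eq_replicate_False:
  "pattern (>) u = replicate (length u - 1) False \<longleftrightarrow> sorted (u :: nat list)"
  using pattern_eq_replicate_False[of "(>)" u] by (simp add: not_less transp_def)

lemma lattice_words_ascents:
  "lattice_words (replicate l False) = {u. sorted u \<and> length u = Suc l \<and> lattice_word u}"
proof (rule set_eqI)
  fix u :: "nat list"
  have "length u = Suc l \<Longrightarrow> pattern (>) u = replicate l False \<longleftrightarrow> sorted u"
    using pattern_greater_eq_replicate_False[of u] by simp
  then show "u \<in> lattice_words (replicate l False) \<longleftrightarrow>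
      u \<in> {u. sorted u \<and> length u = Suc l \<and> lattice_word u}"
    unfolding lattice_words_def by auto
qed

lemma schur_empty: "schur (\<lambda>i. 0) = 1"
proof (rule xseries_eqI)
  fix m :: xmonom
  have "skew_cells (\<lambda>i. 0) (\<lambda>i. 0) = {}" by (simp add: skew_cells_def)
  moreover have "ssyt {} = {\<lambda>c. undefined}" by (simp add: ssyt_def)
  moreover have "(\<forall>v. 0 = Poly_Mapping.lookup m v) \<longleftrightarrow> m = 0"
    by (metis lookup_zero poly_mapping_eqI)
  ultimately show "xcoeff (schur (\<lambda>i. 0)) m = xcoeff 1 m"
    by (cases "m = 0") (simp_all add: schur_def skew_schur_def)
qed

text \<open>The analogue of cutting a ribbon word: the comparison at the cut is free, so both
  patterns occur, and a sorted prefix is a run of ascents.\<close>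

lemma lattice_words_extend:
  "(\<Sum>y\<in>lattice_words q. \<Sum>u | sorted u \<and> length u = Suc l \<and> lattice_word (u @ y). f (u @ y)) =
    (\<Sum>y\<in>lattice_words (replicate l False @ True # q). f y) +
    (\<Sum>y\<in>lattice_words (replicate (Suc l) False @ q). (f y :: 'a::comm_monoid_add))"
proof -
  let ?U = "\<lambda>y. {u. sorted u \<and> length u = Suc l \<and> lattice_word (u @ y)}"
  let ?W = "\<lambda>x. lattice_words (replicate l False @ x # q)"
  have fin: "finite (?U y)" if "lattice_word y" for y
    using bij_betw_finite[OF sorted_extensions[OF that, of "Suc l"]]
      finite_ups[OF lattice_word_partition[OF that]] by simp
  have "(\<Sum>y\<in>lattice_words q. \<Sum>u\<in>?U y. f (u @ y)) = (\<Sum>(y, u)\<in>Sigma (lattice_words q) ?U. f (u @ y))"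
  proof (rule sum.Sigma)
    show "\<forall>y\<in>lattice_words q. finite (?U y)" by (rule ballI, rule fin) (simp add: lattice_words_def)
  qed simp
  also have "\<dots> = (\<Sum>y\<in>?W True \<union> ?W False. f y)"
  proof (rule sum.reindex_bij_witness[where
        i = "\<lambda>w. (drop (Suc l) w, take (Suc l) w)" and j = "\<lambda>(y, u). u @ y"])
    fix a assume "a \<in> Sigma (lattice_words q) ?U"
    then obtain y u where a: "a = (y, u)" and y: "y \<in> lattice_words q"
      and u: "sorted u" "length u = Suc l" "lattice_word (u @ y)" by blast
    show "(\<lambda>w. (drop (Suc l) w, take (Suc l) w)) ((\<lambda>(y, u). u @ y) a) = a"
      using u(2) by (simp add: a)
    show "f ((\<lambda>(y, u). u @ y) a) = (case a of (y, u) \<Rightarrow> f (u @ y))" by (simp add: a)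
    have len: "length y = Suc (length q)" "pattern (>) y = q"
      using y by (simp_all add: lattice_words_def)
    then have "u \<noteq> []" "y \<noteq> []" using u(2) by auto
    then have "pattern (>) (u @ y) = pattern (>) u @ (last u > hd y) # pattern (>) y"
      by (rule pattern_append)
    also have "pattern (>) u = replicate l False"
      using pattern_greater_eq_replicate_False[of u] u(1,2) by simp
    finally have "u @ y \<in> ?W (last u > hd y)"
      using u(2,3) len by (simp add: lattice_words_def)
    then show "(\<lambda>(y, u). u @ y) a \<in> ?W True \<union> ?W False"
      by (cases "last u > hd y") (simp_all add: a)
  next
    fix w assume "w \<in> ?W True \<union> ?W False"
    then obtain x where w: "length w = Suc (Suc (l + length q))" "lattice_word w"
      "pattern (>) w = replicate l False @ x # q"
      by (auto simp: lattice_words_def)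
    define u y where "u = take (Suc l) w" and "y = drop (Suc l) w"
    have split: "w = u @ y" and len: "length u = Suc l" "length y = Suc (length q)"
      using w(1) by (simp_all add: u_def y_def)
    show "(\<lambda>(y, u). u @ y) (drop (Suc l) w, take (Suc l) w) = w" by simp
    have "u \<noteq> []" "y \<noteq> []" using len by auto
    then have "pattern (>) (u @ y) = pattern (>) u @ (last u > hd y) # pattern (>) y"
      by (rule pattern_append)
    then have "pattern (>) u @ (last u > hd y) # pattern (>) y = replicate l False @ x # q"
      using w(3) unfolding split by (rule subst)
    moreover have "length (pattern (>) u) = length (replicate l False)"
      using len by (simp add: length_pattern)
    ultimately have pats: "pattern (>) u = replicate l False" "pattern (>) y = q" by simp_all
    have "sorted u"
      using pattern_greater_eq_replicate_False[of u] pats(1) len by simp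
    moreover have "lattice_word v" if "lattice_word (u' @ v)" for u' v
      using that by (induction u') simp_all
    then have "lattice_word y" using w(2) unfolding split .
    ultimately show "(drop (Suc l) w, take (Suc l) w) \<in> Sigma (lattice_words q) ?U"
      using w(2) len pats(2) unfolding u_def[symmetric] y_def[symmetric]
      by (simp add: lattice_words_def split)
  qed
  also have "\<dots> = (\<Sum>y\<in>?W True. f y) + (\<Sum>y\<in>?W False. f y)"
    by (rule sum.union_disjoint) (simp_all, auto simp: lattice_words_def)
  also have "replicate l False @ False # q = replicate (Suc l) False @ q"
    by (simp add: replicate_app_Cons_same)
  finally show ?thesis .
qed

text \<open>The coefficient of a Schur function is thus the number of standard tableaux of its shape
  with descents prescribed by \<open>p\<close> read backwards. The Pieri rule extends words on the
  left by sorted ones, which reproduces the descent rule.\<close>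

lemma ribbon_schur_expansion: "ribbon p = (\<Sum>y\<in>lattice_words p. schur (shape y))"
proof (induction p rule: pattern_induct)
  case (ascents l)
  \<comment> \<open>The Pieri rule on the empty shape, whose Schur function is 1.\<close>
  have "complete_h (Suc l) * schur (shape []) =
      (\<Sum>u | sorted u \<and> length u = Suc l \<and> lattice_word (u @ []). schur (shape (u @ [])))"
    by (rule pieri_words) simp
  then show ?case
    by (simp add: ribbon_ascents lattice_words_ascents shape_Nil schur_empty)
next
  case (descent l q)
  have "complete_h (Suc l) * ribbon q =
      (\<Sum>y\<in>lattice_words q. complete_h (Suc l) * schur (shape y))"
    unfolding descent(1) by (rule sum_distrib_left)
  also have "\<dots> = (\<Sum>y\<in>lattice_words q.
      \<Sum>u | sorted u \<and> length u = Suc l \<and> lattice_word (u @ y). schur (shape (u @ y)))"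
    by (rule sum.cong[OF refl], rule pieri_words) (simp add: lattice_words_def)
  also have "\<dots> = (\<Sum>y\<in>lattice_words (replicate l False @ True # q). schur (shape y)) +
      ribbon (replicate (Suc l) False @ q)"
    unfolding descent(2) by (rule lattice_words_extend)
  finally show ?case
    unfolding ribbon_descent by simp
qed

lemma schur_positive_sum:
  assumes "finite A" "\<And>a. a \<in> A \<Longrightarrow> is_partition (g a)" "(\<Sum>a\<in>A. schur (g a)) \<in> \<Lambda>"
  shows "schur_positive (\<Sum>a\<in>A. schur (g a))"
  unfolding schur_positive_def
proof (intro conjI exI)
  \<comment> \<open>The coefficient is the multiplicity of \<nu> among the indexed shapes.\<close>
  let ?c = "\<lambda>\<nu>. real (card {a \<in> A. g a = \<nu>})"
  show "\<forall>\<nu>\<in>g ` A. is_partition \<nu> \<and> 0 \<le> ?c \<nu>" using assms(2) by simp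
  have "(\<Sum>a\<in>A. schur (g a)) = (\<Sum>\<nu>\<in>g ` A. \<Sum>a | a \<in> A \<and> g a = \<nu>. schur (g a))"
    by (rule sum.image_gen[OF assms(1)])
  also have "\<dots> = (\<Sum>\<nu>\<in>g ` A. ?c \<nu> *\<^sub>R schur \<nu>)"
    by (intro sum.cong refl) (simp add: scaleR_conv_of_real)
  finally show "(\<Sum>a\<in>A. schur (g a)) = (\<Sum>\<nu>\<in>g ` A. ?c \<nu> *\<^sub>R schur \<nu>)" .
qed (use assms in simp_all)

lemma schur_positive_gamma_hook: "schur_positive (gamma_hook (Suc n) k)"
proof -
  let ?P = "{p \<in> good_pats n. count_list p True = k}"
  have fin: "finite ?P" by simp
  have "gamma_hook (Suc n) k = (\<Sum>p\<in>?P. \<Sum>y\<in>lattice_words p. schur (shape y))"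
    unfolding gamma_hook_Suc ribbon_schur_expansion ..
  also have "\<dots> = (\<Sum>a\<in>Sigma ?P lattice_words. schur (shape (snd a)))"
    using fin by (subst sum.Sigma) (simp_all add: split_beta)
  finally have eq: "gamma_hook (Suc n) k = (\<Sum>a\<in>Sigma ?P lattice_words. schur (shape (snd a)))" .
  have "gamma_hook (Suc n) k \<in> \<Lambda>"
    unfolding gamma_hook_Suc by (rule Sym_sum) (rule Sym_ribbon)
  then show ?thesis
    unfolding eq
  proof (rule schur_positive_sum[rotated 2])
    show "finite (Sigma ?P lattice_words)" using fin by (rule finite_SigmaI) simp
    show "is_partition (shape (snd a))" if "a \<in> Sigma ?P lattice_words" for a
      using that by (auto simp: lattice_words_def intro: lattice_word_partition)
  qed
qed

lemma Sym_coeff_mult: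
  assumes "\<And>i. coeff p i \<in> \<Lambda>" "\<And>i. coeff q i \<in> \<Lambda>"
  shows "coeff (p * q) i \<in> \<Lambda>"
  unfolding coeff_mult by (intro Sym_sum Sym_mult assms)

lemma Sym_coeff_power:
  assumes "\<And>i. coeff p i \<in> \<Lambda>"
  shows "coeff (p ^ k) i \<in> \<Lambda>"
proof (induction k arbitrary: i)
  case 0
  show ?case by (simp add: Sym_0 Sym_1)
next
  case (Suc k)
  show ?case unfolding power_Suc by (rule Sym_coeff_mult[OF assms Suc])
qed

lemma ribbon_like_ribbon: "ribbon_like (\<lambda>n. [:complete_h n:]) (\<lambda>p. [:ribbon p:])"
proof
  show "[:ribbon (replicate l False):] = [:complete_h (Suc l):]" for l
    unfolding ribbon_ascents ..
  show "[:ribbon (replicate l False @ True # p):] =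
      [:complete_h (Suc l):] * [:ribbon p:] - [:ribbon (replicate (Suc l) False @ p):]" for l p
    unfolding ribbon_descent by simp
qed

theorem corollary3p2:
  fixes n :: nat
  assumes "n \<ge> 1"
  shows "Q n = (\<Sum>k = 0..(n - 1) div 2.
            smult (gamma_hook n k) (tvar ^ k * (1 + tvar) ^ (n - 1 - 2 * k)))
         \<and> schur_gamma_positive (Q n)"
proof
  \<comment> \<open>A hook with n cells has m = n - 1 steps; this is the degree d of the
    \<gamma>-expansion.\<close>
  obtain m where n: "n = Suc m" using assms by (cases n) simp_all
  let ?w = "\<lambda>k. tvar ^ k * (1 + tvar) ^ (m - 2 * k)"
  let ?P = "\<lambda>k. {p \<in> good_pats m. count_list p True = k}"
  have smult: "smult c q = q * [:c:]" for c :: xseries and q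
    by simp
  have "Q n = (\<Sum>p\<in>good_pats m. ?w (count_list p True) * [:ribbon p:])"
    using Q_eq_pat_sum[OF ribbon_like_ribbon assms]
    unfolding pat_sum_def n diff_Suc_1 replicate_0 append_Nil .
  \<comment> \<open>Patterns are grouped by their number k of descents, which is the number of
    columns of size 2 and alone determines the weight.\<close>
  also have "\<dots> = (\<Sum>k\<in>{0..m div 2}. \<Sum>p\<in>?P k. ?w (count_list p True) * [:ribbon p:])"
  proof (rule sum.group[symmetric])
    show "(\<lambda>p. count_list p True) ` good_pats m \<subseteq> {0..m div 2}"
    proof (rule image_subsetI)
      fix p assume "p \<in> good_pats m"
      then show "count_list p True \<in> {0..m div 2}"
        using good_downs_le[of p] by (simp add: good_pats_def)
    qed
  qed simp_all
  also have "\<dots> = (\<Sum>k\<in>{0..m div 2}. smult (gamma_hook n k) (?w k))"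
  proof (rule sum.cong[OF refl])
    fix k
    have "(\<Sum>p\<in>?P k. ?w (count_list p True) * [:ribbon p:]) = (\<Sum>p\<in>?P k. ?w k * [:ribbon p:])"
      by (rule sum.cong[OF refl]) (simp only: mem_Collect_eq)
    also have "\<dots> = ?w k * (\<Sum>p\<in>?P k. [:ribbon p:])"
      by (rule sum_distrib_left[symmetric])
    also have "(\<Sum>p\<in>?P k. [:ribbon p:]) = [:gamma_hook n k:]"
      unfolding n gamma_hook_Suc by (rule poly_eqI) (simp add: coeff_sum coeff_pCons split: nat.split)
    finally show "(\<Sum>p\<in>?P k. ?w (count_list p True) * [:ribbon p:]) = smult (gamma_hook n k) (?w k)"
      unfolding smult .
  qed
  finally show Q: "Q n = (\<Sum>k = 0..(n - 1) div 2.
            smult (gamma_hook n k) (tvar ^ k * (1 + tvar) ^ (n - 1 - 2 * k)))"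
    by (simp only: n diff_Suc_1)
  have tvar: "coeff tvar i \<in> \<Lambda>" "coeff (1 + tvar) i \<in> \<Lambda>" for i
    by (auto simp: coeff_pCons one_pCons Sym_0 Sym_1 split: nat.split)
  have "schur_positive (gamma_hook n k)" for k
    unfolding n by (rule schur_positive_gamma_hook)
  moreover from this have "gamma_hook n k \<in> \<Lambda>" for k
    by (simp add: schur_positive_def)
  then have "coeff (Q n) i \<in> \<Lambda>" for i
    unfolding Q coeff_sum coeff_smult
    by (intro Sym_sum Sym_mult Sym_coeff_mult Sym_coeff_power tvar)
  ultimately show "schur_gamma_positive (Q n)"
    unfolding schur_gamma_positive_def using Q by blast
qed

end
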